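(* Let $\varphi:\mathbb{R}^n\to\mathbb{R}$ be of class $C^{1,1}$ and bounded from below, and let $x^0\in\mathbb{R}^n$ be such that for every $x\in\mathbb{R}^n$ with $\varphi(x)\le\varphi(x^0)$ the generalized Hessian $\partial^2\varphi(x)$ is positive-semidefinite. Let $\{x^k\}$ be an infinite sequence generated by Algorithm GRNM-W (described in the context) started at $x^0$, where for some constants $m_{\mathrm{upper}}\ge m_{\mathrm{lower}}>0$ all the eigenvalues of all the matrices $B_k$ lie in $[m_{\mathrm{lower}}^2,m_{\mathrm{upper}}^2]$. Let $\bar x$ be an accumulation point of $\{x^k\}$ such that $\nabla\varphi$ is metrically regular around $\bar x$. Then $\bar x$ is a tilt-stable local minimizer of $\varphi$, and $\{x^k\}$ converges to $\bar x$ with the following rates: (i) $\{\varphi(x^k)\}$ converges Q-linearly to $\varphi(\bar x)$. (ii) $\{x^k\}$ and $\{\nabla\varphi(x^k)\}$ converge R-linearly to $\bar x$ and $0$, respectively. (iii) The convergence of $\{x^k\}$, $\{\varphi(x^k)\}$ and $\{\nabla\varphi(x^k)\}$ (to $\bar x$, $\varphi(\bar x)$ and $0$) is Q-superlinear if $\nabla\varphi$ is semismooth$^*$ at $\bar x$ and one of the following holds: (a) $\nabla\varphi$ is directionally differentiable at $\bar x$ and $\sigma_1\in(0,\tfrac12)$; (b) $\sigma_1\in\big(0,\tfrac{1}{2l\kappa}\big)$ and $\sigma_2\in\big(1-\tfrac{1}{l\kappa},1\big)$, where $\kappa>0$ and $l>0$ are moduli of metric regularity and of Lipschitz continuity of $\nabla\varphi$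 around $\bar x$, respectively.
   Context: A function is of class $C^{1,1}$ if it is continuously differentiable with locally Lipschitz gradient. For a set $\Omega\subset\mathbb{R}^s$ and $\bar z\in\Omega$, the regular normal cone is $\widehat N_\Omega(\bar z)=\{v\mid \limsup_{z\to\bar z,\,z\in\Omega}\langle v,z-\bar z\rangle/\|z-\bar z\|\le 0\}$, and the limiting normal cone $N_\Omega(\bar z)$ is the set of all $v$ for which there are $z_k\to\bar z$ with $z_k\in\Omega$, and $v_k\to v$ with $v_k\in\widehat N_\Omega(z_k)$. The directional normal cone in direction $d$ is $N_\Omega(\bar z;d)=\{v\mid\exists\,t_k\downarrow0,\ d_k\to d,\ v_k\to v\text{ with }v_k\in\widehat N_\Omega(\bar z+t_kd_k)\}$. For $\varphi$ of class $C^{1,1}$, the generalized Hessian at $x$ is the set-valued mapping $\partial^2\varphi(x):\mathbb{R}^n\rightrightarrows\mathbb{R}^n$, $\partial^2\varphi(x)(u)=\{z\mid (z,-u)\in N_{\mathrm{gph}\,\nabla\varphi}(x,\nabla\varphi(x))\}$. It is positive-semidefinite if $\langle z,u\rangle\ge 0$ for all $u\in\mathbb{R}^n$ and all $z\in\partial^2\varphi(x)(u)$. A mapping $F:\mathbb{R}^n\rightrightarrows\mathbb{R}^m$ is metrically regular around $(\bar x,\bar y)\in\mathrm{gph}\,F$ with modulus $\kappa>0$ if there are neighborhoods $U$ of $\bar x$ and $V$ of $\bar y$ with $\mathrm{dist}(x;F^{-1}(y))\le\kappa\,\mathrm{dist}(y;F(x))$ for all $(x,y)\in U\times V$ (for single-valued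 $F$, $\bar y=F(\bar x)$ is omitted). $F$ is semismooth$^*$ at $(\bar x,\bar y)\in\mathrm{gph}\,F$ if for all $(u,v)\in\mathbb{R}^n\times\mathbb{R}^m$ and all $(q,p)$ with $(p,-q)\in N_{\mathrm{gph}\,F}((\bar x,\bar y);(u,v))$ one has $\langle p,u\rangle=\langle q,v\rangle$. $\bar x$ is a tilt-stable local minimizer of $\varphi$ if for some $\gamma>0$ the mapping $M_\gamma:v\mapsto\mathrm{argmin}\{\varphi(x)-\langle v,x\rangle\mid \|x-\bar x\|<\gamma\}$ is single-valued and Lipschitz continuous on some neighborhood of $0$ with $M_\gamma(0)=\{\bar x\}$. Convergence rates for $y^k\to\bar y$ with $y^k\ne\bar y$ for all $k$: R-linear if there are $\mu\in(0,1)$, $C>0$ with $\|y^k-\bar y\|\le C\mu^k$ for all large $k$; Q-linear if there is $\mu\in(0,1)$ with $\|y^{k+1}-\bar y\|\le\mu\|y^k-\bar y\|$ for all large $k$; Q-superlinear if $\|y^{k+1}-\bar y\|/\|y^k-\bar y\|\to0$. Algorithm GRNM-W. Input: $x^0\in\mathbb{R}^n$, $c>0$, $0<\sigma_1<\sigma_2<1$, $\rho\in(0,1]$. For $k=0,1,\ldots$: (1) If $\nabla\varphi(x^k)=0$, stop; otherwise set $\mu_k=c\|\nabla\varphi(x^k)\|^\rho$. (2) Choose a symmetric positive-definite matrix $B_k$ and find $d^k\in\mathbb{R}^n$ with $-\nabla\varphi(x^k)\in\partial^2\varphi(x^k)(d^k)+\mu_kB_kd^k$. (3) If $\tau_k=1$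 satisfies the Wolfe conditions $$\varphi(x^k+\tau_kd^k)\le\varphi(x^k)+\sigma_1\tau_k\langle\nabla\varphi(x^k),d^k\rangle,\qquad \langle\nabla\varphi(x^k+\tau_kd^k),d^k\rangle\ge\sigma_2\langle\nabla\varphi(x^k),d^k\rangle,$$ take $\tau_k=1$; otherwise take any $\tau_k>0$ satisfying them. It is assumed that the stepsizes used by the implementation are bounded above by some constant $\tau_{\max}$. (4) Set $x^{k+1}=x^k+\tau_kd^k$. *)

theory Defs
  imports "HOL-Analysis.Analysis"
begin

section \<open>Smooth functions\<close>

definition gradient :: "('a::euclidean_space \<Rightarrow> real) \<Rightarrow> 'a \<Rightarrow> 'a" where
  "gradient f x = (THE D. GDERIV f x :> D)"

definition lipschitz_around :: "real \<Rightarrow> ('a::metric_space \<Rightarrow> 'b::metric_space) \<Rightarrow> 'a \<Rightarrow> bool" where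
  "lipschitz_around l f x \<longleftrightarrow> (\<exists>U. open U \<and> x \<in> U \<and> l-lipschitz_on U f)"

definition C11 :: "('a::euclidean_space \<Rightarrow> real) \<Rightarrow> bool" where
  "C11 f \<longleftrightarrow>
     (\<forall>x. \<exists>D. GDERIV f x :> D) \<and>
     continuous_on UNIV (gradient f) \<and>
     (\<forall>x. \<exists>l. lipschitz_around l (gradient f) x)"

definition directionally_differentiable_at ::
    "('a::real_normed_vector \<Rightarrow> 'b::real_normed_vector) \<Rightarrow> 'a \<Rightarrow> bool" where
  "directionally_differentiable_at f x \<longleftrightarrow>
     (\<forall>h. \<exists>D. ((\<lambda>t::real. (f (x + t *\<^sub>R h) - f x) /\<^sub>R t) \<longlongrightarrow> D) (at_right 0))"

section \<open>Normal cones\<close>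

text \<open>All cones are empty at points outside the set. At an isolated point of \<open>\<Omega>\<close> the filter
  \<open>at z within \<Omega>\<close> is trivial, the upper limit is \<open>-\<infinity>\<close>, and the regular normal cone is the
  whole space.\<close>

definition regular_normal_cone :: "'a::euclidean_space set \<Rightarrow> 'a \<Rightarrow> 'a set" where
  "regular_normal_cone \<Omega> z =
     {v. z \<in> \<Omega> \<and>
         Limsup (at z within \<Omega>) (\<lambda>y. ereal (inner v (y - z) / norm (y - z))) \<le> 0}"

definition limiting_normal_cone :: "'a::euclidean_space set \<Rightarrow> 'a \<Rightarrow> 'a set" where
  "limiting_normal_cone \<Omega> z =
     {v. z \<in> \<Omega> \<and>
         (\<exists>zs vs. (\<forall>k::nat. zs k \<in> \<Omega> \<and> vs k \<in> regular_normal_cone \<Omega> (zs k)) \<and>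
                  zs \<longlonglongrightarrow> z \<and> vs \<longlonglongrightarrow> v)}"

definition directional_normal_cone :: "'a::euclidean_space set \<Rightarrow> 'a \<Rightarrow> 'a \<Rightarrow> 'a set" where
  "directional_normal_cone \<Omega> z d =
     {v. z \<in> \<Omega> \<and>
         (\<exists>t ds vs. (\<forall>k::nat. (t k :: real) > 0 \<and>
                        vs k \<in> regular_normal_cone \<Omega> (z + t k *\<^sub>R ds k)) \<and>
                    t \<longlonglongrightarrow> 0 \<and> ds \<longlonglongrightarrow> d \<and> vs \<longlonglongrightarrow> v)}"

section \<open>Set-valued mappings\<close>

definition gph :: "('a \<Rightarrow> 'b set) \<Rightarrow> ('a \<times> 'b) set" where
  "gph F = {(x, y). y \<in> F x}"

abbreviation single :: "('a \<Rightarrow> 'b) \<Rightarrow> 'a \<Rightarrow> 'b set" where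
  "single f \<equiv> (\<lambda>x. {f x})"

text \<open>The distance to the empty set is \<open>\<infinity>\<close>, in contrast to \<open>infdist x {} = 0\<close>.\<close>

definition dist_set :: "'a::metric_space \<Rightarrow> 'a set \<Rightarrow> ereal" where
  "dist_set x S = (INF y\<in>S. ereal (dist x y))"

definition metrically_regular ::
    "real \<Rightarrow> ('a::euclidean_space \<Rightarrow> 'b::euclidean_space set) \<Rightarrow> 'a \<Rightarrow> 'b \<Rightarrow> bool" where
  "metrically_regular \<kappa> F x y \<longleftrightarrow>
     \<kappa> > 0 \<and> (x, y) \<in> gph F \<and>
     (\<exists>U V. open U \<and> x \<in> U \<and> open V \<and> y \<in> V \<and>
        (\<forall>x'\<in>U. \<forall>y'\<in>V. dist_set x' {w. y' \<in> F w} \<le> ereal \<kappa> * dist_set y' (F x')))"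

definition semismooth_star ::
    "('a::euclidean_space \<Rightarrow> 'b::euclidean_space set) \<Rightarrow> 'a \<Rightarrow> 'b \<Rightarrow> bool" where
  "semismooth_star F x y \<longleftrightarrow>
     (x, y) \<in> gph F \<and>
     (\<forall>u v p q. (p, - q) \<in> directional_normal_cone (gph F) (x, y) (u, v) \<longrightarrow>
        inner p u = inner q v)"

definition generalized_hessian ::
    "('a::euclidean_space \<Rightarrow> real) \<Rightarrow> 'a \<Rightarrow> 'a \<Rightarrow> 'a set" where
  "generalized_hessian \<phi> x u =
     {z. (z, - u) \<in> limiting_normal_cone (gph (single (gradient \<phi>))) (x, gradient \<phi> x)}"

definition positive_semidefinite_mapping :: "('a::euclidean_space \<Rightarrow> 'a set) \<Rightarrow> bool" where
  "positive_semidefinite_mapping H \<longleftrightarrow> (\<forall>u. \<forall>z\<in>H u. inner z u \<ge> 0)"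

section \<open>Tilt stability\<close>

definition tilted_argmin ::
    "('a::euclidean_space \<Rightarrow> real) \<Rightarrow> 'a \<Rightarrow> real \<Rightarrow> 'a \<Rightarrow> 'a set" where
  "tilted_argmin \<phi> xbar \<gamma> v =
     {x. is_arg_min (\<lambda>x. \<phi> x - inner v x) (\<lambda>x. norm (x - xbar) < \<gamma>) x}"

definition tilt_stable_local_minimizer :: "('a::euclidean_space \<Rightarrow> real) \<Rightarrow> 'a \<Rightarrow> bool" where
  "tilt_stable_local_minimizer \<phi> xbar \<longleftrightarrow>
     (\<exists>\<gamma>>0. tilted_argmin \<phi> xbar \<gamma> 0 = {xbar} \<and>
        (\<exists>V m L. open V \<and> 0 \<in> V \<and>
           (\<forall>v\<in>V. tilted_argmin \<phi> xbar \<gamma> v = {m v}) \<and> L-lipschitz_on V m))"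

section \<open>Convergence rates\<close>

definition accumulation_point :: "(nat \<Rightarrow> 'a::metric_space) \<Rightarrow> 'a \<Rightarrow> bool" where
  "accumulation_point y ybar \<longleftrightarrow> (\<exists>r. strict_mono (r :: nat \<Rightarrow> nat) \<and> (y \<circ> r) \<longlonglongrightarrow> ybar)"

definition R_linear :: "(nat \<Rightarrow> 'a::real_normed_vector) \<Rightarrow> 'a \<Rightarrow> bool" where
  "R_linear y ybar \<longleftrightarrow>
     y \<longlonglongrightarrow> ybar \<and> (\<forall>k. y k \<noteq> ybar) \<and>
     (\<exists>\<mu> C. 0 < \<mu> \<and> \<mu> < 1 \<and> 0 < C \<and>
        (\<forall>\<^sub>F k in sequentially. norm (y k - ybar) \<le> C * \<mu> ^ k))"

definition Q_linear :: "(nat \<Rightarrow> 'a::real_normed_vector) \<Rightarrow> 'a \<Rightarrow> bool" where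
  "Q_linear y ybar \<longleftrightarrow>
     y \<longlonglongrightarrow> ybar \<and> (\<forall>k. y k \<noteq> ybar) \<and>
     (\<exists>\<mu>. 0 < \<mu> \<and> \<mu> < 1 \<and>
        (\<forall>\<^sub>F k in sequentially. norm (y (Suc k) - ybar) \<le> \<mu> * norm (y k - ybar)))"

definition Q_superlinear :: "(nat \<Rightarrow> 'a::real_normed_vector) \<Rightarrow> 'a \<Rightarrow> bool" where
  "Q_superlinear y ybar \<longleftrightarrow>
     y \<longlonglongrightarrow> ybar \<and> (\<forall>k. y k \<noteq> ybar) \<and>
     (\<lambda>k. norm (y (Suc k) - ybar) / norm (y k - ybar)) \<longlonglongrightarrow> 0"

section \<open>The algorithm\<close>

definition symmetric_positive_definite :: "real^'n^'n \<Rightarrow> bool" where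
  "symmetric_positive_definite A \<longleftrightarrow>
     transpose A = A \<and> (\<forall>u. u \<noteq> 0 \<longrightarrow> inner u (A *v u) > 0)"

definition eigenvalue :: "real^'n^'n \<Rightarrow> real \<Rightarrow> bool" where
  "eigenvalue A e \<longleftrightarrow> (\<exists>u. u \<noteq> 0 \<and> A *v u = e *\<^sub>R u)"

definition wolfe ::
    "('a::euclidean_space \<Rightarrow> real) \<Rightarrow> real \<Rightarrow> real \<Rightarrow> 'a \<Rightarrow> 'a \<Rightarrow> real \<Rightarrow> bool" where
  "wolfe \<phi> \<sigma>1 \<sigma>2 x d \<tau> \<longleftrightarrow>
     \<phi> (x + \<tau> *\<^sub>R d) \<le> \<phi> x + \<sigma>1 * \<tau> * inner (gradient \<phi> x) d \<and>
     inner (gradient \<phi> (x + \<tau> *\<^sub>R d)) d \<ge> \<sigma>2 * inner (gradient \<phi> x) d"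

text \<open>A run that never stops: \<open>x\<close>, \<open>B\<close>, \<open>d\<close>, \<open>\<tau>\<close> are the sequences of iterates, regularization
  matrices, directions and stepsizes, and the stopping test fails at every iteration.\<close>

definition GRNM_W_infinite_run ::
    "(real^'n \<Rightarrow> real) \<Rightarrow> real \<Rightarrow> real \<Rightarrow> real \<Rightarrow> real \<Rightarrow> real \<Rightarrow> real^'n \<Rightarrow>
     (nat \<Rightarrow> real^'n) \<Rightarrow> (nat \<Rightarrow> real^'n^'n) \<Rightarrow> (nat \<Rightarrow> real^'n) \<Rightarrow> (nat \<Rightarrow> real) \<Rightarrow> bool" where
  "GRNM_W_infinite_run \<phi> c \<sigma>1 \<sigma>2 \<rho> \<tau>max x0 x B d \<tau> \<longleftrightarrow>
     c > 0 \<and> 0 < \<sigma>1 \<and> \<sigma>1 < \<sigma>2 \<and> \<sigma>2 < 1 \<and> 0 < \<rho> \<and> \<rho> \<le> 1 \<and>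
     x 0 = x0 \<and>
     (\<forall>k. gradient \<phi> (x k) \<noteq> 0 \<and>
          symmetric_positive_definite (B k) \<and>
          (let \<mu> = c * norm (gradient \<phi> (x k)) powr \<rho> in
             \<exists>z\<in>generalized_hessian \<phi> (x k) (d k).
               - gradient \<phi> (x k) = z + \<mu> *\<^sub>R (B k *v d k)) \<and>
          (if wolfe \<phi> \<sigma>1 \<sigma>2 (x k) (d k) 1 then \<tau> k = 1
           else \<tau> k > 0 \<and> wolfe \<phi> \<sigma>1 \<sigma>2 (x k) (d k) (\<tau> k)) \<and>
          \<tau> k \<le> \<tau>max \<and>
          x (Suc k) = x k + \<tau> k *\<^sub>R d k)"

end

theory Submission
  imports Defs
begin

text \<open>
  Elements of the generalized Hessian are limits of regular subgradients \<open>z\<close> of the scalar functions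
  \<open>\<langle>u, \<nabla>\<phi>\<rangle>\<close>, and an approximate mean value inequality for regular subgradients replaces integration
  along segments. It shows that \<open>\<nabla>\<phi>\<close> is monotone near \<open>xbar\<close>. Monotonicity and metric regularity
  make \<open>\<nabla>\<phi>\<close> locally invertible with a \<open>\<kappa>\<close>-Lipschitz inverse; this inverse is the gradient of the
  conjugate of \<open>\<phi>\<close>, and duality gives strong convexity of \<open>\<phi>\<close> with modulus \<open>1 / \<kappa>\<close> near \<open>xbar\<close>, hence
  tilt stability and, through the Wolfe conditions, the linear rates.

  For the superlinear rates, mixed second differences of \<open>\<phi>\<close> yield a symmetry of the generalized
  Hessian: every \<open>z\<close> at \<open>d\<close> is matched, for every \<open>w\<close>, by a \<open>z'\<close> at \<open>w\<close> with \<open>\<langle>z', d\<rangle> \<le> \<langle>z, w\<rangle>\<close> up to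
  a small error. Taking \<open>w = e = x + d - xbar\<close> in the Newton equation, semismoothness of \<open>\<nabla>\<phi>\<close> gives
  \<open>|e| = o(|x - xbar|)\<close>, after which the unit step passes the Wolfe test.
\<close>

text \<open>The gradient is only locally Lipschitz, so second-order information consists of
  one-sided inequalities for the scalarizations, valid near the given point and up to errors. Base
  point, direction and value of a Hessian element all move before a limit is taken; hence the basic
  estimates are proved on whole balls and uniformly in the direction. The choice
  \<open>w = e\<close> is dictated by \<open>e = d + (x - xbar)\<close>: symmetry carries the
  pairing of \<open>z'\<close> with \<open>d\<close> to that of \<open>z\<close> with
  \<open>e\<close>, semismoothness carries the pairing with \<open>x - xbar\<close> to that of the
  gradient with \<open>e\<close>, and the sum pairs \<open>e\<close> with the Newton residual, which
  is \<open>o(|x - xbar|)\<close> because \<open>\<mu> k\<close> tends to 0. Strong convexity bounds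
  the same sum below by \<open>|e|^2 / \<kappa>\<close>. The constant must be exactly
  \<open>1 / \<kappa>\<close>: with \<open>h = x - xbar\<close>, \<open>\<phi>\<close> grows by
  \<open>|h|^2 / (2 \<kappa>)\<close> while the gradient paired with \<open>h\<close> is at most
  \<open>l |h|^2\<close>, so \<open>\<sigma>1 < 1 / (2 l \<kappa>)\<close> just leaves a surplus in
  the Armijo test. Criticality of \<open>xbar\<close> precedes all this; there only the
  regularization provides curvature.\<close>

section \<open>Regular subgradients\<close>

text \<open>The Frechet subdifferential in epsilon form. At \<open>x = y\<close> the inequality is
  an equality, so \<open>nhds y\<close> may replace the punctured filter, and curves through
  \<open>y\<close> can be composed freely.\<close>

definition regular_subgradient :: "('a::euclidean_space \<Rightarrow> real) \<Rightarrow> 'a \<Rightarrow> 'a \<Rightarrow> bool" where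
  "regular_subgradient h y z \<longleftrightarrow>
     (\<forall>\<epsilon>>0. \<forall>\<^sub>F x in nhds y. h y + inner z (x - y) - \<epsilon> * norm (x - y) \<le> h x)"

text \<open>Proximal subgradients are regular: within distance \<open>\<epsilon> / K\<close> the
  quadratic term is at most \<open>\<epsilon>\<close> times the distance.\<close>

lemma regular_subgradient_if_quadratic_minorant:
  assumes "\<forall>\<^sub>F x in nhds y. h y + inner z (x - y) - K * (norm (x - y))\<^sup>2 \<le> h x" "0 < K"
  shows "regular_subgradient h y z"
  unfolding regular_subgradient_def
proof (intro allI impI)
  fix \<epsilon> :: real assume "\<epsilon> > 0"
  have "\<forall>\<^sub>F x in nhds y. x \<in> ball y (\<epsilon> / K)"
    by (rule eventually_nhds_in_open) (use \<open>\<epsilon> > 0\<close> \<open>0 < K\<close> in auto)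
  with assms(1) show "\<forall>\<^sub>F x in nhds y. h y + inner z (x - y) - \<epsilon> * norm (x - y) \<le> h x"
  proof eventually_elim
    case (elim x)
    have "norm (x - y) < \<epsilon> / K" using elim(2) by (simp add: dist_norm norm_minus_commute)
    hence "K * norm (x - y) \<le> \<epsilon>" using \<open>0 < K\<close> by (simp add: field_simps)
    hence "K * norm (x - y) * norm (x - y) \<le> \<epsilon> * norm (x - y)"
      by (rule mult_right_mono) simp
    with elim(1) show ?case by (simp add: power2_eq_square mult.assoc)
  qed
qed

lemma norm_add_square: "(norm (a + b))\<^sup>2 = (norm a)\<^sup>2 + 2 * inner a b + (norm b)\<^sup>2"
  for a b :: "'a::real_inner"
  by (simp add: power2_norm_eq_inner inner_add inner_commute algebra_simps)

text \<open>The minimizer \<open>(s, x)\<close> of \<open>h x + K |x - a - s u|\<^sup>2 - (m - \<epsilon>) s\<close> has \<open>s > 0\<close> once \<open>K\<close> is large;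
  stationarity in \<open>x\<close> produces a subgradient \<open>z\<close>, and stationarity in \<open>s\<close> bounds \<open>\<langle>z, u\<rangle>\<close>.\<close>

lemma approximate_mean_value_inequality:
  fixes h :: "'a::euclidean_space \<Rightarrow> real"
  assumes cont: "continuous_on (ball c R) h" and a: "a \<in> ball c R" and b: "b \<in> ball c R"
    and sub: "\<And>y z. y \<in> ball c R \<Longrightarrow> regular_subgradient h y z \<Longrightarrow> m \<le> inner z (b - a)"
  shows "m \<le> h b - h a"
proof (rule ccontr)
  assume "\<not> m \<le> h b - h a"
  \<comment> \<open>The deficit is split in three: one \<open>\<epsilon>\<close> lowers the slope in
    \<open>F\<close> to \<open>m - \<epsilon>\<close>, one covers the variation of \<open>h\<close>
    near \<open>a\<close> when \<open>s = 0\<close> is excluded, and one keeps that exclusion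
    strict.\<close>
  define \<epsilon> where "\<epsilon> = (m - (h b - h a)) / 3"
  have e0: "\<epsilon> > 0" using \<open>\<not> m \<le> h b - h a\<close> by (simp add: \<epsilon>_def)
  have m_eq: "h b - m = h a - 3 * \<epsilon>" by (simp add: \<epsilon>_def field_simps)
  define u where "u = b - a"
  define r0 where "r0 = max (dist c a) (dist c b)"
  define r1 where "r1 = (r0 + R) / 2"
  have "r0 < R" using a b by (auto simp: r0_def)
  hence r: "r0 < r1" "r1 < R" by (auto simp: r1_def)
  have seg: "a + s *\<^sub>R u \<in> cball c r0" if "s \<in> {0..1}" for s
  proof -
    have "a \<in> cball c r0" "b \<in> cball c r0" by (auto simp: r0_def)
    hence "(1 - s) *\<^sub>R a + s *\<^sub>R b \<in> cball c r0"
      using that by (intro convexD_alt convex_cball) auto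
    thus ?thesis by (simp add: u_def algebra_simps)
  qed
  let ?C = "cball c r1"
  have CR: "?C \<subseteq> ball c R" using r by auto
  have contC: "continuous_on ?C h" using cont CR continuous_on_subset by blast
  have "bounded (h ` ?C)"
    by (intro compact_imp_bounded compact_continuous_image contC compact_cball)
  then obtain M where M: "\<And>x. x \<in> ?C \<Longrightarrow> \<bar>h x\<bar> \<le> M"
    unfolding bounded_iff by (metis imageI real_norm_def)
  have aC: "a \<in> ?C" and bC: "b \<in> ?C" using r by (auto simp: r0_def)
  hence M0: "0 \<le> M" using M[OF aC] by linarith
  have "isCont h a" using cont a by (simp add: continuous_on_eq_continuous_at)
  then obtain \<delta> where d0: "\<delta> > 0" and \<delta>: "\<And>x. dist x a < \<delta> \<Longrightarrow> dist (h x) (h a) < \<epsilon>"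
    using e0 unfolding continuous_at_eps_delta by blast
  define q where "q = min \<delta> (r1 - r0)"
  have q0: "q > 0" using d0 r by (simp add: q_def)
  define A where "A = \<bar>m - \<epsilon>\<bar>"
  have A0: "0 \<le> A" by (simp add: A_def)
  \<comment> \<open>Comparison with \<open>(1, b)\<close> bounds the penalty at the minimizer by the
    oscillation of \<open>h\<close> plus \<open>A\<close>, hence by less than \<open>T\<close>;
    dividing by \<open>q^2\<close> makes \<open>K\<close> force \<open>x\<close> to within
    \<open>q\<close> of the segment.\<close>
  define T where "T = 2 * M + 2 * A + 1"
  have T0: "T > 0" using M0 A0 by (simp add: T_def)
  define K where "K = T / q\<^sup>2"
  have K0: "K > 0" using T0 q0 by (simp add: K_def)
  define F where "F = (\<lambda>(s, x). h x + K * (norm (x - (a + s *\<^sub>R u)))\<^sup>2 - (m - \<epsilon>) * s)"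
  have "continuous_on ({0..1} \<times> ?C) F"
    unfolding F_def case_prod_unfold
    by (intro continuous_intros continuous_on_compose2[OF contC]) auto
  moreover have "compact ({0..1::real} \<times> ?C)" by (intro compact_Times) auto
  moreover have "{0..1::real} \<times> ?C \<noteq> {}" using aC by (metis SigmaI atLeastAtMost_iff empty_iff order_refl zero_le_one)
  ultimately obtain sx where sx: "sx \<in> {0..1} \<times> ?C" "\<And>w. w \<in> {0..1} \<times> ?C \<Longrightarrow> F sx \<le> F w"
    using continuous_attains_inf by metis
  obtain s x where sx_eq: "sx = (s, x)" by force
  have s01: "0 \<le> s" "s \<le> 1" and xC: "x \<in> ?C" using sx sx_eq by auto
  define p where "p = a + s *\<^sub>R u"
  have F1b: "F (1, b) = h a - 2 * \<epsilon>" using m_eq by (simp add: F_def u_def)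
  have le1: "F (s, x) \<le> h a - 2 * \<epsilon>" using sx(2)[of "(1, b)"] bC by (simp add: sx_eq F1b)
  have "\<bar>(m - \<epsilon>) * s\<bar> \<le> A"
    using s01 by (simp add: abs_mult mult_left_le A_def)
  hence "(m - \<epsilon>) * s \<le> A" by linarith
  hence "K * (norm (x - p))\<^sup>2 < T"
    using le1 M[OF xC] M[OF aC] e0 A0 unfolding F_def p_def T_def abs_le_iff prod.case by linarith
  hence "(norm (x - p))\<^sup>2 < q\<^sup>2"
    using q0 T0 by (simp add: K_def field_simps)
  hence xp: "norm (x - p) < q" using q0 by (simp add: power2_less_imp_less)
  have s0: "s > 0"
  proof (rule ccontr)
    assume "\<not> s > 0"
    hence "s = 0" using s01 by simp
    hence "dist x a < \<delta>" using xp by (simp add: p_def q_def dist_norm)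
    hence "\<bar>h x - h a\<bar> < \<epsilon>" using \<delta> by (simp add: dist_real_def)
    hence "h x > h a - \<epsilon>" by linarith
    moreover have "F (s, x) \<ge> h x" using K0 by (simp add: F_def \<open>s = 0\<close>)
    ultimately show False using le1 e0 by linarith
  qed
  define z where "z = - (2 * K) *\<^sub>R (x - p)"
  have "regular_subgradient h x z"
  proof (rule regular_subgradient_if_quadratic_minorant[OF _ K0])
    have "dist c p \<le> r0" using seg[of s] s01 by (simp add: p_def)
    have "\<forall>\<^sub>F y in nhds x. y \<in> ball p q"
      by (rule eventually_nhds_in_open) (use xp in \<open>auto simp: dist_norm norm_minus_commute\<close>)
    thus "\<forall>\<^sub>F y in nhds x. h x + inner z (y - x) - K * (norm (y - x))\<^sup>2 \<le> h y"
    proof eventually_elim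
      case (elim y)
      have "dist c y \<le> dist c p + dist p y" by (rule dist_triangle)
      hence "y \<in> ?C" using elim \<open>dist c p \<le> r0\<close> by (simp add: q_def)
      hence "F (s, x) \<le> F (s, y)" using sx(2)[of "(s, y)"] s01 by (simp add: sx_eq)
      hence "h x + K * (norm (x - p))\<^sup>2 \<le> h y + K * (norm (y - p))\<^sup>2"
        by (simp add: F_def p_def)
      moreover have "(norm (y - p))\<^sup>2 = (norm (x - p))\<^sup>2 + 2 * inner (x - p) (y - x) + (norm (y - x))\<^sup>2"
        using norm_add_square[of "x - p" "y - x"] by simp
      ultimately show ?case by (simp add: z_def distrib_left)
    qed
  qed
  hence "m \<le> inner z u" using sub xC CR unfolding u_def by blast
  \<comment> \<open>Since \<open>s\<close> may equal 1, only a decrease of \<open>s\<close> is sure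
    to be admissible. The bound by \<open>s\<close> keeps \<open>s - \<theta>\<close> in the
    interval, the other entry makes \<open>K * \<theta> * |u|^2\<close> smaller than
    \<open>\<epsilon>\<close>.\<close>
  define \<theta> where "\<theta> = min s (\<epsilon> / (2 * K * ((norm u)\<^sup>2 + 1)))"
  have den: "2 * K * ((norm u)\<^sup>2 + 1) > 0" using K0 by (simp add: add_nonneg_pos)
  have th: "\<theta> > 0" "\<theta> \<le> s" using s0 e0 den by (auto simp: \<theta>_def)
  have "\<theta> \<le> \<epsilon> / (2 * K * ((norm u)\<^sup>2 + 1))" by (simp add: \<theta>_def)
  hence "\<theta> * (2 * K * ((norm u)\<^sup>2 + 1)) \<le> \<epsilon>" using den by (simp add: pos_le_divide_eq)
  moreover have "\<theta> * (K * (norm u)\<^sup>2) < \<theta> * (2 * K * ((norm u)\<^sup>2 + 1))"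
    using th K0 zero_le_power2[of "norm u"] by (intro mult_strict_left_mono) (auto simp: algebra_simps add_pos_nonneg)
  ultimately have small: "K * \<theta> * (norm u)\<^sup>2 < \<epsilon>" by (simp add: algebra_simps)
  have "F (s, x) \<le> F (s - \<theta>, x)" using sx(2)[of "(s - \<theta>, x)"] s01 th xC by (simp add: sx_eq)
  moreover have "x - (a + (s - \<theta>) *\<^sub>R u) = (x - p) + \<theta> *\<^sub>R u" by (simp add: p_def algebra_simps)
  ultimately have "K * (norm (x - p))\<^sup>2 - (m - \<epsilon>) * s \<le> K * (norm ((x - p) + \<theta> *\<^sub>R u))\<^sup>2 - (m - \<epsilon>) * (s - \<theta>)"
    by (simp add: F_def p_def)
  hence "0 \<le> \<theta> * (2 * K * inner (x - p) u + K * \<theta> * (norm u)\<^sup>2 + (m - \<epsilon>))"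
    unfolding norm_add_square by (simp add: algebra_simps power2_eq_square)
  hence "0 \<le> 2 * K * inner (x - p) u + K * \<theta> * (norm u)\<^sup>2 + (m - \<epsilon>)"
    using th by (simp add: zero_le_mult_iff)
  hence "inner z u \<le> K * \<theta> * (norm u)\<^sup>2 + (m - \<epsilon>)" by (simp add: z_def)
  with small \<open>m \<le> inner z u\<close> show False by linarith
qed

lemma DERIV_along_line:
  assumes "GDERIV f (p + t *\<^sub>R w) :> D"
  shows "((\<lambda>s. f (p + s *\<^sub>R w)) has_real_derivative inner D w) (at t)"
proof -
  have "((\<lambda>s. p + s *\<^sub>R w) has_derivative (\<lambda>h. h *\<^sub>R w)) (at t)"
    by (auto intro!: derivative_eq_intros)
  from diff_chain_at[OF this assms[unfolded gderiv_def]]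
  have "((\<lambda>s. f (p + s *\<^sub>R w)) has_derivative (\<lambda>h. h * inner D w)) (at t)"
    by (simp add: o_def inner_commute)
  thus ?thesis by (simp add: has_field_derivative_def mult_commute_abs)
qed

lemma increment_le_if_derivative_le:
  fixes f :: "real \<Rightarrow> real"
  assumes "a \<le> b" "\<And>s. a \<le> s \<Longrightarrow> s \<le> b \<Longrightarrow> (f has_real_derivative f' s) (at s)"
    "\<And>s. a \<le> s \<Longrightarrow> s \<le> b \<Longrightarrow> f' s \<le> m"
  shows "f b - f a \<le> m * (b - a)"
proof (cases "a = b")
  case False
  hence "a < b" using assms(1) by simp
  then obtain s where "a < s" "s < b" "f b - f a = (b - a) * f' s"
    using MVT2[of a b f f'] assms(2) by auto
  thus ?thesis using assms(3)[of s] \<open>a < b\<close> by (simp add: mult.commute)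
qed simp

text \<open>A substitute for the symmetry of second derivatives, obtained from mixed second differences.\<close>

lemma regular_subgradient_gradient_symmetry:
  fixes \<phi> :: "'a::euclidean_space \<Rightarrow> real"
  assumes gd: "\<And>x. GDERIV \<phi> x :> g x" and cont: "continuous_on UNIV g"
    and z: "regular_subgradient (\<lambda>x. inner d (g x)) y z" and eta: "\<eta> > 0"
  obtains y' z' where "dist y y' < \<eta>" "regular_subgradient (\<lambda>x. inner w (g x)) y' z'"
    "inner z' d \<le> inner z w + \<eta>"
proof (rule ccontr)
  assume "\<not> thesis"
  with that have neg: "inner z w + \<eta> < inner z' d"
    if "y' \<in> ball y \<eta>" "regular_subgradient (\<lambda>x. inner w (g x)) y' z'" for y' z'
    using that by (meson mem_ball not_le)
  \<comment> \<open>\<open>N\<close> exceeds \<open>|w| + |d|\<close>: the parallelogram spanned by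
    \<open>\<delta> d\<close> and \<open>- \<delta> w\<close> stays in the ball where
    \<open>neg\<close> holds, and \<open>|w| \<le> N\<close> beats the error term at the
    end.\<close>
  define N where "N = norm w + norm d + 1"
  have N0: "N > 0" by (simp add: N_def add_nonneg_pos)
  define \<delta> where "\<delta> = \<eta> / (2 * N)"
  have d0: "\<delta> > 0" using eta N0 by (simp add: \<delta>_def)
  have inball: "y - t *\<^sub>R w + s *\<^sub>R d \<in> ball y \<eta>" if "\<bar>t\<bar> \<le> \<delta>" "\<bar>s\<bar> \<le> \<delta>" for t s
  proof -
    have "norm (s *\<^sub>R d - t *\<^sub>R w) \<le> \<bar>s\<bar> * norm d + \<bar>t\<bar> * norm w"
      using norm_triangle_ineq4[of "s *\<^sub>R d" "t *\<^sub>R w"] by simp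
    also have "\<dots> \<le> \<delta> * norm d + \<delta> * norm w" using that by (intro add_mono mult_right_mono) auto
    also have "\<dots> < \<delta> * (2 * N)" using d0 by (simp add: N_def algebra_simps add_pos_nonneg add_nonneg_pos)
    also have "\<dots> = \<eta>" using N0 by (simp add: \<delta>_def)
    finally show ?thesis by (simp add: dist_norm norm_minus_commute)
  qed
  \<comment> \<open>Under \<open>neg\<close>, the scalarization by \<open>w\<close> grows too fast
    along \<open>d\<close>.\<close>
  have mono: "s * (inner z w + \<eta>) \<le> inner w (g (y - t *\<^sub>R w + s *\<^sub>R d) - g (y - t *\<^sub>R w))"
    if "0 \<le> s" "s \<le> \<delta>" "0 \<le> t" "t \<le> \<delta>" for s t
  proof -
    have "s * (inner z w + \<eta>) \<le> inner w (g (y - t *\<^sub>R w + s *\<^sub>R d)) - inner w (g (y - t *\<^sub>R w))"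
    proof (rule approximate_mean_value_inequality[where c = y and R = \<eta>
          and h = "\<lambda>x. inner w (g x)"])
      show "continuous_on (ball y \<eta>) (\<lambda>x. inner w (g x))"
        by (intro continuous_intros continuous_on_subset[OF cont]) auto
      show "y - t *\<^sub>R w \<in> ball y \<eta>" "y - t *\<^sub>R w + s *\<^sub>R d \<in> ball y \<eta>"
        using inball[of t 0] inball[of t s] that d0 by auto
      fix y' z' assume "y' \<in> ball y \<eta>" "regular_subgradient (\<lambda>x. inner w (g x)) y' z'"
      hence "inner z w + \<eta> \<le> inner z' d" using neg by fastforce
      thus "s * (inner z w + \<eta>) \<le> inner z' (y - t *\<^sub>R w + s *\<^sub>R d - (y - t *\<^sub>R w))"
        using that by (simp add: mult_left_mono)
    qed
    thus ?thesis by (simp add: inner_diff_right)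
  qed
  \<comment> \<open>Moving along \<open>- w\<close> turns the lower bound \<open>mono\<close> into
    an upper bound on the second difference, the sign that contradicts the lower bound supplied by
    \<open>z\<close>.\<close>
  have diff2: "(\<phi> (y - t *\<^sub>R w + s *\<^sub>R d) - \<phi> (y - t *\<^sub>R w)) - (\<phi> (y + s *\<^sub>R d) - \<phi> y)
      \<le> - (s * (inner z w + \<eta>)) * t" if "0 \<le> s" "s \<le> \<delta>" "0 \<le> t" "t \<le> \<delta>" for s t
  proof -
    let ?f = "\<lambda>t. \<phi> ((y + s *\<^sub>R d) + t *\<^sub>R (- w)) - \<phi> (y + t *\<^sub>R (- w))"
    have "?f t - ?f 0 \<le> - (s * (inner z w + \<eta>)) * (t - 0)"
    proof (rule increment_le_if_derivative_le)
      fix r assume r: "0 \<le> r" "r \<le> t"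
      show "(?f has_real_derivative
          inner (g ((y + s *\<^sub>R d) + r *\<^sub>R (- w))) (- w) - inner (g (y + r *\<^sub>R (- w))) (- w)) (at r)"
        by (intro DERIV_diff DERIV_along_line gd)
      show "inner (g ((y + s *\<^sub>R d) + r *\<^sub>R (- w))) (- w) - inner (g (y + r *\<^sub>R (- w))) (- w)
          \<le> - (s * (inner z w + \<eta>))"
        using mono[of s r] that r by (simp add: inner_diff_right inner_commute algebra_simps)
    qed fact
    thus ?thesis by (simp add: algebra_simps)
  qed
  \<comment> \<open>Dividing by \<open>s\<close> and letting \<open>s\<close> tend to 0
    differentiates \<open>\<phi>\<close> along \<open>d\<close>; \<open>g\<close> itself is never
    differentiated.\<close>
  have le: "inner d (g (y - t *\<^sub>R w) - g y) \<le> - (inner z w + \<eta>) * t" if "0 \<le> t" "t \<le> \<delta>" for t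
  proof -
    let ?f = "\<lambda>s. \<phi> (y - t *\<^sub>R w + s *\<^sub>R d) - \<phi> (y + s *\<^sub>R d)"
    have "(?f has_real_derivative
        inner (g (y - t *\<^sub>R w + 0 *\<^sub>R d)) d - inner (g (y + 0 *\<^sub>R d)) d) (at 0)"
      by (intro DERIV_diff DERIV_along_line gd)
    hence "((\<lambda>s. (?f s - ?f 0) / s) \<longlongrightarrow> inner d (g (y - t *\<^sub>R w) - g y)) (at 0)"
      by (simp add: has_field_derivative_iff inner_diff_right inner_commute)
    hence "((\<lambda>s. (?f s - ?f 0) / s) \<longlongrightarrow> inner d (g (y - t *\<^sub>R w) - g y)) (at_right 0)"
      by (rule tendsto_mono[OF at_le, rotated]) simp
    moreover have "\<forall>\<^sub>F s in at_right 0. (?f s - ?f 0) / s \<le> - (inner z w + \<eta>) * t"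
      unfolding eventually_at_right_field
    proof (intro exI[of _ \<delta>] conjI allI impI)
      fix s :: real assume "0 < s" "s < \<delta>"
      hence "?f s - ?f 0 \<le> - (inner z w + \<eta>) * t * s"
        using diff2[of s t] that by (simp add: algebra_simps)
      thus "(?f s - ?f 0) / s \<le> - (inner z w + \<eta>) * t"
        using \<open>0 < s\<close> by (simp only: pos_divide_le_eq)
    qed fact
    ultimately show ?thesis by (rule tendsto_upperbound) simp
  qed
  define \<epsilon> where "\<epsilon> = \<eta> / (2 * N)"
  have "\<epsilon> > 0" using eta N0 by (simp add: \<epsilon>_def)
  with z have ev: "\<forall>\<^sub>F x in nhds y. inner d (g y) + inner z (x - y) - \<epsilon> * norm (x - y) \<le> inner d (g x)"
    by (auto simp: regular_subgradient_def)
  have "((\<lambda>t. y - t *\<^sub>R w) \<longlongrightarrow> y - 0 *\<^sub>R w) (at_right 0)" by (intro tendsto_intros)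
  hence "filterlim (\<lambda>t. y - t *\<^sub>R w) (nhds y) (at_right 0)" by simp
  from eventually_compose_filterlim[OF ev this]
  have "\<forall>\<^sub>F t in at_right 0. inner d (g y) - t * inner z w - \<epsilon> * (\<bar>t\<bar> * norm w) \<le> inner d (g (y - t *\<^sub>R w))"
    by simp
  moreover have "\<forall>\<^sub>F t in at_right (0::real). 0 < t \<and> t < \<delta>"
    using d0 by (auto simp: eventually_at_right_field)
  ultimately have "\<forall>\<^sub>F t in at_right (0::real). False"
  proof eventually_elim
    case (elim t)
    have "- t * inner z w - \<epsilon> * (t * norm w) \<le> - (inner z w + \<eta>) * t"
      using le[of t] elim by (simp add: inner_diff_right)
    hence "t * \<eta> \<le> t * (\<epsilon> * norm w)" by (simp add: algebra_simps)
    hence "\<eta> \<le> \<epsilon> * norm w" using elim by simp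
    also have "\<dots> \<le> \<epsilon> * N" using \<open>\<epsilon> > 0\<close> by (intro mult_left_mono) (auto simp: N_def)
    also have "\<dots> = \<eta> / 2" using N0 by (simp add: \<epsilon>_def)
    finally show False using eta by simp
  qed
  thus False by simp
qed

section \<open>Regular subgradients of scalarizations as normals to a graph\<close>

lemma Limsup_ereal_le_0_iff:
  "Limsup F (\<lambda>x. ereal (f x)) \<le> 0 \<longleftrightarrow> (\<forall>\<epsilon>>0. \<forall>\<^sub>F x in F. f x < \<epsilon>)"
  unfolding Limsup_le_iff
proof (intro iffI allI impI)
  fix \<epsilon> :: real assume "\<forall>y>0. \<forall>\<^sub>F x in F. ereal (f x) < y" "\<epsilon> > 0"
  thus "\<forall>\<^sub>F x in F. f x < \<epsilon>" by (metis (mono_tags, lifting) ereal_less(2) ereal_less_eq(3) eventually_mono less_ereal.simps(1))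
next
  fix y :: ereal assume *: "\<forall>\<epsilon>>0. \<forall>\<^sub>F x in F. f x < \<epsilon>" and "0 < y"
  show "\<forall>\<^sub>F x in F. ereal (f x) < y"
  proof (cases y)
    case (real r)
    thus ?thesis using * \<open>0 < y\<close> by auto
  qed (use \<open>0 < y\<close> in auto)
qed

text \<open>The pairing of \<open>(z, - u)\<close> with a graph increment is the linear term minus
  the increment of the scalarization, and a graph increment is at least as long as its first
  component.\<close>

lemma regular_normal_graphI:
  assumes "regular_subgradient (\<lambda>x. inner u (g x)) y z"
  shows "(z, - u) \<in> regular_normal_cone (gph (single g)) (y, g y)"
  unfolding regular_normal_cone_def mem_Collect_eq Limsup_ereal_le_0_iff
proof (intro conjI allI impI)
  show "(y, g y) \<in> gph (single g)" by (simp add: gph_def)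
  fix \<epsilon> :: real assume "\<epsilon> > 0"
  have "\<forall>\<^sub>F x in nhds y. inner u (g y) + inner z (x - y) - \<epsilon> / 2 * norm (x - y) \<le> inner u (g x)"
    using assms \<open>\<epsilon> > 0\<close> unfolding regular_subgradient_def by (meson half_gt_zero)
  moreover have "filterlim fst (nhds y) (nhds (y, g y))"
    using tendsto_fst[OF filterlim_ident[of "nhds (y, g y)"]] by simp
  ultimately have "\<forall>\<^sub>F p in nhds (y, g y). inner u (g y) + inner z (fst p - y) - \<epsilon> / 2 * norm (fst p - y) \<le> inner u (g (fst p))"
    by (rule eventually_compose_filterlim)
  thus "\<forall>\<^sub>F p in at (y, g y) within gph (single g).
      inner (z, - u) (p - (y, g y)) / norm (p - (y, g y)) < \<epsilon>"
    unfolding eventually_at_filter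
  proof eventually_elim
    case (elim p)
    show ?case
    proof (intro impI)
      assume p: "p \<noteq> (y, g y)" "p \<in> gph (single g)"
      obtain x where x: "p = (x, g x)" using p(2) by (auto simp: gph_def)
      have "inner (z, - u) (p - (y, g y)) = inner z (x - y) - (inner u (g x) - inner u (g y))"
        by (simp add: x inner_diff_right)
      also have "\<dots> \<le> \<epsilon> / 2 * norm (x - y)" using elim by (simp add: x)
      also have "\<dots> \<le> \<epsilon> / 2 * norm (p - (y, g y))"
        using \<open>\<epsilon> > 0\<close> norm_fst_le[of "x - y" "g x - g y"] by (intro mult_left_mono) (auto simp: x)
      also have "\<dots> < \<epsilon> * norm (p - (y, g y))" using \<open>\<epsilon> > 0\<close> p by simp
      finally show "inner (z, - u) (p - (y, g y)) / norm (p - (y, g y)) < \<epsilon>"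
        using p by (simp add: pos_divide_less_eq)
    qed
  qed
qed

text \<open>Lipschitz continuity makes graph increments at most \<open>1 + l\<close> times as long
  as their first components, so an error relative to the former is one relative to the
  latter.\<close>

lemma regular_normal_graphD:
  assumes N: "(z, - u) \<in> regular_normal_cone (gph (single g)) (y, g y)"
    and lip: "lipschitz_around l g y"
  shows "regular_subgradient (\<lambda>x. inner u (g x)) y z"
  unfolding regular_subgradient_def
proof (intro allI impI)
  fix \<epsilon> :: real assume "\<epsilon> > 0"
  obtain S where S: "open S" "y \<in> S" "l-lipschitz_on S g" using lip by (auto simp: lipschitz_around_def)
  have l0: "0 \<le> l" using S(3) by (rule lipschitz_on_nonneg)
  define e where "e = \<epsilon> / (1 + l)"
  have "e > 0" using \<open>\<epsilon> > 0\<close> l0 by (simp add: e_def)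
  have "\<forall>\<^sub>F p in at (y, g y) within gph (single g).
      inner (z, - u) (p - (y, g y)) / norm (p - (y, g y)) < e"
    using N \<open>e > 0\<close> unfolding regular_normal_cone_def mem_Collect_eq Limsup_ereal_le_0_iff by blast
  \<comment> \<open>As an implication over \<open>nhds\<close>, the statement can be composed with
    \<open>x \<mapsto> (x, g x)\<close>, which may hit the base point.\<close>
  hence ev: "\<forall>\<^sub>F p in nhds (y, g y). p \<noteq> (y, g y) \<longrightarrow> p \<in> gph (single g) \<longrightarrow>
      inner (z, - u) (p - (y, g y)) / norm (p - (y, g y)) < e"
    unfolding eventually_at_filter .
  have "isCont g y"
    using lipschitz_on_continuous_on[OF S(3)] S by (simp add: continuous_on_eq_continuous_at)
  hence "isCont (\<lambda>x. (x, g x)) y" by (intro continuous_intros)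
  hence "filterlim (\<lambda>x. (x, g x)) (nhds (y, g y)) (nhds y)"
    using tendsto_at_iff_tendsto_nhds[of "\<lambda>x. (x, g x)" y] by (simp add: isCont_def)
  note eventually_compose_filterlim[OF ev this]
  moreover have "\<forall>\<^sub>F x in nhds y. x \<in> S" using S by (intro eventually_nhds_in_open)
  ultimately show "\<forall>\<^sub>F x in nhds y. inner u (g y) + inner z (x - y) - \<epsilon> * norm (x - y) \<le> inner u (g x)"
  proof eventually_elim
    case (elim x)
    show ?case
    proof (cases "x = y")
      case False
      hence pos: "norm ((x, g x) - (y, g y)) > 0" by (simp add: zero_prod_def)
      have "norm (g x - g y) \<le> l * norm (x - y)"
        using lipschitz_onD[OF S(3), of x y] elim S by (simp add: dist_norm)
      hence "norm ((x, g x) - (y, g y)) \<le> (1 + l) * norm (x - y)"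
        using norm_Pair_le[of "x - y" "g x - g y"] by (simp add: algebra_simps)
      hence "e * norm ((x, g x) - (y, g y)) \<le> e * ((1 + l) * norm (x - y))"
        using \<open>e > 0\<close> by (intro mult_left_mono) auto
      also have "\<dots> = \<epsilon> * norm (x - y)" using l0 by (simp add: e_def)
      finally have "inner (z, - u) ((x, g x) - (y, g y)) \<le> \<epsilon> * norm (x - y)"
        using elim False pos by (simp add: pos_divide_less_eq gph_def)
      thus ?thesis by (simp add: inner_diff_right)
    qed simp
  qed
qed

text \<open>A subgradient bounds increments from below, so an upper bound along one ray limits its
  pairing with that direction. Used with \<open>v = z\<close> for norms and with
  \<open>v = - u\<close> for lower bounds on the curvature.\<close>

lemma regular_subgradient_inner_le:
  assumes z: "regular_subgradient h y z"
    and ev: "\<forall>\<^sub>F t in at_right 0. h (y + t *\<^sub>R v) - h y \<le> m * t"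
  shows "inner z v \<le> m"
proof (rule field_le_epsilon)
  fix e :: real assume "e > 0"
  define \<epsilon> where "\<epsilon> = e / (norm v + 1)"
  have "\<epsilon> > 0" using \<open>e > 0\<close> by (simp add: \<epsilon>_def add_nonneg_pos)
  with z have ev': "\<forall>\<^sub>F x in nhds y. h y + inner z (x - y) - \<epsilon> * norm (x - y) \<le> h x"
    by (auto simp: regular_subgradient_def)
  have "((\<lambda>t. y + t *\<^sub>R v) \<longlongrightarrow> y + 0 *\<^sub>R v) (at_right 0)" by (intro tendsto_intros)
  hence "filterlim (\<lambda>t. y + t *\<^sub>R v) (nhds y) (at_right 0)" by simp
  note eventually_compose_filterlim[OF ev' this]
  moreover note ev
  moreover have "\<forall>\<^sub>F t in at_right (0::real). 0 < t" by (simp add: eventually_at_right_less)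
  ultimately have "\<forall>\<^sub>F t in at_right (0::real). inner z v \<le> m + e"
  proof eventually_elim
    case (elim t)
    have "t * inner z v \<le> t * (m + \<epsilon> * norm v)" using elim by (simp add: algebra_simps)
    hence "inner z v \<le> m + \<epsilon> * norm v" using elim by simp
    also have "\<epsilon> * norm v \<le> \<epsilon> * (norm v + 1)" using \<open>\<epsilon> > 0\<close> by (intro mult_left_mono) auto
    also have "\<dots> = e" by (simp add: \<epsilon>_def add_nonneg_eq_0_iff)
    finally show ?case by simp
  qed
  thus "inner z v \<le> m + e" by (simp add: eventually_const_iff)
qed

lemma eventually_at_right_line_in_open:
  fixes y v :: "'a::real_normed_vector"
  assumes "open S" "y \<in> S"
  shows "\<forall>\<^sub>F t in at_right 0. y + t *\<^sub>R v \<in> S"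
proof -
  have "((\<lambda>t. y + t *\<^sub>R v) \<longlongrightarrow> y + 0 *\<^sub>R v) (at_right 0)" by (intro tendsto_intros)
  thus ?thesis using assms by (auto elim: topological_tendstoD)
qed

text \<open>Tested in its own direction, a subgradient cannot exceed the Lipschitz modulus
  \<open>l * norm u\<close> of the scalarization.\<close>

lemma regular_subgradient_norm_le:
  assumes z: "regular_subgradient (\<lambda>x. inner u (g x)) y z"
    and S: "open S" "y \<in> S" "l-lipschitz_on S g"
  shows "norm z \<le> l * norm u"
proof -
  have "inner z z \<le> l * norm u * norm z"
  proof (rule regular_subgradient_inner_le[OF z])
    have "\<forall>\<^sub>F t in at_right (0::real). 0 < t" by (simp add: eventually_at_right_less)
    with eventually_at_right_line_in_open[OF S(1,2), of z]
    show "\<forall>\<^sub>F t in at_right 0. inner u (g (y + t *\<^sub>R z)) - inner u (g y) \<le> l * norm u * norm z * t"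
    proof eventually_elim
      case (elim t)
      have "inner u (g (y + t *\<^sub>R z) - g y) \<le> norm u * norm (g (y + t *\<^sub>R z) - g y)"
        by (rule norm_cauchy_schwarz)
      also have "\<dots> \<le> norm u * (l * (t * norm z))"
        using lipschitz_onD[OF S(3) elim(1) S(2)] elim(2) by (intro mult_left_mono) (auto simp: dist_norm)
      finally show ?case by (simp add: inner_diff_right algebra_simps)
    qed
  qed
  hence "norm z * norm z \<le> l * norm u * norm z" by (simp add: power2_norm_eq_inner[symmetric] power2_eq_square)
  moreover have "0 \<le> l * norm u" using lipschitz_on_nonneg[OF S(3)] by simp
  ultimately show ?thesis by (cases "z = 0") auto
qed

section \<open>Uniqueness and recognition of gradients, and the descent lemma\<close>

lemma GDERIV_unique:
  assumes "GDERIV f x :> D" "GDERIV f x :> E"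
  shows "D = E"
proof -
  have "(\<lambda>h. inner h D) = (\<lambda>h. inner h E)"
    using assms unfolding gderiv_def by (rule has_derivative_unique)
  hence "inner (D - E) D = inner (D - E) E" by metis
  hence "inner (D - E) (D - E) = 0" by (simp add: inner_diff_right)
  thus ?thesis by simp
qed

lemma GDERIV_if_quadratic_remainder:
  assumes "\<forall>\<^sub>F w in nhds v. \<bar>f w - f v - inner (w - v) D\<bar> \<le> K * (norm (w - v))\<^sup>2" "0 \<le> K"
  shows "GDERIV f v :> D"
  unfolding gderiv_def has_derivative_at2
proof (intro conjI)
  show "bounded_linear (\<lambda>h. inner h D)" by (rule bounded_linear_inner_left)
  have "((\<lambda>w. K * norm (w - v)) \<longlongrightarrow> K * norm (v - v)) (at v)" by (intro tendsto_intros)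
  hence lim: "((\<lambda>w. K * norm (w - v)) \<longlongrightarrow> 0) (at v)" by simp
  show "((\<lambda>w. (1 / norm (w - v)) *\<^sub>R (f w - (f v + inner (w - v) D))) \<longlongrightarrow> 0) (at v)"
  proof (rule Lim_null_comparison[OF _ lim])
    have "\<forall>\<^sub>F w in at v. \<bar>f w - f v - inner (w - v) D\<bar> \<le> K * (norm (w - v))\<^sup>2"
      using assms(1) by (simp add: eventually_at_filter eventually_mono)
    moreover have "\<forall>\<^sub>F w in at v. w \<noteq> v" by (simp add: eventually_at_filter)
    ultimately show "\<forall>\<^sub>F w in at v. norm ((1 / norm (w - v)) *\<^sub>R (f w - (f v + inner (w - v) D))) \<le> K * norm (w - v)"
    proof eventually_elim
      case (elim w)
      have "\<bar>f w - f v - inner (w - v) D\<bar> / norm (w - v) \<le> K * norm (w - v)"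
        using elim by (simp add: pos_divide_le_eq power2_eq_square mult.assoc)
      thus ?case by (simp add: diff_diff_eq abs_mult)
    qed
  qed
qed

text \<open>Subtracting the expected quadratic from the restriction to the segment leaves a function
  whose derivative never exceeds its value at 0. Needed for \<open>\<phi>\<close> itself and for its
  conjugate.\<close>

lemma Lipschitz_gradient_upper_bound:
  assumes S: "convex S" "\<And>x. x \<in> S \<Longrightarrow> GDERIV \<psi> x :> G x" "L-lipschitz_on S G"
    and vw: "v \<in> S" "w \<in> S"
  shows "\<psi> w \<le> \<psi> v + inner (G v) (w - v) + L / 2 * (norm (w - v))\<^sup>2"
proof -
  let ?f = "\<lambda>t. \<psi> (v + t *\<^sub>R (w - v)) - L / 2 * (norm (w - v))\<^sup>2 * t\<^sup>2"
  have "?f 1 - ?f 0 \<le> inner (G v) (w - v) * (1 - 0)"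
  proof (rule increment_le_if_derivative_le)
    fix t :: real assume t: "0 \<le> t" "t \<le> 1"
    have inS: "v + t *\<^sub>R (w - v) \<in> S"
      using convexD_alt[OF S(1) vw t] by (simp add: algebra_simps)
    show "(?f has_real_derivative inner (G (v + t *\<^sub>R (w - v))) (w - v) - L * (norm (w - v))\<^sup>2 * t) (at t)"
      by (rule derivative_eq_intros DERIV_along_line S(2) inS refl | simp)+
    have "inner (G (v + t *\<^sub>R (w - v)) - G v) (w - v) \<le> norm (G (v + t *\<^sub>R (w - v)) - G v) * norm (w - v)"
      by (rule norm_cauchy_schwarz)
    also have "\<dots> \<le> (L * (t * norm (w - v))) * norm (w - v)"
      using lipschitz_onD[OF S(3) inS vw(1)] t by (intro mult_right_mono) (auto simp: dist_norm)
    finally show "inner (G (v + t *\<^sub>R (w - v))) (w - v) - L * (norm (w - v))\<^sup>2 * t \<le> inner (G v) (w - v)"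
      by (simp add: inner_diff_left power2_eq_square algebra_simps)
  qed simp
  thus ?thesis by simp
qed

section \<open>Functions of class C11\<close>

locale C11_function =
  fixes \<phi> :: "'a::euclidean_space \<Rightarrow> real"
  assumes C11: "C11 \<phi>"
begin

abbreviation "g \<equiv> gradient \<phi>"

lemma GDERIV_gradient: "GDERIV \<phi> x :> g x"
proof -
  obtain D where D: "GDERIV \<phi> x :> D" using C11 by (auto simp: C11_def)
  have "g x = D" unfolding gradient_def using D by (intro the_equality) (auto dest: GDERIV_unique)
  thus ?thesis using D by simp
qed

lemma continuous_gradient: "continuous_on UNIV g"
  using C11 by (simp add: C11_def)

lemma isCont_gradient: "isCont g x"
  using continuous_gradient by (simp add: continuous_on_eq_continuous_at)

lemma isCont_function: "isCont \<phi> x"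
  using GDERIV_gradient[of x] unfolding gderiv_def by (rule has_derivative_continuous)

lemma continuous_function: "continuous_on UNIV \<phi>"
  using isCont_function by (simp add: continuous_at_imp_continuous_on)

lemma lipschitz_near: obtains l r where "0 < l" "0 < r" "l-lipschitz_on (ball y r) g"
proof -
  obtain l S where S: "open S" "y \<in> S" "l-lipschitz_on S g"
    using C11 unfolding C11_def lipschitz_around_def by blast
  obtain r where "0 < r" "ball y r \<subseteq> S" using S openE by blast
  moreover have "(l + 1)-lipschitz_on (ball y r) g"
    by (rule lipschitz_on_mono[OF S(3)]) (use calculation in auto)
  moreover have "0 < l + 1" using lipschitz_on_nonneg[OF S(3)] by simp
  ultimately show ?thesis using that by blast
qed

lemma regular_subgradient_in_generalized_hessian:
  assumes "regular_subgradient (\<lambda>x. inner u (g x)) y z"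
  shows "z \<in> generalized_hessian \<phi> y u"
  unfolding generalized_hessian_def limiting_normal_cone_def mem_Collect_eq
  using regular_normal_graphI[OF assms]
  by (intro conjI exI[of _ "\<lambda>_. (y, g y)"] exI[of _ "\<lambda>_. (z, - u)"]) (auto simp: gph_def)

text \<open>The directions \<open>us\<close> vary together with the base points, so an estimate that
  is to pass to the limit has to hold for regular subgradients in all nearby directions.\<close>

lemma generalized_hessianE:
  assumes "z \<in> generalized_hessian \<phi> y u"
  obtains us ys zs where "\<And>k::nat. regular_subgradient (\<lambda>x. inner (us k) (g x)) (ys k) (zs k)"
    "ys \<longlonglongrightarrow> y" "zs \<longlonglongrightarrow> z" "us \<longlonglongrightarrow> u"
proof -
  obtain ps vs where ps: "\<And>k::nat. ps k \<in> gph (single g)"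
      and vs: "\<And>k. vs k \<in> regular_normal_cone (gph (single g)) (ps k)"
      and lim: "ps \<longlonglongrightarrow> (y, g y)" "vs \<longlonglongrightarrow> (z, - u)"
    using assms unfolding generalized_hessian_def limiting_normal_cone_def by auto
  show ?thesis
  proof (rule that)
    fix k
    have "ps k = (fst (ps k), g (fst (ps k)))" using ps[of k] by (auto simp: gph_def)
    hence "(fst (vs k), - (- snd (vs k))) \<in> regular_normal_cone (gph (single g)) (fst (ps k), g (fst (ps k)))"
      using vs[of k] by simp
    moreover obtain l where "lipschitz_around l g (fst (ps k))" using C11 by (auto simp: C11_def)
    ultimately show "regular_subgradient (\<lambda>x. inner (- snd (vs k)) (g x)) (fst (ps k)) (fst (vs k))"
      by (rule regular_normal_graphD)
  next
    show "(\<lambda>k. fst (ps k)) \<longlonglongrightarrow> y" using tendsto_fst[OF lim(1)] by simp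
    show "(\<lambda>k. fst (vs k)) \<longlonglongrightarrow> z" using tendsto_fst[OF lim(2)] by simp
    show "(\<lambda>k. - snd (vs k)) \<longlonglongrightarrow> u" using tendsto_minus[OF tendsto_snd[OF lim(2)]] by simp
  qed
qed

lemma generalized_hessian_norm_le:
  assumes z: "z \<in> generalized_hessian \<phi> y u" and S: "open S" "y \<in> S" "l-lipschitz_on S g"
  shows "norm z \<le> l * norm u"
proof -
  obtain us ys zs where s: "\<And>k::nat. regular_subgradient (\<lambda>x. inner (us k) (g x)) (ys k) (zs k)"
    "ys \<longlonglongrightarrow> y" "zs \<longlonglongrightarrow> z" "us \<longlonglongrightarrow> u" by (rule generalized_hessianE[OF z]) (rule that)
  have "\<forall>\<^sub>F k in sequentially. ys k \<in> S" using s(2) S(1,2) by (rule topological_tendstoD)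
  hence "\<forall>\<^sub>F k in sequentially. norm (zs k) \<le> l * norm (us k)"
    by eventually_elim (use s(1) S regular_subgradient_norm_le in blast)
  thus ?thesis
    using s by (intro tendsto_le[OF _ _ _ , of sequentially "\<lambda>k. l * norm (us k)" _ "\<lambda>k. norm (zs k)"] tendsto_intros) auto
qed

text \<open>Strong convexity of modulus \<open>1 / \<kappa>\<close> as a gradient inequality; the
  inverse is used because \<open>\<kappa>\<close> will be a modulus of metric regularity.\<close>

definition strongly_convex_near :: "real \<Rightarrow> 'a \<Rightarrow> real \<Rightarrow> bool" where
  "strongly_convex_near \<kappa> c r \<longleftrightarrow>
     (\<forall>x\<in>ball c r. \<forall>y\<in>ball c r. \<phi> y + inner (g y) (x - y) + (norm (x - y))\<^sup>2 / (2 * \<kappa>) \<le> \<phi> x)"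

lemma strongly_convex_monotone:
  assumes "strongly_convex_near \<kappa> c r" "x \<in> ball c r" "y \<in> ball c r"
  shows "(norm (x - y))\<^sup>2 / \<kappa> \<le> inner (g x - g y) (x - y)"
proof -
  have "\<phi> y + inner (g y) (x - y) + (norm (x - y))\<^sup>2 / (2 * \<kappa>) \<le> \<phi> x"
    using assms unfolding strongly_convex_near_def by blast
  moreover have "\<phi> x + inner (g x) (y - x) + (norm (y - x))\<^sup>2 / (2 * \<kappa>) \<le> \<phi> y"
    using assms unfolding strongly_convex_near_def by blast
  hence "\<phi> x + inner (g x) (y - x) + (norm (x - y))\<^sup>2 / (2 * \<kappa>) \<le> \<phi> y"
    by (simp add: norm_minus_commute)
  ultimately have "2 * ((norm (x - y))\<^sup>2 / (2 * \<kappa>)) \<le> inner (g x - g y) (x - y)"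
    by (simp add: inner_diff_left inner_diff_right)
  thus ?thesis by simp
qed

lemma strongly_convex_norm_le:
  assumes "strongly_convex_near \<kappa> c r" "x \<in> ball c r" "y \<in> ball c r" "0 < \<kappa>"
  shows "norm (x - y) \<le> \<kappa> * norm (g x - g y)"
proof (cases "x = y")
  case False
  have "(norm (x - y))\<^sup>2 / \<kappa> \<le> inner (g x - g y) (x - y)" using assms by (intro strongly_convex_monotone)
  also have "\<dots> \<le> norm (g x - g y) * norm (x - y)" by (rule norm_cauchy_schwarz)
  finally show ?thesis using \<open>0 < \<kappa>\<close> False by (simp add: field_simps power2_eq_square)
qed simp

text \<open>Along \<open>- u\<close> strong monotonicity makes the scalarization by \<open>u\<close>
  fall at rate at least \<open>|u|^2 / \<kappa>\<close>, and a subgradient has to allow for this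
  fall.\<close>

lemma regular_subgradient_strongly_convex:
  assumes sc: "strongly_convex_near \<kappa> c r" and y: "y \<in> ball c r"
    and z: "regular_subgradient (\<lambda>x. inner u (g x)) y z"
  shows "(norm u)\<^sup>2 / \<kappa> \<le> inner z u"
proof -
  have "inner z (- u) \<le> - ((norm u)\<^sup>2 / \<kappa>)"
  proof (rule regular_subgradient_inner_le[OF z])
    have "\<forall>\<^sub>F t in at_right (0::real). 0 < t" by (simp add: eventually_at_right_less)
    with eventually_at_right_line_in_open[OF open_ball y, of "- u"]
    show "\<forall>\<^sub>F t in at_right 0. inner u (g (y + t *\<^sub>R - u)) - inner u (g y) \<le> - ((norm u)\<^sup>2 / \<kappa>) * t"
    proof eventually_elim
      case (elim t)
      have "(norm (t *\<^sub>R - u))\<^sup>2 / \<kappa> \<le> inner (g (y + t *\<^sub>R - u) - g y) (t *\<^sub>R - u)"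
        using strongly_convex_monotone[OF sc elim(1) y] by simp
      hence "t * (t * ((norm u)\<^sup>2 / \<kappa>)) \<le> t * (inner (g (y + t *\<^sub>R - u) - g y) (- u))"
        using elim by (simp add: power_mult_distrib power2_eq_square algebra_simps)
      hence "t * ((norm u)\<^sup>2 / \<kappa>) \<le> inner (g (y + t *\<^sub>R - u) - g y) (- u)"
        using elim(2) by (simp only: mult_le_cancel_left_pos)
      thus ?case by (simp add: inner_diff_left inner_commute algebra_simps)
    qed
  qed
  thus ?thesis by simp
qed

lemma generalized_hessian_strongly_convex:
  assumes sc: "strongly_convex_near \<kappa> c r" and y: "y \<in> ball c r"
    and z: "z \<in> generalized_hessian \<phi> y u"
  shows "(norm u)\<^sup>2 / \<kappa> \<le> inner z u"
proof -
  obtain us ys zs where s: "\<And>k::nat. regular_subgradient (\<lambda>x. inner (us k) (g x)) (ys k) (zs k)"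
    "ys \<longlonglongrightarrow> y" "zs \<longlonglongrightarrow> z" "us \<longlonglongrightarrow> u" by (rule generalized_hessianE[OF z]) (rule that)
  have "\<forall>\<^sub>F k in sequentially. ys k \<in> ball c r" using s(2) open_ball y by (rule topological_tendstoD)
  hence ev: "\<forall>\<^sub>F k in sequentially. (norm (us k))\<^sup>2 / \<kappa> \<le> inner (zs k) (us k)"
    by eventually_elim (use s(1) sc regular_subgradient_strongly_convex in blast)
  have "(\<lambda>k. (norm (us k))\<^sup>2 / \<kappa>) \<longlonglongrightarrow> (norm u)\<^sup>2 / \<kappa>"
    using s(4) unfolding divide_inverse by (intro tendsto_intros)
  moreover have "(\<lambda>k. inner (zs k) (us k)) \<longlonglongrightarrow> inner z u" using s by (intro tendsto_intros)
  ultimately show ?thesis using ev by (intro tendsto_le[of sequentially]) auto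
qed

section \<open>From a positive semidefinite Hessian to strong convexity and tilt stability\<close>

lemma gradient_monotone_if_hessian_psd:
  assumes psd: "\<And>y. y \<in> ball c r \<Longrightarrow> positive_semidefinite_mapping (generalized_hessian \<phi> y)"
    and ab: "a \<in> ball c r" "b \<in> ball c r"
  shows "0 \<le> inner (g b - g a) (b - a)"
proof -
  \<comment> \<open>The scalarizing vector is the displacement itself, so every subgradient met is a
    Hessian element paired with its own direction.\<close>
  have "0 \<le> inner (b - a) (g b) - inner (b - a) (g a)"
  proof (rule approximate_mean_value_inequality[where c = c and R = r and h = "\<lambda>x. inner (b - a) (g x)"])
    show "continuous_on (ball c r) (\<lambda>x. inner (b - a) (g x))"
      by (intro continuous_intros continuous_on_subset[OF continuous_gradient]) auto
    show "0 \<le> inner z (b - a)" if "y \<in> ball c r" "regular_subgradient (\<lambda>x. inner (b - a) (g x)) y z" for y z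
      using psd[OF that(1)] regular_subgradient_in_generalized_hessian[OF that(2)]
      unfolding positive_semidefinite_mapping_def by blast
  qed (use ab in auto)
  thus ?thesis by (simp add: inner_diff_right inner_commute)
qed

lemma gradient_inequality_if_monotone:
  assumes mono: "\<And>a b. a \<in> ball c r \<Longrightarrow> b \<in> ball c r \<Longrightarrow> 0 \<le> inner (g b - g a) (b - a)"
    and xy: "x \<in> ball c r" "y \<in> ball c r"
  shows "\<phi> y + inner (g y) (x - y) \<le> \<phi> x"
proof -
  let ?f = "\<lambda>t. - \<phi> (y + t *\<^sub>R (x - y))"
  have "?f 1 - ?f 0 \<le> - inner (g y) (x - y) * (1 - 0)"
  proof (rule increment_le_if_derivative_le)
    fix t :: real assume t: "0 \<le> t" "t \<le> 1"
    show "(?f has_real_derivative - inner (g (y + t *\<^sub>R (x - y))) (x - y)) (at t)"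
      by (intro DERIV_minus DERIV_along_line GDERIV_gradient)
    have "y + t *\<^sub>R (x - y) \<in> ball c r"
      using convexD_alt[OF convex_ball xy(2,1) t] by (simp add: algebra_simps)
    from mono[OF xy(2) this] have "0 \<le> t * inner (g (y + t *\<^sub>R (x - y)) - g y) (x - y)" by simp
    hence "0 \<le> inner (g (y + t *\<^sub>R (x - y)) - g y) (x - y)"
      using t by (cases "t = 0") (auto simp: zero_le_mult_iff)
    thus "- inner (g (y + t *\<^sub>R (x - y))) (x - y) \<le> - inner (g y) (x - y)"
      by (simp add: inner_diff_left)
  qed simp
  thus ?thesis by simp
qed

text \<open>The right side is finite while the distance to the empty set is infinite, hence
  solvability. The solution set is closed, so the distance is attained and the modulus stays
  \<open>\<kappa>\<close> without an extra epsilon.\<close>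

lemma metric_regularity_solution:
  assumes "metrically_regular \<kappa> (single g) c 0"
  obtains r \<delta> where "0 < r" "0 < \<delta>"
    "\<And>x v. x \<in> ball c r \<Longrightarrow> v \<in> ball 0 \<delta> \<Longrightarrow> \<exists>w. g w = v \<and> dist x w \<le> \<kappa> * dist v (g x)"
proof -
  obtain U V where UV: "open U" "c \<in> U" "open V" "0 \<in> V"
      and reg: "\<And>x v. x \<in> U \<Longrightarrow> v \<in> V \<Longrightarrow> dist_set x {w. v \<in> single g w} \<le> ereal \<kappa> * dist_set v (single g x)"
    using assms unfolding metrically_regular_def by blast
  obtain r where r: "0 < r" "ball c r \<subseteq> U" using UV openE by blast
  obtain \<delta> where \<delta>: "0 < \<delta>" "ball 0 \<delta> \<subseteq> V" using UV openE by blast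
  show ?thesis
  proof (rule that[OF r(1) \<delta>(1)])
    fix x v :: 'a assume "x \<in> ball c r" "v \<in> ball 0 \<delta>"
    hence "x \<in> U" "v \<in> V" using r \<delta> by auto
    hence le: "dist_set x {w. g w = v} \<le> ereal (\<kappa> * dist v (g x))"
      using reg[of x v] by (simp add: dist_set_def eq_commute[of v])
    have "{w. g w = v} \<noteq> {}"
    proof
      assume "{w. g w = v} = {}"
      hence "dist_set x {w. g w = v} = \<infinity>" by (simp add: dist_set_def top_ereal_def)
      thus False using le by simp
    qed
    moreover have "closed {w. g w = v}"
      by (intro closed_Collect_eq continuous_gradient continuous_on_const)
    ultimately obtain w where w: "g w = v" "\<And>w'. g w' = v \<Longrightarrow> dist x w \<le> dist x w'"
      using distance_attains_inf[of "{w. g w = v}" x] by auto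
    have "ereal (dist x w) \<le> dist_set x {w. g w = v}"
      unfolding dist_set_def by (rule INF_greatest) (use w in auto)
    hence "dist x w \<le> \<kappa> * dist v (g x)" using le order_trans ereal_less_eq(3) by blast
    thus "\<exists>w. g w = v \<and> dist x w \<le> \<kappa> * dist v (g x)" using w by blast
  qed
qed

text \<open>Injectivity: if \<open>g a = g b\<close>, solve for the value \<open>g b\<close> shifted
  slightly towards \<open>a - b\<close>. The solution \<open>w\<close> stays near \<open>b\<close>,
  but monotonicity between \<open>w\<close> and \<open>a\<close> requires it to lie beyond
  \<open>a\<close>. Given injectivity, the solution that metric regularity yields from
  \<open>m v\<close> for the value \<open>w\<close> must be \<open>m w\<close>, which is the
  Lipschitz bound.\<close>

lemma gradient_inverse:
  assumes reg: "metrically_regular \<kappa> (single g) c 0" and crit: "g c = 0" and "0 < R"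
    and mono: "\<And>a b. a \<in> ball c R \<Longrightarrow> b \<in> ball c R \<Longrightarrow> 0 \<le> inner (g b - g a) (b - a)"
  obtains \<rho> r m where "0 < \<rho>" "0 < r" "r \<le> R" "\<And>v. v \<in> ball 0 \<rho> \<Longrightarrow> m v \<in> ball c R \<and> g (m v) = v"
    "\<kappa>-lipschitz_on (ball 0 \<rho>) m" "\<And>y. y \<in> ball c r \<Longrightarrow> g y \<in> ball 0 \<rho> \<and> m (g y) = y"
proof -
  have k0: "0 < \<kappa>" using reg by (simp add: metrically_regular_def)
  obtain r' \<delta> where r': "0 < r'" and d0: "0 < \<delta>"
    and sol': "\<And>x v. x \<in> ball c r' \<Longrightarrow> v \<in> ball 0 \<delta> \<Longrightarrow> \<exists>w. g w = v \<and> dist x w \<le> \<kappa> * dist v (g x)"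
    by (rule metric_regularity_solution[OF reg]) (rule that)
  define r where "r = min r' R"
  have r0: "0 < r" and rR: "ball c r \<subseteq> ball c R" using r' \<open>0 < R\<close> by (auto simp: r_def)
  have sol: "\<exists>w. g w = v \<and> dist x w \<le> \<kappa> * dist v (g x)" if "x \<in> ball c r" "v \<in> ball 0 \<delta>" for x v
    using sol'[of x v] that by (auto simp: r_def)
  have inj: "a = b" if ab: "a \<in> ball c r" "b \<in> ball c r" "g a = g b" "g b \<in> ball 0 \<delta>" for a b
  proof (rule ccontr)
    assume "a \<noteq> b"
    hence n0: "norm (a - b) > 0" by simp
    \<comment> \<open>The entries keep the shifted value solvable, the solution \<open>w\<close>
      inside the ball, and \<open>w\<close> closer to \<open>b\<close> than \<open>a\<close>
      is.\<close>
    define s where "s = min (min ((\<delta> - norm (g b)) / 2) ((r - dist c b) / (2 * \<kappa>))) (norm (a - b) / (2 * \<kappa>))"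
    have "0 < \<delta> - norm (g b)" "0 < r - dist c b" using ab by (auto simp: dist_norm)
    hence s0: "0 < s" using n0 k0 by (simp add: s_def)
    have "s \<le> (\<delta> - norm (g b)) / 2" "s \<le> (r - dist c b) / (2 * \<kappa>)" "s \<le> norm (a - b) / (2 * \<kappa>)"
      unfolding s_def by linarith+
    hence "s \<le> (\<delta> - norm (g b)) / 2" "\<kappa> * s \<le> (r - dist c b) / 2" "\<kappa> * s \<le> norm (a - b) / 2"
      using k0 by (auto simp: field_simps)
    moreover have half: "t < A" if "t \<le> A / 2" "0 < A" for t A :: real using that by simp
    ultimately have s: "s < \<delta> - norm (g b)" "\<kappa> * s < r - dist c b" "\<kappa> * s < norm (a - b)"
      using \<open>0 < \<delta> - norm (g b)\<close> \<open>0 < r - dist c b\<close> n0 by blast+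
    define e where "e = (a - b) /\<^sub>R norm (a - b)"
    have ne: "norm e = 1" using n0 by (simp add: e_def)
    have "norm (g b + s *\<^sub>R e) \<le> norm (g b) + s" using norm_triangle_ineq[of "g b" "s *\<^sub>R e"] ne s0 by simp
    hence "g b + s *\<^sub>R e \<in> ball 0 \<delta>" using s by simp
    from sol[OF ab(2) this] obtain w where w: "g w = g b + s *\<^sub>R e" "dist b w \<le> \<kappa> * s"
      using ne s0 by (auto simp: dist_norm)
    have "w \<in> ball c r" using dist_triangle[of c w b] w s by simp
    hence "0 \<le> inner (g w - g a) (w - a)" using mono ab rR by blast
    also have "g w - g a = (s / norm (a - b)) *\<^sub>R (a - b)" by (simp add: w ab e_def divide_inverse)
    finally have "0 \<le> (s / norm (a - b)) * inner (a - b) (w - a)" by simp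
    moreover have "s / norm (a - b) > 0" using s0 n0 by simp
    ultimately have "0 \<le> inner (a - b) (w - a)" by (simp only: zero_le_mult_iff) auto
    also have "\<dots> = inner (a - b) (w - b) - norm (a - b) * norm (a - b)"
      by (simp add: power2_eq_square[symmetric] power2_norm_eq_inner inner_diff_left inner_diff_right)
    also have "inner (a - b) (w - b) \<le> norm (a - b) * norm (w - b)" by (rule norm_cauchy_schwarz)
    also have "\<dots> \<le> norm (a - b) * (\<kappa> * s)" using w by (intro mult_left_mono) (auto simp: dist_norm norm_minus_commute)
    also have "\<dots> < norm (a - b) * norm (a - b)" using s n0 by (intro mult_strict_left_mono) auto
    finally show False by simp
  qed
  have cr: "c \<in> ball c r" using r0 by simp
  have "\<exists>m. \<forall>v\<in>ball 0 \<delta>. g (m v) = v \<and> dist c (m v) \<le> \<kappa> * norm v"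
    using sol[OF cr] crit by (intro bchoice) auto
  then obtain m where m: "\<And>v. v \<in> ball 0 \<delta> \<Longrightarrow> g (m v) = v \<and> dist c (m v) \<le> \<kappa> * norm v" by blast
  \<comment> \<open>A quarter of \<open>r\<close> suffices: \<open>m v\<close> lies within
    \<open>r / 4\<close> of \<open>c\<close>, and a competing solution for another value of the ball
    within a further \<open>2 * \<kappa> * \<rho> \<le> r / 2\<close>, so injectivity applies to
    it.\<close>
  define \<rho> where "\<rho> = min \<delta> (r / (4 * \<kappa>))"
  have p0: "0 < \<rho>" using d0 r0 k0 by (simp add: \<rho>_def)
  have "\<rho> \<le> r / (4 * \<kappa>)" by (simp add: \<rho>_def)
  hence kp: "\<kappa> * \<rho> \<le> r / 4" using k0 by (simp add: field_simps)
  have mr: "g (m v) = v \<and> dist c (m v) < r / 4" if "v \<in> ball 0 \<rho>" for v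
  proof -
    have "\<kappa> * norm v < \<kappa> * \<rho>" using that k0 by simp
    thus ?thesis using m[of v] that kp by (auto simp: \<rho>_def)
  qed
  have lip: "\<kappa>-lipschitz_on (ball 0 \<rho>) m"
  proof (rule lipschitz_onI)
    fix v w :: 'a assume vw: "v \<in> ball 0 \<rho>" "w \<in> ball 0 \<rho>"
    have "m v \<in> ball c r" using mr[OF vw(1)] r0 by auto
    moreover have "w \<in> ball 0 \<delta>" using vw by (simp add: \<rho>_def)
    ultimately obtain x' where x': "g x' = w" "dist (m v) x' \<le> \<kappa> * dist w v"
      using sol[of "m v" w] mr[OF vw(1)] by auto
    have "dist w v \<le> norm w + norm v" by (simp add: dist_norm norm_triangle_ineq4)
    also have "\<dots> < 2 * \<rho>" using vw by simp
    finally have "\<kappa> * dist w v < \<kappa> * (2 * \<rho>)" using k0 by simp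
    hence "dist (m v) x' < r / 2" using x' kp by simp
    hence "x' \<in> ball c r" using dist_triangle[of c x' "m v"] mr[OF vw(1)] r0 by simp
    moreover have "m w \<in> ball c r" using mr[OF vw(2)] r0 by auto
    ultimately have "x' = m w" using inj[of x' "m w"] x' mr[OF vw(2)] \<open>w \<in> ball 0 \<delta>\<close> by simp
    thus "dist (m v) (m w) \<le> \<kappa> * dist v w" using x' by (simp add: dist_commute)
  qed (use k0 in simp)
  obtain q where q: "0 < q" "\<And>y. dist y c < q \<Longrightarrow> dist (g y) (g c) < \<rho>"
    using isCont_gradient[of c] p0 unfolding continuous_at_eps_delta by blast
  show ?thesis
  proof (rule that[of \<rho> "min q r" m])
    show "0 < \<rho>" "0 < min q r" "min q r \<le> R" using p0 q r0 by (auto simp: r_def)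
    show "m v \<in> ball c R \<and> g (m v) = v" if "v \<in> ball 0 \<rho>" for v
      using mr[OF that] r0 by (auto simp: r_def)
    show "g y \<in> ball 0 \<rho> \<and> m (g y) = y" if "y \<in> ball c (min q r)" for y
    proof
      show *: "g y \<in> ball 0 \<rho>" using q(2)[of y] that crit by (simp add: dist_commute)
      show "m (g y) = y" using inj[of "m (g y)" y] mr[OF *] that * r0 by (auto simp: \<rho>_def)
    qed
  qed (rule lip)
qed

text \<open>The conjugate \<open>\<psi>\<close> of \<open>\<phi>\<close> has the \<open>\<kappa>\<close>-Lipschitz gradient \<open>m\<close>, and the quadratic upper bound for
  \<open>\<psi>\<close> dualizes to strong convexity of \<open>\<phi>\<close> with the sharp constant.\<close>

lemma strongly_convex_if_lipschitz_inverse: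
  assumes k0: "0 < \<kappa>" and crit: "g c = 0" and p0: "0 < \<rho>" and r0: "0 < r" and rR: "r \<le> R"
    and m: "\<And>v. v \<in> ball 0 \<rho> \<Longrightarrow> m v \<in> ball c R \<and> g (m v) = v"
    and lip: "\<kappa>-lipschitz_on (ball 0 \<rho>) m"
    and inv: "\<And>y. y \<in> ball c r \<Longrightarrow> g y \<in> ball 0 \<rho> \<and> m (g y) = y"
    and conv: "\<And>x y. x \<in> ball c R \<Longrightarrow> y \<in> ball c R \<Longrightarrow> \<phi> y + inner (g y) (x - y) \<le> \<phi> x"
  obtains r' where "0 < r'" "r' \<le> r" "strongly_convex_near \<kappa> c r'"
proof -
  define \<psi> where "\<psi> v = inner v (m v) - \<phi> (m v)" for v
  \<comment> \<open>The two gradient inequalities between \<open>m v\<close> and \<open>m w\<close>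
    put the remainder of \<open>\<psi>\<close> between 0 and the pairing of \<open>w - v\<close>
    with \<open>m w - m v\<close>.\<close>
  have D: "GDERIV \<psi> v :> m v" if v: "v \<in> ball 0 \<rho>" for v
  proof (rule GDERIV_if_quadratic_remainder[of _ _ _ \<kappa>])
    have "\<forall>\<^sub>F w in nhds v. w \<in> ball 0 \<rho>" using v by (intro eventually_nhds_in_open) auto
    thus "\<forall>\<^sub>F w in nhds v. \<bar>\<psi> w - \<psi> v - inner (w - v) (m v)\<bar> \<le> \<kappa> * (norm (w - v))\<^sup>2"
    proof eventually_elim
      case (elim w)
      have 1: "\<phi> (m w) + inner w (m v - m w) \<le> \<phi> (m v)" "\<phi> (m v) + inner v (m w - m v) \<le> \<phi> (m w)"
        using conv[of "m v" "m w"] conv[of "m w" "m v"] m[OF v] m[OF elim] by auto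
      have "inner (w - v) (m w - m v) \<le> norm (w - v) * norm (m w - m v)" by (rule norm_cauchy_schwarz)
      also have "\<dots> \<le> norm (w - v) * (\<kappa> * norm (w - v))"
        using lipschitz_onD[OF lip elim v] by (intro mult_left_mono) (auto simp: dist_norm)
      finally have "inner (w - v) (m w - m v) \<le> \<kappa> * (norm (w - v))\<^sup>2" by (simp add: power2_eq_square algebra_simps)
      thus ?case using 1 unfolding \<psi>_def abs_le_iff
        by (simp add: inner_diff_left inner_diff_right)
    qed
  qed (use k0 in simp)
  have "0 < \<rho> / 2" using p0 by simp
  then obtain q where q: "0 < q" "\<And>y. dist y c < q \<Longrightarrow> dist (g y) (g c) < \<rho> / 2"
    using isCont_gradient[of c] unfolding continuous_at_eps_delta by blast
  \<comment> \<open>\<open>q\<close> bounds \<open>g y\<close> and the last entry bounds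
    \<open>h / \<kappa>\<close>, each by \<open>\<rho> / 2\<close>, so that \<open>w\<close> below
    stays in the domain of the inverse.\<close>
  define r' where "r' = min (min r q) (\<kappa> * \<rho> / 4)"
  show ?thesis
  proof (rule that[of r'])
    show "0 < r'" "r' \<le> r" using r0 q k0 p0 by (auto simp: r'_def)
    show "strongly_convex_near \<kappa> c r'"
      unfolding strongly_convex_near_def
    proof (intro ballI)
      fix x y assume xy: "x \<in> ball c r'" "y \<in> ball c r'"
      define h where "h = x - y"
      \<comment> \<open>The maximizer of the lower bound for \<open>\<phi> x\<close> obtained by
        replacing \<open>\<psi> w\<close> in \<open>inner w x - \<psi> w\<close> by its quadratic
        majorant at \<open>g y\<close>.\<close>
      define w where "w = g y + (1 / \<kappa>) *\<^sub>R h"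
      have y: "g y \<in> ball 0 \<rho>" "m (g y) = y" using inv[of y] xy by (auto simp: r'_def)
      have "norm (g y) < \<rho> / 2" using q(2)[of y] xy crit by (simp add: r'_def dist_commute)
      moreover have "norm h < 2 * (\<kappa> * \<rho> / 4)"
        using dist_triangle2[of x y c] xy by (simp add: h_def dist_norm r'_def norm_minus_commute)
      hence "norm ((1 / \<kappa>) *\<^sub>R h) < \<rho> / 2" using k0 by (simp add: field_simps)
      ultimately have "norm w < \<rho>"
        using norm_triangle_ineq[of "g y" "(1 / \<kappa>) *\<^sub>R h"] unfolding w_def by linarith
      hence w: "w \<in> ball 0 \<rho>" by simp
      have "\<phi> (m w) + inner w (x - m w) \<le> \<phi> x"
        using conv[of x "m w"] m[OF w] xy rR by (auto simp: r'_def)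
      moreover have "\<psi> w \<le> \<psi> (g y) + inner (m (g y)) (w - g y) + \<kappa> / 2 * (norm (w - g y))\<^sup>2"
        by (rule Lipschitz_gradient_upper_bound[OF convex_ball D lip y(1) w])
      moreover have "inner (m (g y)) (w - g y) = inner y h / \<kappa>" by (simp add: y w_def)
      moreover have "\<kappa> / 2 * (norm (w - g y))\<^sup>2 = (norm h)\<^sup>2 / (2 * \<kappa>)"
        using k0 by (simp add: w_def power_divide power2_eq_square field_simps)
      moreover have "\<psi> (g y) = inner (g y) y - \<phi> y" by (simp add: \<psi>_def y)
      ultimately have "inner w x - inner (g y) y + \<phi> y - inner y h / \<kappa> - (norm h)\<^sup>2 / (2 * \<kappa>) \<le> \<phi> x"
        by (simp add: \<psi>_def inner_diff_right)
      moreover have "inner w x = inner (g y) y + inner (g y) h + inner y h / \<kappa> + (norm h)\<^sup>2 / \<kappa>"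
      proof -
        have "inner w x = inner w (y + h)" by (simp add: h_def)
        also have "\<dots> = inner (g y) y + inner (g y) h + inner y h / \<kappa> + (norm h)\<^sup>2 / \<kappa>"
          unfolding w_def by (simp add: inner_add_left inner_add_right inner_commute power2_norm_eq_inner add_divide_distrib)
        finally show ?thesis .
      qed
      moreover have "(norm h)\<^sup>2 / \<kappa> = 2 * ((norm h)\<^sup>2 / (2 * \<kappa>))" by simp
      ultimately show "\<phi> y + inner (g y) (x - y) + (norm (x - y))\<^sup>2 / (2 * \<kappa>) \<le> \<phi> x"
        unfolding h_def[symmetric] by linarith
    qed
  qed
qed

text \<open>As \<open>g (m v) = v\<close>, strong convexity at \<open>m v\<close> says that
  \<open>m v\<close> strictly minimizes the tilted function: the argmin mapping is the local
  inverse. The modulus is kept arbitrary because alternative (b) brings its own.\<close>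

lemma tilt_stable_and_strongly_convex:
  assumes reg: "metrically_regular \<kappa> (single g) c 0" and crit: "g c = 0" and R0: "0 < R"
    and psd: "\<And>y. y \<in> ball c R \<Longrightarrow> positive_semidefinite_mapping (generalized_hessian \<phi> y)"
  shows "tilt_stable_local_minimizer \<phi> c \<and> (\<exists>r>0. strongly_convex_near \<kappa> c r)"
proof -
  have k0: "0 < \<kappa>" using reg by (simp add: metrically_regular_def)
  have mono: "0 \<le> inner (g b - g a) (b - a)" if "a \<in> ball c R" "b \<in> ball c R" for a b
    using gradient_monotone_if_hessian_psd[OF psd that] .
  obtain \<rho> r1 m where m: "0 < \<rho>" "0 < r1" "r1 \<le> R" "\<And>v. v \<in> ball 0 \<rho> \<Longrightarrow> m v \<in> ball c R \<and> g (m v) = v"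
    "\<kappa>-lipschitz_on (ball 0 \<rho>) m" "\<And>y. y \<in> ball c r1 \<Longrightarrow> g y \<in> ball 0 \<rho> \<and> m (g y) = y"
    by (rule gradient_inverse[OF reg crit R0], rule mono, assumption+, rule that)
  obtain r where r: "0 < r" "r \<le> r1" and sc: "strongly_convex_near \<kappa> c r"
    by (rule strongly_convex_if_lipschitz_inverse[OF k0 crit m gradient_inequality_if_monotone[OF mono]])
  \<comment> \<open>The second entry places \<open>m v\<close> within \<open>r\<close> of
    \<open>c\<close>, inside the feasible ball of the tilted problem.\<close>
  define s where "s = min \<rho> (r / \<kappa>)"
  have s0: "0 < s" using m r k0 by (simp add: s_def)
  have m0: "m 0 = c" using m(6)[of c] m(2) crit by simp
  have argmin: "tilted_argmin \<phi> c r v = {m v}" if v: "v \<in> ball 0 s" for v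
  proof -
    have v': "v \<in> ball 0 \<rho>" using v by (simp add: s_def)
    have gm: "g (m v) = v" using m(4)[OF v'] by simp
    have "dist (m v) (m 0) \<le> \<kappa> * norm v" using lipschitz_onD[OF m(5) v', of 0] m(1) by simp
    also have "\<dots> < \<kappa> * (r / \<kappa>)" using v k0 by (intro mult_strict_left_mono) (auto simp: s_def)
    finally have mb: "m v \<in> ball c r" using k0 by (simp add: m0 dist_commute)
    have gt: "\<phi> (m v) - inner v (m v) < \<phi> x - inner v x" if "x \<in> ball c r" "x \<noteq> m v" for x
    proof -
      have "\<phi> (m v) + inner v (x - m v) + (norm (x - m v))\<^sup>2 / (2 * \<kappa>) \<le> \<phi> x"
        using sc mb that gm unfolding strongly_convex_near_def by force
      moreover have "0 < (norm (x - m v))\<^sup>2 / (2 * \<kappa>)" using k0 that by simp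
      ultimately show ?thesis by (simp add: inner_diff_right)
    qed
    have nb: "norm (x - c) < r \<longleftrightarrow> x \<in> ball c r" for x by (simp add: dist_norm norm_minus_commute)
    show ?thesis
      unfolding tilted_argmin_def is_arg_min_def nb
    proof (intro set_eqI iffI)
      fix x assume "x \<in> {x. x \<in> ball c r \<and> (\<nexists>y. y \<in> ball c r \<and> \<phi> y - inner v y < \<phi> x - inner v x)}"
      thus "x \<in> {m v}" using gt mb by blast
    next
      fix x assume "x \<in> {m v}"
      thus "x \<in> {x. x \<in> ball c r \<and> (\<nexists>y. y \<in> ball c r \<and> \<phi> y - inner v y < \<phi> x - inner v x)}"
        using gt mb by (auto dest: less_asym)
    qed
  qed
  have "tilted_argmin \<phi> c r 0 = {c}" using argmin[of 0] s0 m0 by simp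
  moreover have "\<kappa>-lipschitz_on (ball 0 s) m"
    by (rule lipschitz_on_subset[OF m(5)]) (auto simp: s_def)
  moreover have "open (ball (0::'a) s)" "(0::'a) \<in> ball 0 s" using s0 by auto
  ultimately have "tilt_stable_local_minimizer \<phi> c"
    unfolding tilt_stable_local_minimizer_def using r(1) argmin by blast
  thus ?thesis using r sc by blast
qed

end

section \<open>Semismoothness and the Newton step\<close>

lemma regular_subgradient_scaleR:
  assumes z: "regular_subgradient (\<lambda>x. inner u (g x)) y z" and "s > 0"
  shows "regular_subgradient (\<lambda>x. inner (s *\<^sub>R u) (g x)) y (s *\<^sub>R z)"
  unfolding regular_subgradient_def
proof (intro allI impI)
  fix \<epsilon> :: real assume "\<epsilon> > 0"
  hence "\<epsilon> / s > 0" using \<open>s > 0\<close> by simp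
  with z have "\<forall>\<^sub>F x in nhds y. inner u (g y) + inner z (x - y) - \<epsilon> / s * norm (x - y) \<le> inner u (g x)"
    unfolding regular_subgradient_def by blast
  thus "\<forall>\<^sub>F x in nhds y. inner (s *\<^sub>R u) (g y) + inner (s *\<^sub>R z) (x - y) - \<epsilon> * norm (x - y) \<le> inner (s *\<^sub>R u) (g x)"
  proof eventually_elim
    case (elim x)
    hence "s * (inner u (g y) + inner z (x - y) - \<epsilon> / s * norm (x - y)) \<le> s * inner u (g x)"
      using \<open>s > 0\<close> by simp
    thus ?case using \<open>s > 0\<close> by (simp add: right_diff_distrib distrib_left)
  qed
qed

context C11_function begin

text \<open>Compactness: normalized violations at points tending to \<open>c\<close> have a
  convergent subsequence, whose limit is a directional normal violating semismoothness. The
  Lipschitz bound keeps both the slopes of \<open>g\<close> and the normals bounded.\<close>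

lemma semismooth_star_uniform:
  assumes ss: "semismooth_star (single g) c (g c)" and crit: "g c = 0" and e0: "\<epsilon> > 0"
  shows "\<exists>\<delta>>0. \<forall>y\<in>ball c \<delta>. \<forall>u z. regular_subgradient (\<lambda>x. inner u (g x)) y z \<longrightarrow>
    \<bar>inner z (y - c) - inner u (g y)\<bar> \<le> \<epsilon> * norm (y - c) * norm u"
proof (rule ccontr)
  assume neg: "\<not> ?thesis"
  obtain l r where l0: "0 < l" and r0: "0 < r" and lip: "l-lipschitz_on (ball c r) g"
    by (rule lipschitz_near)
  have "\<exists>y u z. y \<in> ball c (r / real (Suc n)) \<and> regular_subgradient (\<lambda>x. inner u (g x)) y z \<and>
      \<epsilon> * norm (y - c) * norm u < \<bar>inner z (y - c) - inner u (g y)\<bar>" for n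
  proof -
    have "r / real (Suc n) > 0" using r0 by simp
    thus ?thesis using neg by (meson not_le)
  qed
  then obtain ys us zs where ys: "\<And>n. ys n \<in> ball c (r / real (Suc n))"
    and reg: "\<And>n. regular_subgradient (\<lambda>x. inner (us n) (g x)) (ys n) (zs n)"
    and viol: "\<And>n. \<epsilon> * norm (ys n - c) * norm (us n) < \<bar>inner (zs n) (ys n - c) - inner (us n) (g (ys n))\<bar>"
    by metis
  have ysr: "ys n \<in> ball c r" for n
  proof -
    have "r / real (Suc n) \<le> r" using r0 by (simp add: divide_le_eq mult_le_cancel_left1)
    thus ?thesis using ys[of n] by simp
  qed
  have gl: "norm (g (ys n)) \<le> l * norm (ys n - c)" for n
    using lipschitz_onD[OF lip ysr[of n], of c] r0 crit by (simp add: dist_norm)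
  have zl: "norm (zs n) \<le> l * norm (us n)" for n
    using regular_subgradient_norm_le[OF reg open_ball ysr lip] .
  \<comment> \<open>A strict violation excludes \<open>ys n = c\<close> and \<open>us n = 0\<close>,
    so both normalizations are legitimate.\<close>
  have t0: "norm (ys n - c) > 0" for n
    using viol[of n] crit by (cases "ys n = c") auto
  have u0: "norm (us n) > 0" for n
    using viol[of n] zl[of n] by (cases "us n = 0") auto
  define t where "t n = norm (ys n - c)" for n
  define w where "w n = (ys n - c) /\<^sub>R t n" for n
  define v where "v n = g (ys n) /\<^sub>R t n" for n
  define p where "p n = zs n /\<^sub>R norm (us n)" for n
  define q where "q n = us n /\<^sub>R norm (us n)" for n
  have tp: "t n > 0" for n using t0 by (simp add: t_def)
  have nw: "norm (w n) \<le> 1" for n using tp[of n] by (simp add: w_def t_def)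
  have nv: "norm (v n) \<le> l" for n
    using gl[of n] tp[of n] by (simp add: v_def t_def divide_inverse_commute[symmetric] pos_divide_le_eq)
  have np: "norm (p n) \<le> l" for n
    using zl[of n] u0[of n] by (simp add: p_def divide_inverse_commute[symmetric] pos_divide_le_eq)
  have nq: "norm (q n) \<le> 1" for n using u0[of n] by (simp add: q_def)
  have "bounded (range (\<lambda>n. ((w n, v n), (p n, q n))))"
    unfolding bounded_iff
  proof (intro exI ballI)
    fix a assume "a \<in> range (\<lambda>n. ((w n, v n), (p n, q n)))"
    then obtain n where a: "a = ((w n, v n), (p n, q n))" by blast
    have "norm a \<le> norm (w n, v n) + norm (p n, q n)" unfolding a by (rule norm_Pair_le)
    also have "\<dots> \<le> (norm (w n) + norm (v n)) + (norm (p n) + norm (q n))"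
      by (intro add_mono norm_Pair_le)
    also have "\<dots> \<le> (1 + l) + (l + 1)" using nw nv np nq by (intro add_mono)
    finally show "norm a \<le> (1 + l) + (l + 1)" .
  qed
  from bounded_imp_convergent_subsequence[OF this]
  obtain L s where s: "strict_mono s" and L: "((\<lambda>n. ((w n, v n), (p n, q n))) \<circ> s) \<longlonglongrightarrow> L"
    by blast
  obtain w' v' p' q' where L_eq: "L = ((w', v'), (p', q'))" by (cases L) auto
  have lim: "(\<lambda>n. w (s n)) \<longlonglongrightarrow> w'" "(\<lambda>n. v (s n)) \<longlonglongrightarrow> v'" "(\<lambda>n. p (s n)) \<longlonglongrightarrow> p'" "(\<lambda>n. q (s n)) \<longlonglongrightarrow> q'"
    using tendsto_fst[OF tendsto_fst[OF L]] tendsto_snd[OF tendsto_fst[OF L]]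
      tendsto_fst[OF tendsto_snd[OF L]] tendsto_snd[OF tendsto_snd[OF L]]
    by (simp_all add: L_eq o_def)
  have "t \<longlonglongrightarrow> 0"
  proof (rule tendsto_sandwich[OF _ _ tendsto_const, of _ _ _ "\<lambda>n. r / real (Suc n)"])
    show "\<forall>\<^sub>F n in sequentially. t n \<le> r / real (Suc n)"
      using ys by (intro always_eventually allI) (simp add: t_def dist_norm norm_minus_commute less_imp_le)
    show "(\<lambda>n. r / real (Suc n)) \<longlonglongrightarrow> 0"
      using LIMSEQ_Suc[OF lim_const_over_n[of r]] by simp
    show "\<forall>\<^sub>F n in sequentially. 0 \<le> t n" using tp by (simp add: less_imp_le)
  qed
  hence lim_t: "(\<lambda>n. t (s n)) \<longlonglongrightarrow> 0" using LIMSEQ_subseq_LIMSEQ[OF _ s] by (auto simp: o_def)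
  have "(p', - q') \<in> directional_normal_cone (gph (single g)) (c, g c) (w', v')"
    unfolding directional_normal_cone_def mem_Collect_eq
  proof (intro conjI exI allI)
    show "(c, g c) \<in> gph (single g)" by (simp add: gph_def)
    fix n
    show "t (s n) > 0" by (rule tp)
    have "(c, g c) + t (s n) *\<^sub>R (w (s n), v (s n)) = (ys (s n), g (ys (s n)))"
      using tp[of "s n"] by (simp add: w_def v_def crit)
    moreover have "regular_subgradient (\<lambda>x. inner (q n) (g x)) (ys n) (p n)" for n
      unfolding q_def p_def using u0[of n] by (intro regular_subgradient_scaleR reg) simp
    ultimately show "(p (s n), - q (s n)) \<in> regular_normal_cone (gph (single g)) ((c, g c) + t (s n) *\<^sub>R (w (s n), v (s n)))"
      by (simp only: regular_normal_graphI)
  next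
    show "(\<lambda>n. t (s n)) \<longlonglongrightarrow> 0" by (rule lim_t)
    show "(\<lambda>n. (w (s n), v (s n))) \<longlonglongrightarrow> (w', v')" using lim by (intro tendsto_Pair)
    show "(\<lambda>n. (p (s n), - q (s n))) \<longlonglongrightarrow> (p', - q')" using lim by (intro tendsto_Pair tendsto_minus)
  qed
  hence eq: "inner p' w' = inner q' v'" using ss unfolding semismooth_star_def by blast
  have "\<epsilon> \<le> \<bar>inner (p n) (w n) - inner (q n) (v n)\<bar>" for n
  proof -
    have "inner (p n) (w n) - inner (q n) (v n) = (inner (zs n) (ys n - c) - inner (us n) (g (ys n))) / (t n * norm (us n))"
      by (simp add: p_def w_def q_def v_def diff_divide_distrib divide_inverse algebra_simps)
    hence "\<bar>inner (p n) (w n) - inner (q n) (v n)\<bar> = \<bar>inner (zs n) (ys n - c) - inner (us n) (g (ys n))\<bar> / (t n * norm (us n))"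
      using tp[of n] by (simp add: abs_mult)
    moreover have "\<epsilon> * (t n * norm (us n)) \<le> \<bar>inner (zs n) (ys n - c) - inner (us n) (g (ys n))\<bar>"
      using viol[of n] by (simp add: t_def mult.assoc)
    ultimately show ?thesis using tp[of n] u0[of n] by (simp add: pos_le_divide_eq)
  qed
  moreover have "(\<lambda>n. \<bar>inner (p (s n)) (w (s n)) - inner (q (s n)) (v (s n))\<bar>) \<longlonglongrightarrow> \<bar>inner p' w' - inner q' v'\<bar>"
    using lim by (intro tendsto_intros)
  ultimately have "\<epsilon> \<le> \<bar>inner p' w' - inner q' v'\<bar>"
    by (intro tendsto_lowerbound) auto
  thus False using eq e0 by simp
qed

text \<open>The bound on \<open>e = y + d - c\<close> comes from \<open>e = d + (y - c)\<close>: the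
  pairing of \<open>z'\<close> with the first summand is controlled by symmetry, with the second by
  semismoothness. As symmetry moves the base point to \<open>y'\<close>, the latter is needed on a
  whole ball.\<close>

lemma newton_step_regular:
  assumes sc: "strongly_convex_near \<kappa> c r" and k0: "0 < \<kappa>" and lip: "l-lipschitz_on (ball c r) g"
    and e0: "\<epsilon> > 0"
    and ss: "\<And>y u z. y \<in> ball c r \<Longrightarrow> regular_subgradient (\<lambda>x. inner u (g x)) y z \<Longrightarrow>
      \<bar>inner z (y - c) - inner u (g y)\<bar> \<le> \<epsilon> * norm (y - c) * norm u"
    and y: "y \<in> ball c r" and z: "regular_subgradient (\<lambda>x. inner d (g x)) y z"
  shows "norm (y + d - c) \<le> \<kappa> * (norm (g y + z) + \<epsilon> * norm (y - c))"
proof -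
  define e where "e = y + d - c"
  \<comment> \<open>Collects the coefficients of \<open>\<eta>\<close>: the symmetry error, the
    replacement of \<open>y'\<close> by \<open>y\<close> in the pairing with \<open>z'\<close> and
    in \<open>g\<close>, and the change of the semismoothness error.\<close>
  define C where "C = 1 + 2 * l * norm e + \<epsilon> * norm e"
  have l0: "0 \<le> l" using lip by (rule lipschitz_on_nonneg)
  have C0: "C > 0" using l0 e0 by (simp add: C_def add_pos_nonneg)
  have "(norm e)\<^sup>2 / \<kappa> \<le> inner (g y + z) e + \<epsilon> * norm (y - c) * norm e"
  proof (rule field_le_epsilon)
    fix a :: real assume "a > 0"
    define \<eta> where "\<eta> = min (r - dist c y) (a / C)"
    have "\<eta> > 0" using y C0 \<open>a > 0\<close> by (simp add: \<eta>_def)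
    have "\<eta> \<le> a / C" by (simp add: \<eta>_def)
    hence Ca: "C * \<eta> \<le> a" using C0 by (simp add: field_simps)
    obtain y' z' where y': "dist y y' < \<eta>" and z': "regular_subgradient (\<lambda>x. inner e (g x)) y' z'"
      and le: "inner z' d \<le> inner z e + \<eta>"
      by (rule regular_subgradient_gradient_symmetry[OF GDERIV_gradient continuous_gradient z \<open>\<eta> > 0\<close>, of e])
    have y'r: "y' \<in> ball c r" using dist_triangle[of c y' y] y' by (simp add: \<eta>_def)
    have yy: "norm (y - y') \<le> \<eta>" using y' by (simp add: dist_norm)
    have "(norm e)\<^sup>2 / \<kappa> \<le> inner z' e" by (rule regular_subgradient_strongly_convex[OF sc y'r z'])
    also have "\<dots> = inner z' d + inner z' (y' - c) + inner z' (y - y')"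
      by (simp add: e_def inner_diff_right inner_add_right)
    also have "\<dots> \<le> (inner z e + \<eta>) + (inner e (g y') + \<epsilon> * norm (y' - c) * norm e) + l * norm e * \<eta>"
    proof (intro add_mono le)
      show "inner z' (y' - c) \<le> inner e (g y') + \<epsilon> * norm (y' - c) * norm e"
        using ss[OF y'r z'] by linarith
      have "inner z' (y - y') \<le> norm z' * norm (y - y')" by (rule norm_cauchy_schwarz)
      also have "\<dots> \<le> (l * norm e) * \<eta>"
        using regular_subgradient_norm_le[OF z' open_ball y'r lip] yy l0 by (intro mult_mono) auto
      finally show "inner z' (y - y') \<le> l * norm e * \<eta>" .
    qed
    finally have 1: "(norm e)\<^sup>2 / \<kappa> \<le> (inner z e + \<eta>) + (inner e (g y') + \<epsilon> * norm (y' - c) * norm e) + l * norm e * \<eta>" .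
    have "inner e (g y' - g y) \<le> norm e * norm (g y' - g y)" by (rule norm_cauchy_schwarz)
    also have "\<dots> \<le> norm e * (l * \<eta>)"
    proof (intro mult_left_mono)
      have "norm (g y' - g y) \<le> l * norm (y - y')"
        using lipschitz_onD[OF lip y'r y] by (simp add: dist_norm norm_minus_commute)
      also have "\<dots> \<le> l * \<eta>" using yy l0 by (rule mult_left_mono)
      finally show "norm (g y' - g y) \<le> l * \<eta>" .
    qed simp
    finally have 2: "inner e (g y') \<le> inner e (g y) + norm e * (l * \<eta>)" by (simp add: inner_diff_right)
    have 3: "\<epsilon> * norm (y' - c) * norm e \<le> \<epsilon> * (norm (y - c) + \<eta>) * norm e"
      using e0 yy norm_triangle_ineq4[of "y - c" "y - y'"] by (intro mult_right_mono mult_left_mono) auto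
    have "inner z e + \<eta> + (inner e (g y) + norm e * (l * \<eta>) + \<epsilon> * (norm (y - c) + \<eta>) * norm e) + l * norm e * \<eta>
        = inner (g y + z) e + \<epsilon> * norm (y - c) * norm e + C * \<eta>"
      by (simp add: C_def inner_add_left inner_commute algebra_simps)
    also have "\<dots> \<le> inner (g y + z) e + \<epsilon> * norm (y - c) * norm e + a" using Ca by simp
    finally show "(norm e)\<^sup>2 / \<kappa> \<le> inner (g y + z) e + \<epsilon> * norm (y - c) * norm e + a" using 1 2 3 by linarith
  qed
  also have "\<dots> \<le> norm (g y + z) * norm e + \<epsilon> * norm (y - c) * norm e"
    using norm_cauchy_schwarz[of "g y + z" e] by simp
  finally have "norm e * norm e \<le> (\<kappa> * (norm (g y + z) + \<epsilon> * norm (y - c))) * norm e"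
    using k0 by (simp add: pos_divide_le_eq power2_eq_square algebra_simps)
  moreover have "0 \<le> \<kappa> * (norm (g y + z) + \<epsilon> * norm (y - c))" using k0 e0 by simp
  ultimately have "norm e \<le> \<kappa> * (norm (g y + z) + \<epsilon> * norm (y - c))" by (cases "e = 0") auto
  thus ?thesis by (simp add: e_def)
qed

text \<open>The residual \<open>g x + z\<close> stays in the bound because the algorithm solves a
  regularized equation only.\<close>

lemma newton_step_estimate:
  assumes sc: "strongly_convex_near \<kappa> c r" and k0: "0 < \<kappa>" and r0: "0 < r"
    and ss: "semismooth_star (single g) c (g c)" and crit: "g c = 0" and e0: "\<epsilon> > 0"
  shows "\<exists>\<delta>>0. \<forall>x\<in>ball c \<delta>. \<forall>d. \<forall>z\<in>generalized_hessian \<phi> x d.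
    norm (x + d - c) \<le> \<kappa> * (norm (g x + z) + \<epsilon> * norm (x - c))"
proof -
  obtain \<delta> where d0: "\<delta> > 0" and \<delta>: "\<And>y u z. y \<in> ball c \<delta> \<Longrightarrow> regular_subgradient (\<lambda>x. inner u (g x)) y z \<Longrightarrow>
      \<bar>inner z (y - c) - inner u (g y)\<bar> \<le> \<epsilon> * norm (y - c) * norm u"
    using semismooth_star_uniform[OF ss crit e0] by blast
  obtain l q where q0: "0 < q" and lip: "l-lipschitz_on (ball c q) g" by (rule lipschitz_near)
  define s where "s = min (min r q) \<delta>"
  have sub: "ball c s \<subseteq> ball c r" "ball c s \<subseteq> ball c q" "ball c s \<subseteq> ball c \<delta>" by (auto simp: s_def)
  have sc': "strongly_convex_near \<kappa> c s" using sc sub unfolding strongly_convex_near_def by blast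
  have lip': "l-lipschitz_on (ball c s) g" using lip sub(2) by (rule lipschitz_on_subset)
  show ?thesis
  proof (intro exI[of _ s] conjI ballI allI)
    show "s > 0" using r0 q0 d0 by (simp add: s_def)
    fix x d z assume x: "x \<in> ball c s" and z: "z \<in> generalized_hessian \<phi> x d"
    obtain us ys zs where lim: "\<And>k::nat. regular_subgradient (\<lambda>x. inner (us k) (g x)) (ys k) (zs k)"
      "ys \<longlonglongrightarrow> x" "zs \<longlonglongrightarrow> z" "us \<longlonglongrightarrow> d" by (rule generalized_hessianE[OF z]) (rule that)
    have "\<forall>\<^sub>F k in sequentially. ys k \<in> ball c s" using lim(2) open_ball x by (rule topological_tendstoD)
    hence ev: "\<forall>\<^sub>F k in sequentially. norm (ys k + us k - c) \<le> \<kappa> * (norm (g (ys k) + zs k) + \<epsilon> * norm (ys k - c))"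
    proof eventually_elim
      case (elim k)
      show ?case
        by (rule newton_step_regular[OF sc' k0 lip' e0 _ elim lim(1)]) (use \<delta> sub in blast)
    qed
    have "(\<lambda>k. g (ys k)) \<longlonglongrightarrow> g x" using isCont_gradient lim(2) by (rule isCont_tendsto_compose)
    hence "(\<lambda>k. \<kappa> * (norm (g (ys k) + zs k) + \<epsilon> * norm (ys k - c))) \<longlonglongrightarrow> \<kappa> * (norm (g x + z) + \<epsilon> * norm (x - c))"
      using lim by (intro tendsto_intros)
    moreover have "(\<lambda>k. norm (ys k + us k - c)) \<longlonglongrightarrow> norm (x + d - c)" using lim by (intro tendsto_intros)
    ultimately show "norm (x + d - c) \<le> \<kappa> * (norm (g x + z) + \<epsilon> * norm (x - c))"
      using ev by (intro tendsto_le[of sequentially]) auto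
  qed
qed

text \<open>Directions of violations converge to some \<open>w'\<close>. By Lipschitz continuity the
  directional derivative \<open>D\<close> along \<open>w'\<close> describes \<open>g\<close> along
  \<open>w n\<close> at all small steps at once, so both vectors compared are close to the same
  multiple of \<open>D\<close>.\<close>

lemma directionally_differentiable_uniform:
  assumes dd: "directionally_differentiable_at g c" and crit: "g c = 0" and e0: "\<epsilon> > 0"
  shows "\<exists>\<delta>>0. \<forall>h. norm h < \<delta> \<longrightarrow> (\<forall>t\<in>{0..1}. norm (g (c + t *\<^sub>R h) - t *\<^sub>R g (c + h)) \<le> \<epsilon> * norm h)"
proof (rule ccontr)
  assume neg: "\<not> ?thesis"
  obtain l r where l0: "0 < l" and r0: "0 < r" and lip: "l-lipschitz_on (ball c r) g"
    by (rule lipschitz_near)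
  have "\<exists>h t. norm h < r / real (Suc n) \<and> t \<in> {0..1} \<and> \<epsilon> * norm h < norm (g (c + t *\<^sub>R h) - t *\<^sub>R g (c + h))" for n
  proof -
    have "r / real (Suc n) > 0" using r0 by simp
    thus ?thesis using neg by (meson not_le)
  qed
  then obtain hs ts where hs: "\<And>n. norm (hs n) < r / real (Suc n)" and ts: "\<And>n. ts n \<in> {0..1}"
    and viol: "\<And>n. \<epsilon> * norm (hs n) < norm (g (c + ts n *\<^sub>R hs n) - ts n *\<^sub>R g (c + hs n))"
    by metis
  define s where "s n = norm (hs n)" for n
  have s0: "s n > 0" for n using viol[of n] crit by (cases "hs n = 0") (auto simp: s_def)
  have sr: "s n < r" for n
  proof -
    have "r / real (Suc n) \<le> r" using r0 by (simp add: divide_le_eq mult_le_cancel_left1)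
    thus ?thesis using hs[of n] by (simp add: s_def)
  qed
  define w where "w n = hs n /\<^sub>R s n" for n
  have h_eq: "hs n = s n *\<^sub>R w n" for n using s0[of n] by (simp add: w_def)
  have nw: "norm (w n) = 1" for n using s0[of n] by (simp add: w_def s_def)
  have "bounded (range w)" unfolding bounded_iff using nw by (intro exI[of _ 1]) auto
  from bounded_imp_convergent_subsequence[OF this]
  obtain w' f where f: "strict_mono f" and lim: "(w \<circ> f) \<longlonglongrightarrow> w'"
    by blast
  have nw': "norm w' = 1"
    using LIMSEQ_unique[OF tendsto_norm[OF lim] ] nw by (simp add: o_def)
  obtain D where "((\<lambda>t. (g (c + t *\<^sub>R w') - g c) /\<^sub>R t) \<longlongrightarrow> D) (at_right 0)"
    using dd unfolding directionally_differentiable_at_def by blast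
  moreover have "\<epsilon> / 4 > 0" using e0 by simp
  ultimately have "\<forall>\<^sub>F t in at_right 0. dist ((g (c + t *\<^sub>R w') - g c) /\<^sub>R t) D < \<epsilon> / 4"
    by (rule tendstoD)
  then obtain a where a0: "a > 0" and a: "\<And>t. 0 < t \<Longrightarrow> t < a \<Longrightarrow> dist ((g (c + t *\<^sub>R w') - g c) /\<^sub>R t) D < \<epsilon> / 4"
    unfolding eventually_at_right_field by blast
  have "s \<longlonglongrightarrow> 0"
  proof (rule tendsto_sandwich[OF _ _ tendsto_const, of _ _ _ "\<lambda>n. r / real (Suc n)"])
    show "\<forall>\<^sub>F n in sequentially. s n \<le> r / real (Suc n)"
      using hs by (intro always_eventually allI) (simp add: s_def less_imp_le)
    show "(\<lambda>n. r / real (Suc n)) \<longlonglongrightarrow> 0"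
      using LIMSEQ_Suc[OF lim_const_over_n[of r]] by simp
    show "\<forall>\<^sub>F n in sequentially. 0 \<le> s n" using s0 by (simp add: less_imp_le)
  qed
  hence "(s \<circ> f) \<longlonglongrightarrow> 0" using f by (rule LIMSEQ_subseq_LIMSEQ)
  hence "\<forall>\<^sub>F n in sequentially. (s \<circ> f) n < a" using a0 by (rule order_tendstoD)
  moreover have "\<forall>\<^sub>F n in sequentially. dist ((w \<circ> f) n) w' < \<epsilon> / (4 * l)"
    by (intro tendstoD[OF lim]) (use e0 l0 in simp)
  ultimately have "\<forall>\<^sub>F n in sequentially. (s \<circ> f) n < a \<and> dist ((w \<circ> f) n) w' < \<epsilon> / (4 * l)"
    by (rule eventually_conj)
  then obtain n where n: "s n < a" "dist (w n) w' < \<epsilon> / (4 * l)"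
    by (auto simp: eventually_sequentially)
  have lw: "l * norm (w n - w') \<le> \<epsilon> / 4" using n(2) l0 by (simp add: dist_norm field_simps)
  \<comment> \<open>One \<open>\<epsilon> / 4\<close> pays for replacing \<open>w n\<close> by
    \<open>w'\<close>, the other for the difference quotient.\<close>
  have close: "norm (g (c + t *\<^sub>R w n) - t *\<^sub>R D) \<le> \<epsilon> / 2 * t" if t: "0 \<le> t" "t \<le> s n" for t
  proof (cases "t = 0")
    case False
    hence tp: "0 < t" using t by simp
    have "c + t *\<^sub>R w n \<in> ball c r" "c + t *\<^sub>R w' \<in> ball c r"
      using tp t sr[of n] nw[of n] nw' by (auto simp: dist_norm)
    hence "norm (g (c + t *\<^sub>R w n) - g (c + t *\<^sub>R w')) \<le> l * norm (t *\<^sub>R (w n - w'))"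
      using lipschitz_onD[OF lip, of "c + t *\<^sub>R w n" "c + t *\<^sub>R w'"] by (simp add: dist_norm scaleR_diff_right)
    also have "\<dots> = t * (l * norm (w n - w'))" using tp by simp
    also have "\<dots> \<le> t * (\<epsilon> / 4)" using lw tp by (intro mult_left_mono) auto
    finally have 1: "norm (g (c + t *\<^sub>R w n) - g (c + t *\<^sub>R w')) \<le> t * (\<epsilon> / 4)" .
    have "norm (t *\<^sub>R (g (c + t *\<^sub>R w') /\<^sub>R t - D)) \<le> t * (\<epsilon> / 4)"
      using a[of t] tp t n crit by (simp add: dist_norm)
    moreover have "t *\<^sub>R (g (c + t *\<^sub>R w') /\<^sub>R t - D) = g (c + t *\<^sub>R w') - t *\<^sub>R D"
      using tp by (simp add: scaleR_diff_right)
    ultimately have 2: "norm (g (c + t *\<^sub>R w') - t *\<^sub>R D) \<le> t * (\<epsilon> / 4)" by simp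
    have "norm (g (c + t *\<^sub>R w n) - t *\<^sub>R D) \<le> norm (g (c + t *\<^sub>R w n) - g (c + t *\<^sub>R w')) + norm (g (c + t *\<^sub>R w') - t *\<^sub>R D)"
      using norm_triangle_ineq[of "g (c + t *\<^sub>R w n) - g (c + t *\<^sub>R w')" "g (c + t *\<^sub>R w') - t *\<^sub>R D"] by simp
    thus ?thesis using 1 2 by (simp add: algebra_simps)
  qed (simp add: crit)
  have t01: "0 \<le> ts n" "ts n \<le> 1" using ts[of n] by auto
  have A: "norm (g (c + (ts n * s n) *\<^sub>R w n) - (ts n * s n) *\<^sub>R D) \<le> \<epsilon> / 2 * (ts n * s n)"
    using t01 s0[of n] by (intro close) (auto simp: mult_left_le_one_le less_imp_le)
  have "\<dots> \<le> \<epsilon> / 2 * s n" using t01 s0[of n] e0 by (simp add: mult_left_le_one_le)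
  note A = order_trans[OF A this]
  have B: "norm (g (c + s n *\<^sub>R w n) - s n *\<^sub>R D) \<le> \<epsilon> / 2 * s n"
    using s0[of n] by (intro close) auto
  have "norm (ts n *\<^sub>R (g (c + s n *\<^sub>R w n) - s n *\<^sub>R D)) \<le> norm (g (c + s n *\<^sub>R w n) - s n *\<^sub>R D)"
    using t01 by (simp add: mult_left_le_one_le)
  note B = order_trans[OF this B]
  have "g (c + ts n *\<^sub>R hs n) - ts n *\<^sub>R g (c + hs n)
      = (g (c + (ts n * s n) *\<^sub>R w n) - (ts n * s n) *\<^sub>R D) - ts n *\<^sub>R (g (c + s n *\<^sub>R w n) - s n *\<^sub>R D)"
    unfolding h_eq by (simp add: scaleR_diff_right)
  hence "norm (g (c + ts n *\<^sub>R hs n) - ts n *\<^sub>R g (c + hs n))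
      \<le> norm (g (c + (ts n * s n) *\<^sub>R w n) - (ts n * s n) *\<^sub>R D) + norm (ts n *\<^sub>R (g (c + s n *\<^sub>R w n) - s n *\<^sub>R D))"
    by (simp only: norm_triangle_ineq4)
  also have "\<dots> \<le> \<epsilon> / 2 * s n + \<epsilon> / 2 * s n" using A B by (rule add_mono)
  also have "\<dots> = \<epsilon> * norm (hs n)" by (simp add: s_def)
  finally show False using viol[of n] by simp
qed

text \<open>Along the segment the gradient is almost \<open>t\<close> times its end value, and
  \<open>t\<close> integrates to one half: the origin of the bound
  \<open>\<sigma>1 < 1 / 2\<close>.\<close>

lemma directionally_differentiable_second_order:
  assumes dd: "directionally_differentiable_at g c" and crit: "g c = 0" and e0: "\<epsilon> > 0"
  shows "\<exists>\<delta>>0. \<forall>h. norm h < \<delta> \<longrightarrow> inner (g (c + h)) h / 2 - \<epsilon> * (norm h)\<^sup>2 \<le> \<phi> (c + h) - \<phi> c"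
proof -
  obtain \<delta> where d0: "\<delta> > 0" and \<delta>: "\<And>h t. norm h < \<delta> \<Longrightarrow> t \<in> {0..1} \<Longrightarrow>
      norm (g (c + t *\<^sub>R h) - t *\<^sub>R g (c + h)) \<le> \<epsilon> * norm h"
    using directionally_differentiable_uniform[OF dd crit e0] by blast
  show ?thesis
  proof (intro exI[of _ \<delta>] conjI allI impI d0)
    fix h :: 'a assume h: "norm h < \<delta>"
    let ?f = "\<lambda>t. inner (g (c + h)) h / 2 * t\<^sup>2 - \<phi> (c + t *\<^sub>R h)"
    have "?f 1 - ?f 0 \<le> \<epsilon> * (norm h)\<^sup>2 * (1 - 0)"
    proof (rule increment_le_if_derivative_le)
      fix t :: real assume t: "0 \<le> t" "t \<le> 1"
      show "(?f has_real_derivative inner (g (c + h)) h * t - inner (g (c + t *\<^sub>R h)) h) (at t)"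
        by (rule derivative_eq_intros DERIV_along_line GDERIV_gradient refl | simp)+
      have "inner (- (g (c + t *\<^sub>R h) - t *\<^sub>R g (c + h))) h \<le> norm (- (g (c + t *\<^sub>R h) - t *\<^sub>R g (c + h))) * norm h"
        by (rule norm_cauchy_schwarz)
      also have "\<dots> \<le> (\<epsilon> * norm h) * norm h"
        using \<delta>[OF h, of t] t by (intro mult_right_mono) (auto simp: norm_minus_commute)
      finally show "inner (g (c + h)) h * t - inner (g (c + t *\<^sub>R h)) h \<le> \<epsilon> * (norm h)\<^sup>2"
        by (simp add: inner_diff_left power2_eq_square algebra_simps)
    qed simp
    thus "inner (g (c + h)) h / 2 - \<epsilon> * (norm h)\<^sup>2 \<le> \<phi> (c + h) - \<phi> c" by simp
  qed
qed

end


section \<open>The surplus needed in the Armijo test of the unit step\<close>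

context C11_function begin

text \<open>Growth with constant \<open>1 / (2 * \<kappa>)\<close> is set against the Lipschitz
  bound \<open>l\<close> on the gradient; \<open>\<eta>\<close> is their difference after weighting
  by \<open>\<sigma>\<close>.\<close>

lemma sufficient_decrease_if_moduli:
  assumes sc: "strongly_convex_near \<kappa> c r" and r0: "0 < r" and k0: "0 < \<kappa>"
    and crit: "g c = 0" and lip: "lipschitz_around l g c" and l0: "0 < l"
    and \<sigma>: "0 < \<sigma>" "\<sigma> < 1 / (2 * l * \<kappa>)"
  shows "\<exists>\<eta>>0. \<forall>\<^sub>F y in nhds c. \<sigma> * inner (g y) (y - c) + \<eta> * (norm (y - c))\<^sup>2 \<le> \<phi> y - \<phi> c"
proof (intro exI conjI)
  obtain S where S: "open S" "c \<in> S" "l-lipschitz_on S g" using lip unfolding lipschitz_around_def by blast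
  show "1 / (2 * \<kappa>) - \<sigma> * l > 0" using \<sigma> l0 k0 by (simp add: field_simps)
  have "\<forall>\<^sub>F y in nhds c. y \<in> S" using S by (intro eventually_nhds_in_open)
  moreover have "\<forall>\<^sub>F y in nhds c. y \<in> ball c r" using r0 by (intro eventually_nhds_in_open) auto
  ultimately show "\<forall>\<^sub>F y in nhds c. \<sigma> * inner (g y) (y - c) + (1 / (2 * \<kappa>) - \<sigma> * l) * (norm (y - c))\<^sup>2 \<le> \<phi> y - \<phi> c"
  proof eventually_elim
    case (elim y)
    have "\<phi> c + inner (g c) (y - c) + (norm (y - c))\<^sup>2 / (2 * \<kappa>) \<le> \<phi> y"
      using sc elim r0 unfolding strongly_convex_near_def by auto
    hence 1: "(norm (y - c))\<^sup>2 / (2 * \<kappa>) \<le> \<phi> y - \<phi> c" by (simp add: crit)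
    have "inner (g y) (y - c) \<le> norm (g y) * norm (y - c)" by (rule norm_cauchy_schwarz)
    also have "\<dots> \<le> (l * norm (y - c)) * norm (y - c)"
      using lipschitz_onD[OF S(3) elim(1) S(2)] crit by (intro mult_right_mono) (auto simp: dist_norm)
    finally have "\<sigma> * inner (g y) (y - c) \<le> \<sigma> * (l * norm (y - c) * norm (y - c))"
      using \<sigma> by (intro mult_left_mono) auto
    thus ?case using 1 by (simp add: power2_eq_square left_diff_distrib mult.assoc)
  qed
qed

text \<open>Strong monotonicity turns the margin \<open>1 / 2 - \<sigma>\<close> into
  \<open>2 * \<eta>\<close> times the squared distance; one \<open>\<eta>\<close> absorbs the
  second-order error.\<close>

lemma sufficient_decrease_if_directionally_differentiable:
  assumes sc: "strongly_convex_near \<kappa> c r" and r0: "0 < r" and k0: "0 < \<kappa>"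
    and crit: "g c = 0" and dd: "directionally_differentiable_at g c"
    and \<sigma>: "\<sigma> < 1 / 2"
  shows "\<exists>\<eta>>0. \<forall>\<^sub>F y in nhds c. \<sigma> * inner (g y) (y - c) + \<eta> * (norm (y - c))\<^sup>2 \<le> \<phi> y - \<phi> c"
proof -
  define \<eta> where "\<eta> = (1 / 2 - \<sigma>) / (2 * \<kappa>)"
  have e0: "\<eta> > 0" using \<sigma> k0 by (simp add: \<eta>_def)
  obtain \<delta> where d0: "\<delta> > 0"
    and \<delta>: "\<And>h. norm h < \<delta> \<Longrightarrow> inner (g (c + h)) h / 2 - \<eta> * (norm h)\<^sup>2 \<le> \<phi> (c + h) - \<phi> c"
    using directionally_differentiable_second_order[OF dd crit e0] by blast
  have "\<forall>\<^sub>F y in nhds c. y \<in> ball c (min r \<delta>)" using r0 d0 by (intro eventually_nhds_in_open) auto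
  hence "\<forall>\<^sub>F y in nhds c. \<sigma> * inner (g y) (y - c) + \<eta> * (norm (y - c))\<^sup>2 \<le> \<phi> y - \<phi> c"
  proof eventually_elim
    case (elim y)
    have "norm (y - c) < \<delta>" using elim by (simp add: dist_norm norm_minus_commute)
    from \<delta>[OF this] have 1: "inner (g y) (y - c) / 2 - \<eta> * (norm (y - c))\<^sup>2 \<le> \<phi> y - \<phi> c" by simp
    have "(norm (y - c))\<^sup>2 / \<kappa> \<le> inner (g y) (y - c)"
      using strongly_convex_monotone[OF sc, of y c] elim r0 by (simp add: crit)
    hence "(1 / 2 - \<sigma>) * ((norm (y - c))\<^sup>2 / \<kappa>) \<le> (1 / 2 - \<sigma>) * inner (g y) (y - c)"
      using \<sigma> by (intro mult_left_mono) auto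
    moreover have "(1 / 2 - \<sigma>) * ((norm (y - c))\<^sup>2 / \<kappa>) = 2 * (\<eta> * (norm (y - c))\<^sup>2)"
      using k0 by (simp add: \<eta>_def field_simps)
    moreover have "(1 / 2 - \<sigma>) * inner (g y) (y - c) = inner (g y) (y - c) / 2 - \<sigma> * inner (g y) (y - c)"
      by (simp add: left_diff_distrib)
    ultimately show ?case using 1 by linarith
  qed
  thus ?thesis using e0 by blast
qed

end


section \<open>Symmetric matrices\<close>

text \<open>At \<open>u - t *\<^sub>R f u\<close> the form has first-order term
  \<open>- 2 * t * |f u|^2\<close>, which would make it negative for small \<open>t\<close>.\<close>

lemma psd_form_zero_imp_kernel:
  fixes f :: "'a::real_inner \<Rightarrow> 'a"
  assumes lin: "linear f" and sym: "\<And>x y. inner (f x) y = inner x (f y)"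
    and psd: "\<And>x. 0 \<le> inner x (f x)" and u: "inner u (f u) = 0"
  shows "f u = 0"
proof (rule ccontr)
  assume ne: "f u \<noteq> 0"
  define w where "w = f u"
  define q where "q = inner w (f w)"
  define n where "n = inner w w"
  have n0: "n > 0" using ne by (simp add: n_def w_def)
  have q0: "q \<ge> 0" unfolding q_def by (rule psd)
  \<comment> \<open>Small enough that \<open>t * q \<le> n\<close>, and the denominator is positive
    even for \<open>q = 0\<close>.\<close>
  define t where "t = n / (q + 1)"
  have t0: "t > 0" using n0 q0 by (simp add: t_def)
  have sw: "inner u (f w) = n" using sym[of u w] by (simp add: n_def w_def)
  have uw: "inner u w = 0" using u by (simp add: w_def)
  have "0 \<le> inner (u - t *\<^sub>R w) (f (u - t *\<^sub>R w))" by (rule psd)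
  also have "f (u - t *\<^sub>R w) = w - t *\<^sub>R f w"
    by (simp only: linear_diff[OF lin] linear_scale[OF lin] w_def)
  also have "inner (u - t *\<^sub>R w) (w - t *\<^sub>R f w) = inner u w - t * inner u (f w) - t * inner w w + t * t * inner w (f w)"
    by (simp add: inner_diff_left inner_diff_right algebra_simps)
  also have "\<dots> = t * (t * q - 2 * n)"
    unfolding sw uw n_def[symmetric] q_def[symmetric] by algebra
  finally have "0 \<le> t * q - 2 * n" using t0 zero_le_mult_iff by (metis less_le_not_le)
  moreover have "t * q \<le> t * (q + 1)" using t0 by simp
  moreover have "t * (q + 1) = n" using q0 by (simp add: t_def)
  ultimately show False using n0 by linarith
qed

context
  fixes A :: "real^'n^'n" and a b :: real
  assumes sym: "transpose A = A" and eig: "\<And>e. eigenvalue A e \<Longrightarrow> e \<in> {a..b}"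
begin

lemma symmetric_matrix_inner: "inner (A *v x) y = inner x (A *v y)"
proof -
  have "inner (A *v x) y = inner (transpose A *v x) y" by (simp only: sym)
  thus ?thesis by (simp only: transpose_matrix_vector dot_lmul_matrix)
qed

lemma quadratic_form_normalize:
  fixes u :: "real^'n" 
  assumes "u \<noteq> 0"
  obtains v where "v \<in> sphere 0 1" "u = norm u *\<^sub>R v" "inner u (A *v u) = (norm u)\<^sup>2 * inner v (A *v v)"
proof
  show "u /\<^sub>R norm u \<in> sphere 0 1" using assms by simp
  show eq: "u = norm u *\<^sub>R (u /\<^sub>R norm u)" using assms by simp
  show "inner u (A *v u) = (norm u)\<^sup>2 * inner (u /\<^sub>R norm u) (A *v (u /\<^sub>R norm u))"
    using assms by (simp add: matrix_vector_mult_scaleR power2_eq_square field_simps)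
qed

lemma continuous_on_quadratic_form: "continuous_on S (\<lambda>u. inner u (A *v u))"
  by (intro continuous_intros linear_continuous_on matrix_vector_mul_bounded_linear)

text \<open>The minimum \<open>m\<close> of the form on the sphere is an eigenvalue: the form of
  \<open>A - m I\<close> is nonnegative and vanishes at the minimizer, which therefore lies in the
  kernel.\<close>

lemma symmetric_matrix_form_ge: "a * (norm u)\<^sup>2 \<le> inner u (A *v u)"
proof -
  obtain v where v: "v \<in> sphere 0 1" "\<And>w. w \<in> sphere 0 1 \<Longrightarrow> inner v (A *v v) \<le> inner w (A *v w)"
    using continuous_attains_inf[OF compact_sphere _ continuous_on_quadratic_form, of 0 1]
    by (auto simp del: mem_sphere)
  define m where "m = inner v (A *v v)"
  have vv: "inner v v = 1" using v(1) by (simp add: power2_norm_eq_inner[symmetric])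
  have form: "m * (norm x)\<^sup>2 \<le> inner x (A *v x)" for x
  proof (cases "x = 0")
    case False
    then obtain w where w: "w \<in> sphere 0 1" "inner x (A *v x) = (norm x)\<^sup>2 * inner w (A *v w)"
      by (rule quadratic_form_normalize)
    show ?thesis using mult_left_mono[OF v(2)[OF w(1)], of "(norm x)\<^sup>2"] w(2) by (simp add: m_def mult.commute)
  qed simp
  have "A *v v - m *\<^sub>R v = 0"
  proof (rule psd_form_zero_imp_kernel[of "\<lambda>x. A *v x - m *\<^sub>R x"])
    show "linear (\<lambda>x. A *v x - m *\<^sub>R x)"
      by (rule linearI) (simp_all add: matrix_vector_right_distrib matrix_vector_mult_scaleR algebra_simps)
    show "inner (A *v x - m *\<^sub>R x) y = inner x (A *v y - m *\<^sub>R y)" for x y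
      by (simp add: inner_diff_left inner_diff_right symmetric_matrix_inner)
    show "0 \<le> inner x (A *v x - m *\<^sub>R x)" for x
      using form[of x] by (simp add: inner_diff_right power2_norm_eq_inner)
    show "inner v (A *v v - m *\<^sub>R v) = 0"
      by (simp add: inner_diff_right vv m_def[symmetric])
  qed
  moreover have "v \<noteq> 0" using v(1) by auto
  ultimately have "eigenvalue A m" unfolding eigenvalue_def by auto
  hence "a \<le> m" using eig by auto
  hence "a * (norm u)\<^sup>2 \<le> m * (norm u)\<^sup>2" by (simp add: mult_right_mono)
  thus ?thesis using form[of u] by linarith
qed

lemma symmetric_matrix_form_le: "inner u (A *v u) \<le> b * (norm u)\<^sup>2"
proof -
  obtain v where v: "v \<in> sphere 0 1" "\<And>w. w \<in> sphere 0 1 \<Longrightarrow> inner w (A *v w) \<le> inner v (A *v v)"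
    using continuous_attains_sup[OF compact_sphere _ continuous_on_quadratic_form, of 0 1]
    by (auto simp del: mem_sphere)
  define m where "m = inner v (A *v v)"
  have vv: "inner v v = 1" using v(1) by (simp add: power2_norm_eq_inner[symmetric])
  have form: "inner x (A *v x) \<le> m * (norm x)\<^sup>2" for x
  proof (cases "x = 0")
    case False
    then obtain w where w: "w \<in> sphere 0 1" "inner x (A *v x) = (norm x)\<^sup>2 * inner w (A *v w)"
      by (rule quadratic_form_normalize)
    show ?thesis using mult_left_mono[OF v(2)[OF w(1)], of "(norm x)\<^sup>2"] w(2) by (simp add: m_def mult.commute)
  qed simp
  have "m *\<^sub>R v - A *v v = 0"
  proof (rule psd_form_zero_imp_kernel[of "\<lambda>x. m *\<^sub>R x - A *v x"])
    show "linear (\<lambda>x. m *\<^sub>R x - A *v x)"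
      by (rule linearI) (simp_all add: matrix_vector_right_distrib matrix_vector_mult_scaleR algebra_simps)
    show "inner (m *\<^sub>R x - A *v x) y = inner x (m *\<^sub>R y - A *v y)" for x y
      by (simp add: inner_diff_left inner_diff_right symmetric_matrix_inner)
    show "0 \<le> inner x (m *\<^sub>R x - A *v x)" for x
      using form[of x] by (simp add: inner_diff_right power2_norm_eq_inner)
    show "inner v (m *\<^sub>R v - A *v v) = 0"
      by (simp add: inner_diff_right vv m_def[symmetric])
  qed
  moreover have "v \<noteq> 0" using v(1) by auto
  ultimately have "eigenvalue A m" unfolding eigenvalue_def by auto
  hence "m \<le> b" using eig by auto
  hence "m * (norm u)\<^sup>2 \<le> b * (norm u)\<^sup>2" by (simp add: mult_right_mono)
  thus ?thesis using form[of u] by linarith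
qed

text \<open>The form at \<open>x = b *\<^sub>R u - A *v u\<close> is nonnegative; expanding it and
  bounding the forms at \<open>u\<close> and \<open>A *v u\<close> above by \<open>b\<close> leaves
  the squared inequality.\<close>

lemma symmetric_matrix_norm_le:
  assumes "0 \<le> a" "0 < b"
  shows "norm (A *v u) \<le> b * norm u"
proof -
  define w where "w = A *v u"
  define x where "x = b *\<^sub>R u - w"
  have "0 \<le> a * (norm x)\<^sup>2" using assms by simp
  also have "\<dots> \<le> inner x (A *v x)" by (rule symmetric_matrix_form_ge)
  finally have nonneg: "0 \<le> inner x (A *v x)" .
  have "A *v x = b *\<^sub>R w - A *v w"
    by (simp add: x_def w_def matrix_vector_mult_diff_distrib matrix_vector_mult_scaleR)
  hence "inner x (A *v x) = inner x (b *\<^sub>R w - A *v w)" by (simp only:)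
  also have "inner x (b *\<^sub>R w - A *v w) = b * b * inner u w - b * inner u (A *v w) - b * inner w w + inner w (A *v w)"
    by (simp add: x_def inner_diff_left inner_diff_right algebra_simps)
  also have "inner u (A *v w) = inner w w" unfolding symmetric_matrix_inner[symmetric] by (simp only: w_def)
  finally have "inner x (A *v x) = b * b * inner u w - b * inner w w - b * inner w w + inner w (A *v w)" .
  with nonneg have "0 \<le> b * b * inner u w - b * (norm w)\<^sup>2 - b * (norm w)\<^sup>2 + inner w (A *v w)"
    by (simp add: power2_norm_eq_inner)
  moreover have "b * b * inner u w \<le> b * b * (b * (norm u)\<^sup>2)"
    unfolding w_def using assms by (intro mult_left_mono symmetric_matrix_form_le) auto
  moreover have "inner w (A *v w) \<le> b * (norm w)\<^sup>2" by (rule symmetric_matrix_form_le)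
  ultimately have "0 \<le> b * b * (b * (norm u)\<^sup>2) - b * (norm w)\<^sup>2" by linarith
  also have "\<dots> = b * ((b * norm u)\<^sup>2 - (norm w)\<^sup>2)"
    by (simp add: power_mult_distrib power2_eq_square algebra_simps)
  finally have "0 \<le> b * ((b * norm u)\<^sup>2 - (norm w)\<^sup>2)" .
  hence "0 \<le> (b * norm u)\<^sup>2 - (norm w)\<^sup>2" using assms(2) by (simp only: zero_le_mult_iff) auto
  hence "(norm w)\<^sup>2 \<le> (b * norm u)\<^sup>2" by simp
  moreover have "0 \<le> b * norm u" using assms by simp
  ultimately show ?thesis unfolding w_def by (rule power2_le_imp_le)
qed

end

section \<open>Convergence rates of the algorithm\<close>

lemma Q_linear_imp_R_bound:
  assumes "Q_linear y ybar"
  shows "\<exists>\<mu> C. 0 < \<mu> \<and> \<mu> < 1 \<and> 0 < C \<and> (\<forall>\<^sub>F k in sequentially. norm (y k - ybar) \<le> C * \<mu> ^ k)"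
proof -
  obtain \<mu> N where mu: "0 < \<mu>" "\<mu> < 1" and N: "\<And>k. k \<ge> N \<Longrightarrow> norm (y (Suc k) - ybar) \<le> \<mu> * norm (y k - ybar)"
    using assms unfolding Q_linear_def eventually_sequentially by blast
  define C where "C = norm (y N - ybar) / \<mu> ^ N + 1"
  have le: "norm (y k - ybar) \<le> norm (y N - ybar) / \<mu> ^ N * \<mu> ^ k" if "k \<ge> N" for k
    using that
  proof (induction k rule: dec_induct)
    case base
    show ?case using mu by simp
  next
    case (step k)
    have "norm (y (Suc k) - ybar) \<le> \<mu> * norm (y k - ybar)" using N step by blast
    also have "\<dots> \<le> \<mu> * (norm (y N - ybar) / \<mu> ^ N * \<mu> ^ k)" using step mu by (intro mult_left_mono) auto
    finally show ?case by (simp add: mult_ac)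
  qed
  have "norm (y k - ybar) \<le> C * \<mu> ^ k" if "k \<ge> N" for k
  proof -
    have "norm (y N - ybar) / \<mu> ^ N * \<mu> ^ k \<le> C * \<mu> ^ k"
      using mu by (intro mult_right_mono) (auto simp: C_def)
    thus ?thesis using le[OF that] by linarith
  qed
  moreover have "C > 0" using mu by (simp add: C_def add_nonneg_pos)
  ultimately show ?thesis using mu unfolding eventually_sequentially by blast
qed

text \<open>Value gaps dominate squared distances, so distances inherit the rate
  \<open>sqrt \<mu>\<close>.\<close>

lemma R_linear_if_square_dominated:
  fixes y :: "nat \<Rightarrow> 'a::real_normed_vector"
  assumes lim: "y \<longlonglongrightarrow> ybar" and ne: "\<And>k. y k \<noteq> ybar"
    and mu: "0 < \<mu>" "\<mu> < 1" and C: "0 < C"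
    and ev: "\<forall>\<^sub>F k in sequentially. (norm (y k - ybar))\<^sup>2 \<le> C * \<mu> ^ k"
  shows "R_linear y ybar"
proof -
  have "\<forall>\<^sub>F k in sequentially. norm (y k - ybar) \<le> sqrt C * sqrt \<mu> ^ k"
    using ev
  proof eventually_elim
    case (elim k)
    hence "sqrt ((norm (y k - ybar))\<^sup>2) \<le> sqrt (C * \<mu> ^ k)" by (rule real_sqrt_le_mono)
    thus ?case by (simp add: real_sqrt_mult real_sqrt_power)
  qed
  moreover have "0 < sqrt \<mu>" "sqrt \<mu> < 1" "0 < sqrt C" using mu C by auto
  ultimately show ?thesis unfolding R_linear_def using lim ne by blast
qed

lemma Q_superlinearI:
  assumes "y \<longlonglongrightarrow> ybar" and ne: "\<And>k. y k \<noteq> ybar"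
    and ev: "\<And>\<epsilon>. \<epsilon> > 0 \<Longrightarrow> \<forall>\<^sub>F k in sequentially. norm (y (Suc k) - ybar) \<le> \<epsilon> * norm (y k - ybar)"
  shows "Q_superlinear y ybar"
  unfolding Q_superlinear_def
proof (intro conjI allI assms(1) ne tendstoI)
  fix e :: real assume "e > 0"
  hence "e / 2 > 0" by simp
  from ev[OF this]
  show "\<forall>\<^sub>F k in sequentially. dist (norm (y (Suc k) - ybar) / norm (y k - ybar)) 0 < e"
  proof eventually_elim
    case (elim k)
    have "norm (y k - ybar) > 0" using ne by simp
    hence "norm (y (Suc k) - ybar) / norm (y k - ybar) \<le> e / 2" using elim by (simp add: pos_divide_le_eq)
    also have "\<dots> < e" using \<open>e > 0\<close> by simp
    finally show ?case by (simp add: dist_real_def)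
  qed
qed

text \<open>The vector \<open>b k\<close> stands for the product of the matrix \<open>B k\<close> with \<open>d k\<close>.\<close>

locale newton_run = C11_function \<phi> for \<phi> :: "'a::euclidean_space \<Rightarrow> real" +
  fixes x d z b :: "nat \<Rightarrow> 'a" and \<tau> \<mu> :: "nat \<Rightarrow> real" and c \<sigma>1 \<sigma>2 \<rho> \<tau>max m M :: real
  assumes bdd: "bdd_below (range \<phi>)"
    and psd: "\<And>y. \<phi> y \<le> \<phi> (x 0) \<Longrightarrow> positive_semidefinite_mapping (generalized_hessian \<phi> y)"
    and c_pos: "0 < c" and \<sigma>1_pos: "0 < \<sigma>1" and \<sigma>_less: "\<sigma>1 < \<sigma>2" and \<sigma>2_less: "\<sigma>2 < 1"
    and \<rho>_pos: "0 < \<rho>" and m_pos: "0 < m" and M_pos: "0 < M"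
    and noncritical: "\<And>k. g (x k) \<noteq> 0"
    and hess: "\<And>k. z k \<in> generalized_hessian \<phi> (x k) (d k)"
    and newton: "\<And>k. - g (x k) = z k + \<mu> k *\<^sub>R b k"
    and \<mu>_eq: "\<And>k. \<mu> k = c * norm (g (x k)) powr \<rho>"
    and b_ge: "\<And>k. m * (norm (d k))\<^sup>2 \<le> inner (b k) (d k)"
    and b_le: "\<And>k. norm (b k) \<le> M * norm (d k)"
    and step: "\<And>k. if wolfe \<phi> \<sigma>1 \<sigma>2 (x k) (d k) 1 then \<tau> k = 1
                    else \<tau> k > 0 \<and> wolfe \<phi> \<sigma>1 \<sigma>2 (x k) (d k) (\<tau> k)"
    and \<tau>_le: "\<And>k. \<tau> k \<le> \<tau>max"
    and x_Suc: "\<And>k. x (Suc k) = x k + \<tau> k *\<^sub>R d k"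
begin

abbreviation "slope k \<equiv> inner (g (x k)) (d k)"

lemma \<tau>_pos: "\<tau> k > 0"
  using step[of k] by (auto split: if_splits)

lemma armijo: "\<phi> (x (Suc k)) \<le> \<phi> (x k) + \<sigma>1 * \<tau> k * slope k"
  and curvature: "\<sigma>2 * slope k \<le> inner (g (x (Suc k))) (d k)"
proof -
  have "wolfe \<phi> \<sigma>1 \<sigma>2 (x k) (d k) (\<tau> k)" using step[of k] by (auto split: if_splits)
  thus "\<phi> (x (Suc k)) \<le> \<phi> (x k) + \<sigma>1 * \<tau> k * slope k" "\<sigma>2 * slope k \<le> inner (g (x (Suc k))) (d k)"
    unfolding wolfe_def x_Suc by auto
qed

lemma \<mu>_pos: "\<mu> k > 0"
  unfolding \<mu>_eq using c_pos noncritical by simp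

lemma slope_eq: "slope k = - inner (z k) (d k) - \<mu> k * inner (b k) (d k)"
proof -
  have "- slope k = inner (z k + \<mu> k *\<^sub>R b k) (d k)" by (simp flip: newton)
  thus ?thesis by (simp add: inner_add_left)
qed

lemma slope_le_if:
  assumes "a \<le> inner (z k) (d k)"
  shows "slope k \<le> - a - \<mu> k * m * (norm (d k))\<^sup>2"
proof -
  have "\<mu> k * (m * (norm (d k))\<^sup>2) \<le> \<mu> k * inner (b k) (d k)"
    using b_ge \<mu>_pos by (intro mult_left_mono) (auto intro: less_imp_le)
  thus ?thesis using assms unfolding slope_eq by (simp add: mult.assoc)
qed

lemma gradient_norm_le:
  assumes "norm (z k) \<le> l * norm (d k)"
  shows "norm (g (x k)) \<le> (l + \<mu> k * M) * norm (d k)"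
proof -
  have "norm (g (x k)) = norm (z k + \<mu> k *\<^sub>R b k)" by (simp flip: newton)
  also have "\<dots> \<le> norm (z k) + norm (\<mu> k *\<^sub>R b k)" by (rule norm_triangle_ineq)
  also have "norm (\<mu> k *\<^sub>R b k) = \<mu> k * norm (b k)" using \<mu>_pos[of k] by simp
  also have "norm (z k) + \<mu> k * norm (b k) \<le> l * norm (d k) + \<mu> k * (M * norm (d k))"
    using assms b_le[of k] \<mu>_pos[of k] by (intro add_mono mult_left_mono) auto
  finally show ?thesis by (simp add: algebra_simps)
qed

text \<open>A zero direction would annihilate \<open>z k\<close> and \<open>b k\<close>, and by the
  Newton equation the gradient.\<close>

lemma d_nonzero: "d k \<noteq> 0"
proof
  assume d: "d k = 0"
  obtain l r where "0 < r" "l-lipschitz_on (ball (x k) r) g" by (rule lipschitz_near)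
  hence "norm (z k) \<le> l * norm (d k)"
    by (intro generalized_hessian_norm_le[OF hess open_ball]) auto
  from gradient_norm_le[OF this] show False using noncritical[of k] d by simp
qed

text \<open>Semidefiniteness is available on the initial level set only, so an induction proves that
  the iterates remain there, each step using the descent just obtained.\<close>

lemma descent_direction: "slope k \<le> - (\<mu> k * m * (norm (d k))\<^sup>2)"
proof -
  have slope: "slope k \<le> - (\<mu> k * m * (norm (d k))\<^sup>2)" if "\<phi> (x k) \<le> \<phi> (x 0)" for k
  proof -
    have "0 \<le> inner (z k) (d k)"
      using psd[OF that] hess[of k] unfolding positive_semidefinite_mapping_def by blast
    from slope_le_if[OF this] show ?thesis by simp
  qed
  have "\<phi> (x k) \<le> \<phi> (x 0)" for k
  proof (induction k)
    case (Suc k)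
    have "0 \<le> \<mu> k * m * (norm (d k))\<^sup>2" using \<mu>_pos[of k] m_pos by simp
    hence "slope k \<le> 0" using slope[OF Suc] by linarith
    hence "\<sigma>1 * \<tau> k * slope k \<le> 0" using \<sigma>1_pos \<tau>_pos[of k] by (simp add: mult_nonneg_nonpos)
    thus ?case using armijo[of k] Suc by linarith
  qed simp
  thus ?thesis by (rule slope)
qed

lemma slope_neg: "slope k < 0"
proof -
  have "0 < \<mu> k * m * (norm (d k))\<^sup>2" using \<mu>_pos[of k] m_pos d_nonzero[of k] by simp
  thus ?thesis using descent_direction[of k] by linarith
qed

lemma value_decreasing: "\<phi> (x (Suc k)) < \<phi> (x k)"
proof -
  have "\<sigma>1 * \<tau> k * slope k < 0" using \<sigma>1_pos \<tau>_pos[of k] slope_neg[of k] by (simp add: mult_pos_neg)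
  thus ?thesis using armijo[of k] by linarith
qed

lemma decseq_value: "decseq (\<lambda>k. \<phi> (x k))"
  by (rule decseq_SucI) (rule less_imp_le[OF value_decreasing])

lemma value_tendsto:
  assumes "accumulation_point x xbar"
  shows "(\<lambda>k. \<phi> (x k)) \<longlonglongrightarrow> \<phi> xbar"
proof -
  obtain B where "\<And>y. B \<le> \<phi> y" using bdd by (auto simp: bdd_below_def)
  then obtain L where L: "(\<lambda>k. \<phi> (x k)) \<longlonglongrightarrow> L" using decseq_convergent[OF decseq_value] by blast
  obtain f where f: "strict_mono f" "(x \<circ> f) \<longlonglongrightarrow> xbar" using assms unfolding accumulation_point_def by blast
  have "(\<lambda>j. \<phi> ((x \<circ> f) j)) \<longlonglongrightarrow> \<phi> xbar" by (rule isCont_tendsto_compose[OF isCont_function f(2)])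
  moreover have "(\<lambda>j. \<phi> ((x \<circ> f) j)) \<longlonglongrightarrow> L" using LIMSEQ_subseq_LIMSEQ[OF L f(1)] by (simp add: o_def)
  ultimately show ?thesis using L LIMSEQ_unique by blast
qed

text \<open>Strictness puts a whole neighbourhood of \<open>xbar\<close> into the initial level set
  and gives the nonzero gaps that the rates require.\<close>

lemma value_gt_limit:
  assumes "accumulation_point x xbar"
  shows "\<phi> xbar < \<phi> (x k)"
proof -
  have "\<phi> xbar \<le> \<phi> (x (Suc k))" using decseq_ge[OF decseq_value value_tendsto[OF assms]] .
  thus ?thesis using value_decreasing[of k] by linarith
qed

text \<open>Together with a bound of \<open>- slope k\<close> below by a multiple of
  \<open>|d k|^2\<close>, this keeps the stepsize away from 0.\<close>

lemma curvature_bound: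
  assumes lip: "l-lipschitz_on S g" and S: "x k \<in> S" "x (Suc k) \<in> S"
  shows "(1 - \<sigma>2) * - slope k \<le> l * (\<tau> k * (norm (d k))\<^sup>2)"
proof -
  have "(1 - \<sigma>2) * - slope k \<le> inner (g (x (Suc k)) - g (x k)) (d k)"
    using curvature[of k] by (simp add: inner_diff_left algebra_simps)
  also have "\<dots> \<le> norm (g (x (Suc k)) - g (x k)) * norm (d k)" by (rule norm_cauchy_schwarz)
  also have "\<dots> \<le> (l * (\<tau> k * norm (d k))) * norm (d k)"
    using lipschitz_onD[OF lip S(2,1)] \<tau>_pos[of k] by (intro mult_right_mono) (auto simp: dist_norm x_Suc)
  finally show ?thesis by (simp add: power2_eq_square mult_ac)
qed

text \<open>If the gradient did not vanish, \<open>\<mu>\<close> would stay between positive bounds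
  along the subsequence. Vanishing value differences and Armijo then give
  \<open>\<tau> |d|^2 \<rightarrow> 0\<close>, the curvature condition upgrades this to
  \<open>d \<rightarrow> 0\<close>, and the Newton equation makes the gradients vanish.\<close>

lemma accumulation_point_critical:
  assumes acc: "accumulation_point x xbar"
  shows "g xbar = 0"
proof (rule ccontr)
  assume ne: "g xbar \<noteq> 0"
  obtain f where f: "strict_mono f" and xf: "(x \<circ> f) \<longlonglongrightarrow> xbar" using acc unfolding accumulation_point_def by blast
  obtain l r where l0: "0 < l" and r0: "0 < r" and lip: "l-lipschitz_on (ball xbar r) g" by (rule lipschitz_near)
  define \<gamma> where "\<gamma> = norm (g xbar)"
  have g0: "\<gamma> > 0" using ne by (simp add: \<gamma>_def)
  define \<mu>0 where "\<mu>0 = c * (\<gamma> / 2) powr \<rho>"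
  define \<mu>1 where "\<mu>1 = c * (2 * \<gamma>) powr \<rho>"
  have \<mu>0: "\<mu>0 > 0" and \<mu>1: "\<mu>1 > 0" using c_pos g0 by (auto simp: \<mu>0_def \<mu>1_def)
  have lim_g: "(\<lambda>j. norm (g (x (f j)))) \<longlonglongrightarrow> \<gamma>"
    unfolding \<gamma>_def using isCont_tendsto_compose[OF isCont_gradient xf] by (intro tendsto_norm) (simp add: o_def)
  have ev_lo: "\<forall>\<^sub>F j in sequentially. \<gamma> / 2 < norm (g (x (f j)))"
    using lim_g g0 by (intro order_tendstoD(1)[of _ \<gamma>]) auto
  have ev_hi: "\<forall>\<^sub>F j in sequentially. norm (g (x (f j))) < 2 * \<gamma>"
    using lim_g g0 by (intro order_tendstoD(2)[of _ \<gamma>]) auto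
  have \<mu>_lo: "\<forall>\<^sub>F j in sequentially. \<mu>0 \<le> \<mu> (f j)"
    using ev_lo
  proof eventually_elim
    case (elim j)
    thus ?case unfolding \<mu>_eq \<mu>0_def using c_pos \<rho>_pos g0 by (intro mult_left_mono powr_mono2) auto
  qed
  have \<mu>_hi: "\<forall>\<^sub>F j in sequentially. \<mu> (f j) \<le> \<mu>1"
    using ev_hi
  proof eventually_elim
    case (elim j)
    thus ?case unfolding \<mu>_eq \<mu>1_def using c_pos \<rho>_pos by (intro mult_left_mono powr_mono2) auto
  qed
  have lim_val: "(\<lambda>k. \<phi> (x k) - \<phi> (x (Suc k))) \<longlonglongrightarrow> 0"
    using tendsto_diff[OF value_tendsto[OF acc] LIMSEQ_Suc[OF value_tendsto[OF acc]]] by simp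
  define E where "E j = \<tau> (f j) * (norm (d (f j)))\<^sup>2" for j
  have E0: "0 \<le> E j" for j using \<tau>_pos[of "f j"] by (simp add: E_def)
  have lim_E: "E \<longlonglongrightarrow> 0"
  proof (rule tendsto_sandwich[OF _ _ tendsto_const])
    show "\<forall>\<^sub>F j in sequentially. 0 \<le> E j" using E0 by simp
    show "\<forall>\<^sub>F j in sequentially. E j \<le> (\<phi> (x (f j)) - \<phi> (x (Suc (f j)))) / (\<sigma>1 * \<mu>0 * m)"
      using \<mu>_lo
    proof eventually_elim
      case (elim j)
      have "\<mu>0 * m * (norm (d (f j)))\<^sup>2 \<le> \<mu> (f j) * m * (norm (d (f j)))\<^sup>2"
        using elim m_pos by (intro mult_right_mono) auto
      hence "\<mu>0 * m * (norm (d (f j)))\<^sup>2 \<le> - slope (f j)" using descent_direction[of "f j"] by linarith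
      hence "\<sigma>1 * \<tau> (f j) * (\<mu>0 * m * (norm (d (f j)))\<^sup>2) \<le> \<sigma>1 * \<tau> (f j) * - slope (f j)"
        using \<sigma>1_pos \<tau>_pos[of "f j"] by (intro mult_left_mono) auto
      also have "\<dots> \<le> \<phi> (x (f j)) - \<phi> (x (Suc (f j)))" using armijo[of "f j"] by simp
      finally have "E j * (\<sigma>1 * \<mu>0 * m) \<le> \<phi> (x (f j)) - \<phi> (x (Suc (f j)))" by (simp add: E_def mult_ac)
      thus ?case using \<sigma>1_pos \<mu>0 m_pos by (simp add: pos_le_divide_eq)
    qed
    have "(\<lambda>j. (\<phi> (x (f j)) - \<phi> (x (Suc (f j)))) / (\<sigma>1 * \<mu>0 * m)) \<longlonglongrightarrow> 0 / (\<sigma>1 * \<mu>0 * m)"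
      using LIMSEQ_subseq_LIMSEQ[OF lim_val f] \<sigma>1_pos \<mu>0 m_pos by (intro tendsto_divide tendsto_const) (auto simp: o_def)
    thus "(\<lambda>j. (\<phi> (x (f j)) - \<phi> (x (Suc (f j)))) / (\<sigma>1 * \<mu>0 * m)) \<longlonglongrightarrow> 0" by simp
  qed
  \<comment> \<open>The cap \<open>\<tau>max\<close> makes successors converge too, so both points
    lie where \<open>g\<close> is Lipschitz with constant \<open>l\<close>.\<close>
  have "(\<lambda>j. \<tau> (f j) *\<^sub>R d (f j)) \<longlonglongrightarrow> 0"
  proof (rule Lim_null_comparison)
    show "\<forall>\<^sub>F j in sequentially. norm (\<tau> (f j) *\<^sub>R d (f j)) \<le> sqrt (\<tau>max * E j)"
    proof (intro always_eventually allI)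
      fix j
      have "(norm (\<tau> (f j) *\<^sub>R d (f j)))\<^sup>2 = \<tau> (f j) * E j"
        by (simp add: E_def power_mult_distrib power2_eq_square)
      also have "\<dots> \<le> \<tau>max * E j" using \<tau>_le E0 by (rule mult_right_mono)
      finally show "norm (\<tau> (f j) *\<^sub>R d (f j)) \<le> sqrt (\<tau>max * E j)" by (rule real_le_rsqrt)
    qed
    have "(\<lambda>j. sqrt (\<tau>max * E j)) \<longlonglongrightarrow> sqrt (\<tau>max * 0)" by (intro tendsto_intros lim_E)
    thus "(\<lambda>j. sqrt (\<tau>max * E j)) \<longlonglongrightarrow> 0" by simp
  qed
  from tendsto_add[OF xf this] have xSf: "(\<lambda>j. x (Suc (f j))) \<longlonglongrightarrow> xbar" by (simp add: o_def x_Suc)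
  have in1: "\<forall>\<^sub>F j in sequentially. x (f j) \<in> ball xbar r"
    using topological_tendstoD[OF xf open_ball, of xbar r] r0 by (simp add: o_def)
  have in2: "\<forall>\<^sub>F j in sequentially. x (Suc (f j)) \<in> ball xbar r"
    using topological_tendstoD[OF xSf open_ball, of xbar r] r0 by simp
  \<comment> \<open>The stepsize floor that \<open>curvature_bound\<close> gives with
    \<open>- slope \<ge> \<mu>0 * m * |d|^2\<close>.\<close>
  define \<tau>0 where "\<tau>0 = (1 - \<sigma>2) * \<mu>0 * m / l"
  have \<tau>0: "\<tau>0 > 0" using \<sigma>2_less \<mu>0 m_pos l0 by (simp add: \<tau>0_def)
  have "\<forall>\<^sub>F j in sequentially. (norm (d (f j)))\<^sup>2 \<le> E j / \<tau>0"
    using in1 in2 \<mu>_lo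
  proof eventually_elim
    case (elim j)
    have "\<mu>0 * m * (norm (d (f j)))\<^sup>2 \<le> \<mu> (f j) * m * (norm (d (f j)))\<^sup>2"
      using elim m_pos by (intro mult_right_mono) auto
    hence "\<mu>0 * m * (norm (d (f j)))\<^sup>2 \<le> - slope (f j)" using descent_direction[of "f j"] by linarith
    hence "(1 - \<sigma>2) * (\<mu>0 * m * (norm (d (f j)))\<^sup>2) \<le> (1 - \<sigma>2) * - slope (f j)"
      using \<sigma>2_less by (intro mult_left_mono) auto
    also have "\<dots> \<le> l * E j" unfolding E_def by (rule curvature_bound[OF lip elim(1,2)])
    finally have "(norm (d (f j)))\<^sup>2 * \<tau>0 \<le> E j" using l0 by (simp add: \<tau>0_def field_simps)
    thus ?case using \<tau>0 by (simp add: pos_le_divide_eq)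
  qed
  hence ev_d: "\<forall>\<^sub>F j in sequentially. norm (d (f j)) \<le> sqrt (E j / \<tau>0)"
    by eventually_elim (rule real_le_rsqrt)
  have "(\<lambda>j. (l + \<mu>1 * M) * sqrt (E j / \<tau>0)) \<longlonglongrightarrow> (l + \<mu>1 * M) * sqrt (0 / \<tau>0)"
    using \<tau>0 by (intro tendsto_intros lim_E) auto
  moreover have "\<forall>\<^sub>F j in sequentially. norm (g (x (f j))) \<le> (l + \<mu>1 * M) * sqrt (E j / \<tau>0)"
    using in1 \<mu>_hi ev_d
  proof eventually_elim
    case (elim j)
    have "norm (z (f j)) \<le> l * norm (d (f j))"
      by (rule generalized_hessian_norm_le[OF hess open_ball elim(1) lip])
    from gradient_norm_le[OF this]
    have "norm (g (x (f j))) \<le> (l + \<mu> (f j) * M) * norm (d (f j))" .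
    also have "\<dots> \<le> (l + \<mu>1 * M) * sqrt (E j / \<tau>0)"
      using elim l0 \<mu>1 M_pos by (intro mult_mono add_mono order_refl) auto
    finally show ?case .
  qed
  ultimately have "\<gamma> \<le> (l + \<mu>1 * M) * sqrt (0 / \<tau>0)"
    using lim_g by (intro tendsto_le[of sequentially]) auto
  thus False using g0 by simp
qed

end

section \<open>Rates once one ball carries strong convexity and a Lipschitz bound\<close>

locale newton_run_near_minimizer = newton_run +
  fixes xbar :: 'a and \<kappa> r l :: real
  assumes acc: "accumulation_point x xbar" and sc: "strongly_convex_near \<kappa> xbar r"
    and \<kappa>_pos: "0 < \<kappa>" and r_pos: "0 < r" and lip: "l-lipschitz_on (ball xbar r) g" and l_pos: "0 < l"
begin

lemma critical: "g xbar = 0"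
  by (rule accumulation_point_critical[OF acc])

lemma xbar_in: "xbar \<in> ball xbar r"
  using r_pos by simp

lemma growth:
  assumes "y \<in> ball xbar r"
  shows "(norm (y - xbar))\<^sup>2 / (2 * \<kappa>) \<le> \<phi> y - \<phi> xbar"
proof -
  have "\<phi> xbar + inner (g xbar) (y - xbar) + (norm (y - xbar))\<^sup>2 / (2 * \<kappa>) \<le> \<phi> y"
    using sc assms xbar_in unfolding strongly_convex_near_def by blast
  thus ?thesis by (simp add: critical)
qed

lemma value_upper:
  assumes "y \<in> ball xbar r"
  shows "\<phi> y - \<phi> xbar \<le> l / 2 * (norm (y - xbar))\<^sup>2"
  using Lipschitz_gradient_upper_bound[OF convex_ball GDERIV_gradient lip xbar_in assms] by (simp add: critical)

lemma gradient_upper: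
  assumes "y \<in> ball xbar r"
  shows "norm (g y) \<le> l * norm (y - xbar)"
  using lipschitz_onD[OF lip assms xbar_in] by (simp add: critical dist_norm)

lemma gradient_lower:
  assumes "y \<in> ball xbar r"
  shows "norm (y - xbar) \<le> \<kappa> * norm (g y)"
  using strongly_convex_norm_le[OF sc assms xbar_in \<kappa>_pos] by (simp add: critical)

text \<open>Unlike \<open>descent_direction\<close>, this bound does not degenerate as
  \<open>\<mu> k\<close> tends to 0.\<close>

lemma slope_upper:
  assumes "x k \<in> ball xbar r"
  shows "slope k \<le> - ((norm (d k))\<^sup>2 / \<kappa>)"
proof -
  have "0 \<le> \<mu> k * m * (norm (d k))\<^sup>2" using \<mu>_pos[of k] m_pos by simp
  thus ?thesis using slope_le_if[OF generalized_hessian_strongly_convex[OF sc assms hess]] by linarith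
qed

lemma direction_norm_le:
  assumes "x k \<in> ball xbar r"
  shows "norm (d k) \<le> \<kappa> * l * norm (x k - xbar)"
proof -
  have "(norm (d k))\<^sup>2 / \<kappa> \<le> - slope k" using slope_upper[OF assms] by simp
  also have "- slope k \<le> norm (g (x k)) * norm (d k)"
    using norm_cauchy_schwarz[of "- g (x k)" "d k"] by simp
  finally have "norm (d k) \<le> \<kappa> * norm (g (x k))"
    using d_nonzero[of k] \<kappa>_pos by (simp add: power2_eq_square field_simps)
  also have "\<dots> \<le> \<kappa> * (l * norm (x k - xbar))"
    using gradient_upper[OF assms] \<kappa>_pos by (intro mult_left_mono) auto
  finally show ?thesis by simp
qed

lemma norm_square_le_value_gap:
  assumes "y \<in> ball xbar r"
  shows "(norm (y - xbar))\<^sup>2 \<le> 2 * \<kappa> * (\<phi> y - \<phi> xbar)"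
  using growth[OF assms] \<kappa>_pos by (simp add: pos_divide_le_eq mult_ac)

text \<open>A trapping argument: one step from within \<open>\<epsilon>\<close> of
  \<open>xbar\<close> stays in the ball, where growth turns the small, decreasing value gap back
  into distance less than \<open>\<epsilon>\<close>.\<close>

lemma iterates_tendsto: "x \<longlonglongrightarrow> xbar"
proof -
  \<comment> \<open>Bounds the expansion of the distance to \<open>xbar\<close> in one step, since
    \<open>d k\<close> is at most \<open>\<kappa> * l\<close> times that distance.\<close>
  define Q where "Q = 1 + \<tau>max * \<kappa> * l"
  have tm: "\<tau>max > 0" using \<tau>_le[of 0] \<tau>_pos[of 0] by linarith
  have Q1: "Q > 1" using tm \<kappa>_pos l_pos by (simp add: Q_def)
  define \<epsilon> where "\<epsilon> = r / Q"
  have e0: "\<epsilon> > 0" using r_pos Q1 by (simp add: \<epsilon>_def)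
  have er: "\<epsilon> \<le> r" using r_pos Q1 by (simp add: \<epsilon>_def divide_le_eq)
  have stay: "x (Suc k) \<in> ball xbar r" if "norm (x k - xbar) < \<epsilon>" for k
  proof -
    have xk: "x k \<in> ball xbar r" using that er by (simp add: dist_norm norm_minus_commute)
    have "norm (x (Suc k) - xbar) = norm ((x k - xbar) + \<tau> k *\<^sub>R d k)" by (simp add: x_Suc algebra_simps)
    also have "\<dots> \<le> norm (x k - xbar) + \<tau> k * norm (d k)"
      using norm_triangle_ineq[of "x k - xbar" "\<tau> k *\<^sub>R d k"] \<tau>_pos[of k] by simp
    also have "\<dots> \<le> norm (x k - xbar) + \<tau>max * (\<kappa> * l * norm (x k - xbar))"
      using \<tau>_le[of k] direction_norm_le[OF xk] tm by (intro add_left_mono mult_mono) auto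
    also have "\<dots> = Q * norm (x k - xbar)" by (simp add: Q_def algebra_simps)
    also have "\<dots> < Q * \<epsilon>" using that Q1 by simp
    also have "\<dots> = r" using Q1 by (simp add: \<epsilon>_def)
    finally show ?thesis by (simp add: dist_norm norm_minus_commute)
  qed
  have "\<phi> xbar < \<phi> xbar + \<epsilon>\<^sup>2 / (2 * \<kappa>)" using e0 \<kappa>_pos by simp
  from order_tendstoD(2)[OF value_tendsto[OF acc] this]
  obtain K where K: "\<And>k. k \<ge> K \<Longrightarrow> \<phi> (x k) < \<phi> xbar + \<epsilon>\<^sup>2 / (2 * \<kappa>)"
    unfolding eventually_sequentially by blast
  obtain f where f: "strict_mono f" "(x \<circ> f) \<longlonglongrightarrow> xbar" using acc unfolding accumulation_point_def by blast
  from tendstoD[OF f(2) e0] obtain J where J: "\<And>j. j \<ge> J \<Longrightarrow> dist (x (f j)) xbar < \<epsilon>"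
    unfolding eventually_sequentially by auto
  \<comment> \<open>Late in the subsequence, so the iterate is close, and at least \<open>K\<close>
    because \<open>f n \<ge> n\<close>.\<close>
  define k0 where "k0 = f (max J K)"
  have "k0 \<ge> K" using seq_suble[OF f(1), of "max J K"] by (simp add: k0_def)
  have near: "norm (x k - xbar) < \<epsilon>" if "k \<ge> k0" for k
    using that
  proof (induction k rule: dec_induct)
    case base
    show ?case using J[of "max J K"] by (simp add: k0_def dist_norm)
  next
    case (step k)
    have "(norm (x (Suc k) - xbar))\<^sup>2 \<le> 2 * \<kappa> * (\<phi> (x (Suc k)) - \<phi> xbar)"
      by (rule norm_square_le_value_gap[OF stay[OF step.IH]])
    also have "\<dots> < 2 * \<kappa> * (\<epsilon>\<^sup>2 / (2 * \<kappa>))"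
      using K[of "Suc k"] step \<open>k0 \<ge> K\<close> \<kappa>_pos by (intro mult_strict_left_mono) auto
    also have "\<dots> = \<epsilon>\<^sup>2" using \<kappa>_pos by simp
    finally show ?case using e0 by (simp add: power2_less_imp_less)
  qed
  have "(\<lambda>k. x k - xbar) \<longlonglongrightarrow> 0"
  proof (rule Lim_null_comparison)
    show "\<forall>\<^sub>F k in sequentially. norm (x k - xbar) \<le> sqrt (2 * \<kappa> * (\<phi> (x k) - \<phi> xbar))"
      unfolding eventually_sequentially
    proof (intro exI allI impI)
      fix k assume "k0 \<le> k"
      hence "x k \<in> ball xbar r" using near[of k] er by (simp add: dist_norm norm_minus_commute)
      thus "norm (x k - xbar) \<le> sqrt (2 * \<kappa> * (\<phi> (x k) - \<phi> xbar))"
        by (intro real_le_rsqrt norm_square_le_value_gap)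
    qed
    have "(\<lambda>k. sqrt (2 * \<kappa> * (\<phi> (x k) - \<phi> xbar))) \<longlonglongrightarrow> sqrt (2 * \<kappa> * (\<phi> xbar - \<phi> xbar))"
      by (intro tendsto_intros value_tendsto acc)
    thus "(\<lambda>k. sqrt (2 * \<kappa> * (\<phi> (x k) - \<phi> xbar))) \<longlonglongrightarrow> 0" by simp
  qed
  thus ?thesis by (simp add: LIM_zero_iff)
qed

lemma eventually_in_ball: "\<forall>\<^sub>F k in sequentially. x k \<in> ball xbar r"
  using topological_tendstoD[OF iterates_tendsto open_ball xbar_in] .

lemma eventually_Suc_in_ball: "\<forall>\<^sub>F k in sequentially. x (Suc k) \<in> ball xbar r"
  using topological_tendstoD[OF LIMSEQ_Suc[OF iterates_tendsto] open_ball xbar_in] .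

lemma gradients_tendsto: "(\<lambda>k. g (x k)) \<longlonglongrightarrow> 0"
  using isCont_tendsto_compose[OF isCont_gradient iterates_tendsto] by (simp add: critical)

lemma \<mu>_tendsto: "\<mu> \<longlonglongrightarrow> 0"
proof -
  have "(\<lambda>k. norm (g (x k)) powr \<rho>) \<longlonglongrightarrow> 0"
    using tendsto_norm[OF gradients_tendsto] \<rho>_pos by (intro tendsto_zero_powrI) auto
  from tendsto_mult[OF tendsto_const[of c] this] show ?thesis by (simp add: \<mu>_eq[abs_def])
qed

lemma iterate_ne: "x k \<noteq> xbar"
  using noncritical[of k] critical by auto

lemma values_Q_linear: "Q_linear (\<lambda>k. \<phi> (x k)) (\<phi> xbar)"
proof -
  define \<tau>0 where "\<tau>0 = (1 - \<sigma>2) / (l * \<kappa>)"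
  have \<tau>0: "\<tau>0 > 0" using \<sigma>2_less l_pos \<kappa>_pos by (simp add: \<tau>0_def)
  \<comment> \<open>The factor 1 stands for \<open>\<mu> k\<close>, which is eventually below
    1.\<close>
  define N where "N = l + 1 * M"
  have N0: "N > 0" using l_pos M_pos by (simp add: N_def)
  \<comment> \<open>The Armijo decrease is at least \<open>\<sigma>1 * \<tau>0 / \<kappa>\<close>
    times \<open>|d|^2\<close>. The gradient is at most \<open>N |d|\<close>, the distance at most
    \<open>\<kappa>\<close> times the gradient and the gap at most \<open>l / 2\<close> times the
    squared distance; the product is \<open>\<eta>\<close>.\<close>
  define \<eta> where "\<eta> = \<sigma>1 * \<tau>0 * (1 / (\<kappa> * N\<^sup>2)) * (2 / (l * \<kappa>\<^sup>2))"
  have e0: "\<eta> > 0" using \<sigma>1_pos \<tau>0 \<kappa>_pos N0 l_pos by (simp add: \<eta>_def)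
  have "\<forall>\<^sub>F k in sequentially. \<mu> k < 1" using order_tendstoD(2)[OF \<mu>_tendsto] by simp
  with eventually_in_ball eventually_Suc_in_ball
  have "\<forall>\<^sub>F k in sequentially. \<phi> (x (Suc k)) - \<phi> xbar \<le> (1 - \<eta>) * (\<phi> (x k) - \<phi> xbar)"
  proof eventually_elim
    case (elim k)
    define D where "D = (norm (d k))\<^sup>2"
    have D0: "D > 0" using d_nonzero[of k] by (simp add: D_def)
    have sl: "D / \<kappa> \<le> - slope k" using slope_upper[OF elim(1)] by (simp add: D_def)
    have "(1 - \<sigma>2) * (D / \<kappa>) \<le> (1 - \<sigma>2) * - slope k" using sl \<sigma>2_less by (intro mult_left_mono) auto
    also have "\<dots> \<le> l * (\<tau> k * D)" unfolding D_def by (rule curvature_bound[OF lip elim(1,2)])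
    finally have "D * \<tau>0 \<le> D * \<tau> k" using l_pos \<kappa>_pos by (simp add: \<tau>0_def field_simps)
    hence \<tau>: "\<tau>0 \<le> \<tau> k" using D0 by simp
    have "norm (z k) \<le> l * norm (d k)"
      by (rule generalized_hessian_norm_le[OF hess open_ball elim(1) lip])
    from gradient_norm_le[OF this] have "norm (g (x k)) \<le> (l + \<mu> k * M) * norm (d k)" .
    also have "\<dots> \<le> N * norm (d k)"
      unfolding N_def using elim(3) M_pos by (intro mult_right_mono add_left_mono) auto
    finally have gN: "norm (g (x k)) \<le> N * norm (d k)" .
    have "norm (x k - xbar) \<le> \<kappa> * norm (g (x k))" by (rule gradient_lower[OF elim(1)])
    also have "\<dots> \<le> \<kappa> * (N * norm (d k))" using gN \<kappa>_pos by (intro mult_left_mono) auto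
    finally have "(norm (x k - xbar))\<^sup>2 \<le> (\<kappa> * (N * norm (d k)))\<^sup>2" by (rule power_mono) simp
    also have "\<dots> = \<kappa>\<^sup>2 * N\<^sup>2 * D" by (simp add: D_def power_mult_distrib mult.assoc)
    finally have "l / 2 * (norm (x k - xbar))\<^sup>2 \<le> l / 2 * (\<kappa>\<^sup>2 * N\<^sup>2 * D)"
      using l_pos by (intro mult_left_mono) auto
    hence "\<phi> (x k) - \<phi> xbar \<le> l / 2 * (\<kappa>\<^sup>2 * N\<^sup>2 * D)" using value_upper[OF elim(1)] by linarith
    hence "\<eta> * (\<phi> (x k) - \<phi> xbar) \<le> \<eta> * (l / 2 * (\<kappa>\<^sup>2 * N\<^sup>2 * D))" using e0 by (intro mult_left_mono) auto
    also have "\<dots> = \<sigma>1 * \<tau>0 * (D / \<kappa>)" using l_pos \<kappa>_pos N0 by (simp add: \<eta>_def field_simps)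
    also have "\<dots> \<le> \<sigma>1 * \<tau> k * - slope k"
      using \<tau> sl \<sigma>1_pos \<tau>0 D0 \<kappa>_pos \<tau>_pos[of k] by (intro mult_mono) auto
    finally show ?case using armijo[of k] by (simp add: left_diff_distrib)
  qed
  \<comment> \<open>The maximum with \<open>1 / 2\<close> keeps the factor positive, as
    \<open>Q_linear\<close> demands.\<close>
  hence "\<forall>\<^sub>F k in sequentially. norm (\<phi> (x (Suc k)) - \<phi> xbar) \<le> max (1 / 2) (1 - \<eta>) * norm (\<phi> (x k) - \<phi> xbar)"
  proof eventually_elim
    case (elim k)
    have "(1 - \<eta>) * (\<phi> (x k) - \<phi> xbar) \<le> max (1 / 2) (1 - \<eta>) * (\<phi> (x k) - \<phi> xbar)"
      using value_gt_limit[OF acc, of k] by (intro mult_right_mono) auto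
    with elim have "\<phi> (x (Suc k)) - \<phi> xbar \<le> max (1 / 2) (1 - \<eta>) * (\<phi> (x k) - \<phi> xbar)"
      by (rule order_trans)
    thus ?case using value_gt_limit[OF acc, of k] value_gt_limit[OF acc, of "Suc k"] by simp
  qed
  moreover have "0 < max (1 / 2) (1 - \<eta>)" "max (1 / 2) (1 - \<eta>) < 1" using e0 by auto
  moreover have "\<phi> (x k) \<noteq> \<phi> xbar" for k using value_gt_limit[OF acc, of k] by simp
  ultimately show ?thesis unfolding Q_linear_def using value_tendsto[OF acc] by blast
qed

lemma R_linear_rates: "R_linear x xbar" "R_linear (\<lambda>k. g (x k)) 0"
proof -
  obtain \<theta> C where th: "0 < \<theta>" "\<theta> < 1" and C: "0 < C"
    and ev: "\<forall>\<^sub>F k in sequentially. norm (\<phi> (x k) - \<phi> xbar) \<le> C * \<theta> ^ k"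
    using Q_linear_imp_R_bound[OF values_Q_linear] by blast
  have sq: "\<forall>\<^sub>F k in sequentially. (norm (x k - xbar))\<^sup>2 \<le> 2 * \<kappa> * C * \<theta> ^ k"
    using ev eventually_in_ball
  proof eventually_elim
    case (elim k)
    have "(norm (x k - xbar))\<^sup>2 \<le> 2 * \<kappa> * (\<phi> (x k) - \<phi> xbar)" by (rule norm_square_le_value_gap[OF elim(2)])
    also have "\<dots> \<le> 2 * \<kappa> * (C * \<theta> ^ k)" using elim(1) \<kappa>_pos by (intro mult_left_mono) auto
    finally show ?case by (simp add: mult.assoc)
  qed
  show "R_linear x xbar"
    by (rule R_linear_if_square_dominated[OF iterates_tendsto iterate_ne th _ sq]) (use \<kappa>_pos C in simp)
  have "\<forall>\<^sub>F k in sequentially. (norm (g (x k) - 0))\<^sup>2 \<le> l\<^sup>2 * (2 * \<kappa> * C) * \<theta> ^ k"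
    using sq eventually_in_ball
  proof eventually_elim
    case (elim k)
    have "(norm (g (x k)))\<^sup>2 \<le> (l * norm (x k - xbar))\<^sup>2"
      by (intro power_mono gradient_upper[OF elim(2)]) auto
    also have "\<dots> = l\<^sup>2 * (norm (x k - xbar))\<^sup>2" by (simp add: power_mult_distrib)
    also have "\<dots> \<le> l\<^sup>2 * (2 * \<kappa> * C * \<theta> ^ k)" using elim(1) by (intro mult_left_mono) auto
    finally show ?case by (simp add: mult.assoc)
  qed
  thus "R_linear (\<lambda>k. g (x k)) 0"
    by (rule R_linear_if_square_dominated[OF gradients_tendsto noncritical th, rotated]) (use \<kappa>_pos C l_pos in simp)
qed

lemma newton_direction_superlinear:
  assumes ss: "semismooth_star (single g) xbar (g xbar)" and e0: "\<epsilon> > 0"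
  shows "\<forall>\<^sub>F k in sequentially. norm (x k + d k - xbar) \<le> \<epsilon> * norm (x k - xbar)"
proof -
  \<comment> \<open>Half of \<open>\<epsilon>\<close> is for the semismoothness error, half for the
    residual of norm \<open>\<mu> k * norm (b k)\<close>; the factor \<open>\<kappa>\<close> of the
    step estimate is divided out.\<close>
  define e where "e = \<epsilon> / (2 * \<kappa>)"
  have "e > 0" using e0 \<kappa>_pos by (simp add: e_def)
  obtain \<delta> where d0: "\<delta> > 0" and \<delta>: "\<And>y u v. y \<in> ball xbar \<delta> \<Longrightarrow> v \<in> generalized_hessian \<phi> y u \<Longrightarrow>
      norm (y + u - xbar) \<le> \<kappa> * (norm (g y + v) + e * norm (y - xbar))"
    using newton_step_estimate[OF sc \<kappa>_pos r_pos ss critical \<open>e > 0\<close>] by blast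
  have "\<forall>\<^sub>F k in sequentially. x k \<in> ball xbar \<delta>"
    using topological_tendstoD[OF iterates_tendsto open_ball, of xbar \<delta>] d0 by simp
  moreover have "(\<lambda>k. \<mu> k * (M * \<kappa> * l)) \<longlonglongrightarrow> 0 * (M * \<kappa> * l)" by (intro tendsto_intros \<mu>_tendsto)
  hence "\<forall>\<^sub>F k in sequentially. \<mu> k * (M * \<kappa> * l) < e"
    using \<open>e > 0\<close> by (intro order_tendstoD(2)[of _ 0]) auto
  ultimately show ?thesis using eventually_in_ball
  proof eventually_elim
    case (elim k)
    have "g (x k) = - (z k + \<mu> k *\<^sub>R b k)" using newton[of k] by (metis minus_minus)
    hence "g (x k) + z k = - (\<mu> k *\<^sub>R b k)" by simp
    hence "norm (g (x k) + z k) = \<mu> k * norm (b k)" using \<mu>_pos[of k] by simp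
    also have "\<dots> \<le> \<mu> k * (M * norm (d k))" using b_le[of k] \<mu>_pos[of k] by (intro mult_left_mono) auto
    also have "\<dots> \<le> \<mu> k * (M * (\<kappa> * l * norm (x k - xbar)))"
      using direction_norm_le[OF elim(3)] \<mu>_pos[of k] M_pos by (intro mult_left_mono) auto
    also have "\<dots> = \<mu> k * (M * \<kappa> * l) * norm (x k - xbar)" by (simp add: mult_ac)
    also have "\<dots> \<le> e * norm (x k - xbar)" using elim(2) by (intro mult_right_mono) auto
    finally have "norm (g (x k) + z k) + e * norm (x k - xbar) \<le> 2 * e * norm (x k - xbar)" by simp
    hence "\<kappa> * (norm (g (x k) + z k) + e * norm (x k - xbar)) \<le> \<kappa> * (2 * e * norm (x k - xbar))"
      using \<kappa>_pos by (intro mult_left_mono) auto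
    also have "\<dots> = \<epsilon> * norm (x k - xbar)" using \<kappa>_pos by (simp add: e_def)
    finally show ?case using \<delta>[OF elim(1) hess] by linarith
  qed
qed

text \<open>The full step lands at \<open>xbar + e\<close> with \<open>e\<close> of lower order. The
  value gap there is negligible, so Armijo reduces to the surplus \<open>dec\<close> at
  \<open>x k\<close>; the gradient there is negligible against the slope, which settles curvature.
  The algorithm prefers 1 whenever it passes.\<close>

lemma eventually_unit_step:
  assumes ss: "semismooth_star (single g) xbar (g xbar)" and \<eta>: "\<eta> > 0"
    and dec: "\<forall>\<^sub>F y in nhds xbar. \<sigma>1 * inner (g y) (y - xbar) + \<eta> * (norm (y - xbar))\<^sup>2 \<le> \<phi> y - \<phi> xbar"
  shows "\<forall>\<^sub>F k in sequentially. \<tau> k = 1"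
proof -
  \<comment> \<open>The first entry gives \<open>|h| \<le> 2 |d|\<close>, the second serves the
    curvature test, the third the Armijo test.\<close>
  define \<epsilon> where "\<epsilon> = min (1 / 2) (min (\<sigma>2 / (2 * l * \<kappa>)) (\<eta> / (2 * l)))"
  have \<sigma>2_pos: "\<sigma>2 > 0" using \<sigma>1_pos \<sigma>_less by simp
  have e0: "\<epsilon> > 0" using \<sigma>2_pos \<eta> l_pos \<kappa>_pos by (simp add: \<epsilon>_def)
  have eh: "\<epsilon> \<le> 1 / 2" by (simp add: \<epsilon>_def)
  have "\<epsilon> \<le> \<sigma>2 / (2 * l * \<kappa>)" unfolding \<epsilon>_def by linarith
  hence e1: "2 * l * \<epsilon> \<le> \<sigma>2 / \<kappa>" using l_pos \<kappa>_pos by (simp add: field_simps)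
  have "\<epsilon> \<le> \<eta> / (2 * l)" unfolding \<epsilon>_def by linarith
  hence e2: "2 * l * \<epsilon> \<le> \<eta>" using l_pos by (simp add: field_simps)
  have "\<forall>\<^sub>F k in sequentially. \<sigma>1 * inner (g (x k)) (x k - xbar) + \<eta> * (norm (x k - xbar))\<^sup>2 \<le> \<phi> (x k) - \<phi> xbar"
    using dec iterates_tendsto by (rule eventually_compose_filterlim)
  with newton_direction_superlinear[OF ss e0] eventually_in_ball
  show ?thesis
  proof eventually_elim
    case (elim k)
    define h where "h = x k - xbar"
    define e where "e = x k + d k - xbar"
    have d_eq: "d k = e - h" by (simp add: e_def h_def)
    have eh': "norm e \<le> \<epsilon> * norm h" using elim(1) by (simp add: e_def h_def)
    also have "\<dots> \<le> 1 / 2 * norm h" using eh by (rule mult_right_mono) simp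
    finally have half: "norm e \<le> norm h / 2" by simp
    have "norm h \<le> norm e + norm (d k)" using norm_triangle_ineq4[of e "d k"] by (simp add: d_eq)
    hence hd: "norm h \<le> 2 * norm (d k)" using half by linarith
    have "norm e \<le> norm h" using half norm_ge_zero[of h] by linarith
    hence new_in: "x k + d k \<in> ball xbar r"
      using elim(2) unfolding e_def h_def mem_ball dist_norm by (metis norm_minus_commute order_le_less_trans)
    have gnew: "norm (g (x k + d k)) \<le> l * norm e"
      using gradient_upper[OF new_in] by (simp add: e_def)
    have curv: "\<sigma>2 * slope k \<le> inner (g (x k + d k)) (d k)"
    proof -
      have "inner (- g (x k + d k)) (d k) \<le> norm (- g (x k + d k)) * norm (d k)" by (rule norm_cauchy_schwarz)
      also have "\<dots> \<le> (l * (\<epsilon> * (2 * norm (d k)))) * norm (d k)"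
      proof (intro mult_right_mono)
        have "l * norm e \<le> l * (\<epsilon> * norm h)" using eh' l_pos by (intro mult_left_mono) auto
        also have "\<dots> \<le> l * (\<epsilon> * (2 * norm (d k)))" using hd e0 l_pos by (intro mult_left_mono) auto
        finally show "norm (- g (x k + d k)) \<le> l * (\<epsilon> * (2 * norm (d k)))" using gnew by simp
      qed simp
      also have "\<dots> = 2 * l * \<epsilon> * (norm (d k))\<^sup>2" by (simp add: power2_eq_square)
      also have "\<dots> \<le> \<sigma>2 / \<kappa> * (norm (d k))\<^sup>2" using e1 by (intro mult_right_mono) auto
      also have "\<dots> \<le> \<sigma>2 * - slope k"
        using mult_left_mono[OF slope_upper[OF elim(2)], of \<sigma>2] \<sigma>2_pos by simp
      finally show ?thesis by simp
    qed
    have arm: "\<phi> (x k + d k) \<le> \<phi> (x k) + \<sigma>1 * slope k"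
    proof -
      have "\<phi> (x k + d k) - \<phi> xbar \<le> l / 2 * (norm e)\<^sup>2"
        using value_upper[OF new_in] by (simp add: e_def)
      also have "\<dots> \<le> l / 2 * (\<epsilon> * (norm h)\<^sup>2)"
      proof (intro mult_left_mono)
        have "norm e * norm e \<le> (\<epsilon> * norm h) * norm h"
          using eh' \<open>norm e \<le> norm h\<close> e0 by (intro mult_mono) auto
        thus "(norm e)\<^sup>2 \<le> \<epsilon> * (norm h)\<^sup>2" by (simp add: power2_eq_square)
      qed (use l_pos in simp)
      finally have 1: "\<phi> (x k + d k) - \<phi> xbar \<le> l / 2 * (\<epsilon> * (norm h)\<^sup>2)" .
      have "- inner (g (x k)) e \<le> norm (g (x k)) * norm e"
        using norm_cauchy_schwarz[of "- g (x k)" e] by simp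
      also have "\<dots> \<le> (l * norm h) * (\<epsilon> * norm h)"
        using gradient_upper[OF elim(2)] eh' l_pos by (intro mult_mono) (auto simp: h_def)
      finally have "\<sigma>1 * - inner (g (x k)) e \<le> 1 * (l * norm h * (\<epsilon> * norm h))"
        using \<sigma>1_pos \<sigma>_less \<sigma>2_less e0 l_pos
        by (meson less_imp_le less_trans mult_left_mono mult_right_mono order_trans mult_nonneg_nonneg norm_ge_zero)
      hence 2: "\<sigma>1 * - inner (g (x k)) e \<le> l * (\<epsilon> * (norm h)\<^sup>2)" by (simp add: power2_eq_square mult_ac)
      \<comment> \<open>The value at the new point contributes \<open>l * \<epsilon> / 2\<close>,
        the pairing with \<open>e\<close> contributes \<open>l * \<epsilon>\<close>.\<close>
      have "3 / 2 * (l * \<epsilon>) \<le> \<eta>" using e2 l_pos e0 mult_pos_pos[of l \<epsilon>] by linarith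
      hence "3 / 2 * (l * \<epsilon>) * (norm h)\<^sup>2 \<le> \<eta> * (norm h)\<^sup>2" by (rule mult_right_mono) simp
      moreover have "\<sigma>1 * slope k = \<sigma>1 * inner (g (x k)) e - \<sigma>1 * inner (g (x k)) h"
        by (simp add: d_eq inner_diff_right right_diff_distrib)
      moreover have "\<sigma>1 * inner (g (x k)) h + \<eta> * (norm h)\<^sup>2 \<le> \<phi> (x k) - \<phi> xbar"
        using elim(3) by (simp add: h_def)
      ultimately show ?thesis using 1 2 by (simp add: algebra_simps)
    qed
    have "wolfe \<phi> \<sigma>1 \<sigma>2 (x k) (d k) 1" unfolding wolfe_def using arm curv by simp
    thus ?case using step[of k] by simp
  qed
qed

lemma superlinear_rates:
  assumes ss: "semismooth_star (single g) xbar (g xbar)" and \<eta>: "\<eta> > 0"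
    and dec: "\<forall>\<^sub>F y in nhds xbar. \<sigma>1 * inner (g y) (y - xbar) + \<eta> * (norm (y - xbar))\<^sup>2 \<le> \<phi> y - \<phi> xbar"
  shows "Q_superlinear x xbar" "Q_superlinear (\<lambda>k. \<phi> (x k)) (\<phi> xbar)" "Q_superlinear (\<lambda>k. g (x k)) 0"
proof -
  have sup: "\<forall>\<^sub>F k in sequentially. norm (x (Suc k) - xbar) \<le> \<epsilon> * norm (x k - xbar)" if "\<epsilon> > 0" for \<epsilon>
    using eventually_unit_step[OF ss \<eta> dec] newton_direction_superlinear[OF ss that]
    by eventually_elim (simp add: x_Suc)
  show "Q_superlinear x xbar"
    by (rule Q_superlinearI[OF iterates_tendsto iterate_ne sup])
  show "Q_superlinear (\<lambda>k. g (x k)) 0"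
  proof (rule Q_superlinearI[OF gradients_tendsto noncritical])
    fix \<epsilon> :: real assume "\<epsilon> > 0"
    hence "\<epsilon> / (l * \<kappa>) > 0" using l_pos \<kappa>_pos by simp
    from sup[OF this] eventually_in_ball eventually_Suc_in_ball
    show "\<forall>\<^sub>F k in sequentially. norm (g (x (Suc k)) - 0) \<le> \<epsilon> * norm (g (x k) - 0)"
    proof eventually_elim
      case (elim k)
      have "norm (g (x (Suc k))) \<le> l * norm (x (Suc k) - xbar)" by (rule gradient_upper[OF elim(3)])
      also have "\<dots> \<le> l * (\<epsilon> / (l * \<kappa>) * norm (x k - xbar))" using elim(1) l_pos by (intro mult_left_mono) auto
      also have "\<dots> \<le> l * (\<epsilon> / (l * \<kappa>) * (\<kappa> * norm (g (x k))))"
        using gradient_lower[OF elim(2)] l_pos \<kappa>_pos \<open>\<epsilon> > 0\<close> by (intro mult_left_mono) auto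
      also have "\<dots> = \<epsilon> * norm (g (x k))" using l_pos \<kappa>_pos by simp
      finally show ?case by simp
    qed
  qed
  show "Q_superlinear (\<lambda>k. \<phi> (x k)) (\<phi> xbar)"
  proof (rule Q_superlinearI[OF value_tendsto[OF acc]])
    show "\<phi> (x k) \<noteq> \<phi> xbar" for k using value_gt_limit[OF acc, of k] by simp
    fix \<epsilon> :: real assume "\<epsilon> > 0"
    \<comment> \<open>Gaps lie between \<open>1 / (2 * \<kappa>)\<close> and \<open>l / 2\<close>
      times squared distances, so contraction of distances by \<open>e\<close> contracts gaps by
      \<open>l * \<kappa> * e^2\<close>.\<close>
    define e where "e = sqrt (\<epsilon> / (l * \<kappa>))"
    have "e > 0" using \<open>\<epsilon> > 0\<close> l_pos \<kappa>_pos by (simp add: e_def)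
    have ee: "e\<^sup>2 = \<epsilon> / (l * \<kappa>)" using \<open>\<epsilon> > 0\<close> l_pos \<kappa>_pos by (simp add: e_def)
    from sup[OF \<open>e > 0\<close>] eventually_in_ball eventually_Suc_in_ball
    show "\<forall>\<^sub>F k in sequentially. norm (\<phi> (x (Suc k)) - \<phi> xbar) \<le> \<epsilon> * norm (\<phi> (x k) - \<phi> xbar)"
    proof eventually_elim
      case (elim k)
      have "\<phi> (x (Suc k)) - \<phi> xbar \<le> l / 2 * (norm (x (Suc k) - xbar))\<^sup>2" by (rule value_upper[OF elim(3)])
      also have "\<dots> \<le> l / 2 * (e * norm (x k - xbar))\<^sup>2"
        using elim(1) l_pos by (intro mult_left_mono power_mono) auto
      also have "\<dots> = l / 2 * e\<^sup>2 * (norm (x k - xbar))\<^sup>2" by (simp add: power_mult_distrib)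
      also have "\<dots> \<le> l / 2 * e\<^sup>2 * (2 * \<kappa> * (\<phi> (x k) - \<phi> xbar))"
        using norm_square_le_value_gap[OF elim(2)] l_pos by (intro mult_left_mono) auto
      also have "\<dots> = \<epsilon> * (\<phi> (x k) - \<phi> xbar)" unfolding ee using l_pos \<kappa>_pos by simp
      finally show ?case
        using value_gt_limit[OF acc, of k] value_gt_limit[OF acc, of "Suc k"] by simp
    qed
  qed
qed

end

theorem theorem6:
  fixes \<phi> :: "real^'n \<Rightarrow> real"
    and x0 xbar :: "real^'n"
    and x d :: "nat \<Rightarrow> real^'n"
    and B :: "nat \<Rightarrow> real^'n^'n"
    and \<tau> :: "nat \<Rightarrow> real"
    and c \<sigma>1 \<sigma>2 \<rho> \<tau>max m_lower m_upper :: real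
  assumes "C11 \<phi>"
    and "bdd_below (range \<phi>)"
    and "\<And>y. \<phi> y \<le> \<phi> x0 \<Longrightarrow> positive_semidefinite_mapping (generalized_hessian \<phi> y)"
    and "GRNM_W_infinite_run \<phi> c \<sigma>1 \<sigma>2 \<rho> \<tau>max x0 x B d \<tau>"
    and "0 < m_lower" and "m_lower \<le> m_upper"
    and "\<And>k e. eigenvalue (B k) e \<Longrightarrow> e \<in> {m_lower^2..m_upper^2}"
    and "accumulation_point x xbar"
    and "\<exists>\<kappa>. metrically_regular \<kappa> (single (gradient \<phi>)) xbar (gradient \<phi> xbar)"
  shows "tilt_stable_local_minimizer \<phi> xbar \<and>
    x \<longlonglongrightarrow> xbar \<and>
    Q_linear (\<lambda>k. \<phi> (x k)) (\<phi> xbar) \<and>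
    R_linear x xbar \<and>
    R_linear (\<lambda>k. gradient \<phi> (x k)) 0 \<and>
    (semismooth_star (single (gradient \<phi>)) xbar (gradient \<phi> xbar) \<and>
     ((directionally_differentiable_at (gradient \<phi>) xbar \<and> \<sigma>1 \<in> {0<..<1/2}) \<or>
      (\<exists>\<kappa> l. metrically_regular \<kappa> (single (gradient \<phi>)) xbar (gradient \<phi> xbar) \<and>
             0 < l \<and> lipschitz_around l (gradient \<phi>) xbar \<and>
             \<sigma>1 \<in> {0<..<1 / (2 * l * \<kappa>)} \<and> \<sigma>2 \<in> {1 - 1 / (l * \<kappa>)<..<1}))
     \<longrightarrow> Q_superlinear x xbar \<and>
         Q_superlinear (\<lambda>k. \<phi> (x k)) (\<phi> xbar) \<and>
         Q_superlinear (\<lambda>k. gradient \<phi> (x k)) 0)"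
proof -
  interpret C11_function \<phi> by unfold_locales fact
  define \<mu> where "\<mu> k = c * norm (g (x k)) powr \<rho>" for k
  note run = assms(4)[unfolded GRNM_W_infinite_run_def Let_def]
  have x0: "x 0 = x0" using run by blast
  have "\<exists>z. \<forall>k. z k \<in> generalized_hessian \<phi> (x k) (d k) \<and> - g (x k) = z k + \<mu> k *\<^sub>R (B k *v d k)"
    using run unfolding \<mu>_def by (intro choice) blast
  then obtain z where z: "\<And>k. z k \<in> generalized_hessian \<phi> (x k) (d k)"
      "\<And>k. - g (x k) = z k + \<mu> k *\<^sub>R (B k *v d k)"
    by blast
  have sym: "transpose (B k) = B k" for k using run unfolding symmetric_positive_definite_def by blast
  have B_ge: "m_lower\<^sup>2 * (norm (d k))\<^sup>2 \<le> inner (B k *v d k) (d k)" for k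
    using symmetric_matrix_form_ge[OF sym[of k] assms(7)[of k], of "d k"] by (simp add: inner_commute)
  have B_le: "norm (B k *v d k) \<le> m_upper\<^sup>2 * norm (d k)" for k
    by (rule symmetric_matrix_norm_le[OF sym[of k] assms(7)[of k]]) (use assms(5,6) in auto)
  interpret newton_run \<phi> x d z "\<lambda>k. B k *v d k" \<tau> \<mu> c \<sigma>1 \<sigma>2 \<rho> \<tau>max "m_lower\<^sup>2" "m_upper\<^sup>2"
    by unfold_locales
      (use assms(2,3,5,6) run z B_ge B_le \<mu>_def x0 in \<open>blast | simp\<close>)+
  have crit: "g xbar = 0" by (rule accumulation_point_critical) fact
  have "\<phi> xbar < \<phi> x0" using value_gt_limit[OF assms(8), of 0] x0 by simp
  hence "xbar \<in> {y. \<phi> y < \<phi> x0}" by simp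
  moreover have "open {y. \<phi> y < \<phi> x0}"
    by (intro open_Collect_less continuous_function continuous_on_const)
  ultimately obtain R where R: "0 < R" "ball xbar R \<subseteq> {y. \<phi> y < \<phi> x0}" using openE by blast
  have psd_near: "positive_semidefinite_mapping (generalized_hessian \<phi> y)" if "y \<in> ball xbar R" for y
    using assms(3)[of y] R(2) that by (auto simp: less_imp_le)
  \<comment> \<open>Stated for every modulus: one fixed \<open>\<kappa>\<close> drives the linear
    rates, while (b) is evaluated with its own.\<close>
  have tilt: "tilt_stable_local_minimizer \<phi> xbar \<and> (\<exists>r>0. strongly_convex_near \<kappa> xbar r)"
    if "metrically_regular \<kappa> (single g) xbar (g xbar)" for \<kappa>
    using that unfolding crit by (rule tilt_stable_and_strongly_convex[OF _ crit R(1) psd_near])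
  obtain \<kappa> where \<kappa>: "metrically_regular \<kappa> (single g) xbar (g xbar)" using assms(9) by blast
  hence k0: "0 < \<kappa>" by (simp add: metrically_regular_def)
  obtain r1 where r1: "0 < r1" "strongly_convex_near \<kappa> xbar r1" using tilt[OF \<kappa>] by blast
  obtain l r2 where l: "0 < l" "0 < r2" "l-lipschitz_on (ball xbar r2) g" by (rule lipschitz_near)
  define r where "r = min r1 r2"
  have r0: "0 < r" and sc: "strongly_convex_near \<kappa> xbar r" and lip: "l-lipschitz_on (ball xbar r) g"
    using r1 l unfolding r_def strongly_convex_near_def by (auto intro: lipschitz_on_subset)
  interpret newton_run_near_minimizer \<phi> x d z "\<lambda>k. B k *v d k" \<tau> \<mu> c \<sigma>1 \<sigma>2 \<rho> \<tau>max "m_lower\<^sup>2" "m_upper\<^sup>2" xbar \<kappa> r l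
    by unfold_locales (use assms(8) sc k0 r0 lip l(1) in auto)
  have "Q_superlinear x xbar \<and> Q_superlinear (\<lambda>k. \<phi> (x k)) (\<phi> xbar) \<and> Q_superlinear (\<lambda>k. g (x k)) 0"
    if ss: "semismooth_star (single g) xbar (g xbar)"
      and ab: "(directionally_differentiable_at g xbar \<and> \<sigma>1 \<in> {0<..<1/2}) \<or>
      (\<exists>\<kappa> l. metrically_regular \<kappa> (single g) xbar (g xbar) \<and>
             0 < l \<and> lipschitz_around l g xbar \<and>
             \<sigma>1 \<in> {0<..<1 / (2 * l * \<kappa>)} \<and> \<sigma>2 \<in> {1 - 1 / (l * \<kappa>)<..<1})"
  proof -
    have "\<exists>\<eta>>0. \<forall>\<^sub>F y in nhds xbar. \<sigma>1 * inner (g y) (y - xbar) + \<eta> * (norm (y - xbar))\<^sup>2 \<le> \<phi> y - \<phi> xbar"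
      using ab
    proof
      assume "directionally_differentiable_at g xbar \<and> \<sigma>1 \<in> {0<..<1/2}"
      thus ?thesis by (intro sufficient_decrease_if_directionally_differentiable[OF sc r0 k0 crit]) auto
    next
      assume "\<exists>\<kappa> l. metrically_regular \<kappa> (single g) xbar (g xbar) \<and>
             0 < l \<and> lipschitz_around l g xbar \<and>
             \<sigma>1 \<in> {0<..<1 / (2 * l * \<kappa>)} \<and> \<sigma>2 \<in> {1 - 1 / (l * \<kappa>)<..<1}"
      \<comment> \<open>These moduli are independent of those in the locale; they enter only through
        the surplus inequality.\<close>
      then obtain \<kappa>' l' where b: "metrically_regular \<kappa>' (single g) xbar (g xbar)" "0 < l'"
        "lipschitz_around l' g xbar" "0 < \<sigma>1" "\<sigma>1 < 1 / (2 * l' * \<kappa>')" by auto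
      have "0 < \<kappa>'" using b(1) by (simp add: metrically_regular_def)
      moreover obtain r' where "0 < r'" "strongly_convex_near \<kappa>' xbar r'" using tilt[OF b(1)] by blast
      ultimately show ?thesis using sufficient_decrease_if_moduli crit b by blast
    qed
    then obtain \<eta> where "\<eta> > 0"
      "\<forall>\<^sub>F y in nhds xbar. \<sigma>1 * inner (g y) (y - xbar) + \<eta> * (norm (y - xbar))\<^sup>2 \<le> \<phi> y - \<phi> xbar" by blast
    from superlinear_rates[OF ss this] show ?thesis by blast
  qed
  thus ?thesis using tilt[OF \<kappa>] iterates_tendsto values_Q_linear R_linear_rates by blast
qed

end
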